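(* Let $n>2$ be an integer not congruent to $2$ modulo $4$, let $\zeta_n$ be a primitive $n$-th root of unity, and let $L$ be a number field over which the $n$-th cyclotomic polynomial is irreducible. Then $\mathcal{O}_L[\zeta_n]=\mathcal{O}_{L(\zeta_n)}$ if and only if $\gcd(n,\Delta_L)=1$.
   Context: $\mathcal{O}_F$ denotes the ring of integers of a number field $F$, and $\Delta_L$ denotes the (absolute) discriminant of the number field $L$. *)

theory Defs
  imports
    "HOL-Computational_Algebra.Polynomial"
    "HOL-Number_Theory.Cong"
    "Jordan_Normal_Form.Determinant"
begin

text \<open>
  Number fields are subfields, of finite degree over the rationals, of an arbitrary ambient field
  of characteristic zero. The ambient field is a type and is not assumed to be algebraically closed,
  nor algebraic over the rationals.
\<close>

global_interpretation rat_vec: Vector_Spaces.vector_space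
  "\<lambda>(q :: rat) (x :: 'a :: field_char_0). of_rat q * x"
  by unfold_locales (simp_all add: algebra_simps of_rat_add of_rat_mult)

global_interpretation int_mod: Modules.module
  "\<lambda>(k :: int) (x :: 'a :: field_char_0). of_int k * x"
  by unfold_locales (simp_all add: algebra_simps)

definition is_subfield :: "'a :: field set \<Rightarrow> bool" where
  "is_subfield K \<longleftrightarrow>
     0 \<in> K \<and> 1 \<in> K \<and>
     (\<forall>x\<in>K. \<forall>y\<in>K. x + y \<in> K \<and> x * y \<in> K) \<and>
     (\<forall>x\<in>K. - x \<in> K \<and> inverse x \<in> K)"

definition number_field :: "'a :: field_char_0 set \<Rightarrow> bool" where
  "number_field L \<longleftrightarrow> is_subfield L \<and> (\<exists>B. finite B \<and> rat_vec.span B = L)"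

definition ring_of_integers :: "'a :: field_char_0 set \<Rightarrow> 'a set" where
  "ring_of_integers L = {x \<in> L. algebraic_int x}"

definition polys_over :: "'a :: comm_ring_1 set \<Rightarrow> 'a poly set" where
  "polys_over R = {p. \<forall>i. coeff p i \<in> R}"

definition adjoin_ring :: "'a :: comm_ring_1 set \<Rightarrow> 'a \<Rightarrow> 'a set" where
  "adjoin_ring R a = (\<lambda>p. poly p a) ` polys_over R"

definition adjoin_field :: "'a :: field set \<Rightarrow> 'a \<Rightarrow> 'a set" where
  "adjoin_field K a = is_subfield hull (insert a K)"

definition irreducible_over :: "'a :: field set \<Rightarrow> 'a poly \<Rightarrow> bool" where
  "irreducible_over K p \<longleftrightarrow>
     p \<in> polys_over K \<and> degree p > 0 \<and>
     (\<forall>q\<in>polys_over K. \<forall>r\<in>polys_over K. p = q * r \<longrightarrow> degree q = 0 \<or> degree r = 0)"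

definition primitive_root_of_unity :: "nat \<Rightarrow> 'a :: field \<Rightarrow> bool" where
  "primitive_root_of_unity n z \<longleftrightarrow> n > 0 \<and> z ^ n = 1 \<and> (\<forall>k. 0 < k \<and> k < n \<longrightarrow> z ^ k \<noteq> 1)"

text \<open>
  This is the image of the cyclotomic polynomial in the polynomial ring over the ambient field as
  soon as that field contains a primitive \<open>n\<close>-th root of unity (otherwise it is the constant 1).
\<close>

definition cyclotomic_poly :: "nat \<Rightarrow> 'a :: field_char_0 poly" where
  "cyclotomic_poly n = (\<Prod>z | primitive_root_of_unity n z. [:- z, 1:])"

text \<open>
  The trace from \<open>L\<close> to the rationals of \<open>x\<close>: the trace of multiplication by \<open>x\<close> on \<open>L\<close>, which does
  not depend on the chosen basis.
\<close>

definition field_trace :: "'a :: field_char_0 set \<Rightarrow> 'a \<Rightarrow> rat" where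
  "field_trace L x =
     (let B = (SOME B. rat_vec.independent B \<and> rat_vec.span B = L)
      in \<Sum>b\<in>B. rat_vec.representation B (x * b) b)"

definition integral_basis :: "'a :: field_char_0 set \<Rightarrow> 'a list \<Rightarrow> bool" where
  "integral_basis L bs \<longleftrightarrow>
     distinct bs \<and> int_mod.independent (set bs) \<and> int_mod.span (set bs) = ring_of_integers L"

definition discriminant :: "'a :: field_char_0 set \<Rightarrow> int" where
  "discriminant L =
     (THE d. \<exists>bs. integral_basis L bs \<and>
        of_int d =
          det (mat (length bs) (length bs) (\<lambda>(i, j). field_trace L (bs ! i * bs ! j))))"

end

theory Submission
  imports Defs "Jordan_Normal_Form.Schur_Decomposition" "HOL-Number_Theory.Residues"
begin

hide_const (open) up_ring.coeff up_ring.monom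

text \<open>
  Both sides are tested one prime \<open>p\<close> dividing \<open>n\<close> at a time. Write \<open>O\<close> for the integers of \<open>L\<close>.

  First, \<open>p\<close> divides the discriminant iff \<open>O / p\<close> has nonzero nilpotents. Nilpotents have trace zero, so
  they lie in the radical of the trace form. Conversely, in a reduced \<open>O / p\<close> a minimal ideal inside the
  radical would be a finite field whose elements all have trace zero, which the identity
  \<open>(\<Sum>u\<noteq>0. Tr u / u) = - 1\<close> excludes.

  If \<open>O / p\<close> is reduced, let \<open>n = p ^ a * m\<close> with \<open>p\<close> not dividing \<open>m\<close>, and split \<open>\<zeta> = \<omega> * \<eta>\<close> into roots of unity of
  order \<open>m\<close> and \<open>p ^ a\<close>. Fourier inversion over the conjugates of \<open>\<omega>\<close> shows that \<open>O[\<omega>] / p\<close> is reduced; it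
  surjects onto \<open>O[\<zeta>] / \<pi>\<close> with \<open>\<pi> = 1 - \<eta>\<close>. If \<open>x\<close> is integral and \<open>\<pi> x \<in> O[\<zeta>]\<close>, then \<open>\<pi> x\<close> is nilpotent modulo \<open>\<pi>\<close>,
  hence divisible by \<open>\<pi>\<close>, so \<open>x \<in> O[\<zeta>]\<close>. As a power of \<open>\<pi>\<close> is divisible by \<open>p\<close>, and as \<open>n x \<in> O[\<zeta>]\<close> for every
  integral \<open>x \<in> L(\<zeta>)\<close> (again by Fourier inversion), \<open>O[\<zeta>]\<close> is the full ring of integers.

  If \<open>v \<in> O\<close> is not divisible by \<open>p\<close> but \<open>v ^ 2\<close> is, let \<open>\<rho> = 1 - \<kappa>\<close> with \<open>\<kappa>\<close> of order \<open>p\<close> (order 4 if \<open>p = 2\<close>).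
  Then \<open>\<rho> ^ 2\<close> divides \<open>p\<close>, so \<open>v / \<rho>\<close> is integral; but it is not in \<open>O[\<zeta>]\<close>, as \<open>p / \<rho>\<close> is not divisible by \<open>p\<close> in the
  free \<open>\<int>\<close>-module \<open>\<int>[\<zeta>]\<close>.
\<close>

section \<open>Algebraic integers\<close>

text \<open>Divisibility by \<open>p\<close> is always an explicit equation inside some subring of
  the ambient field; prime ideals and quotient rings are avoided. The recurring tool is that
  \<open>p\<close>-power maps are additive modulo \<open>p\<close>: it carries nilpotency through
  sums, in the trace as well as in Fourier coefficients. Since the ambient field need not contain
  the conjugates of \<open>L\<close>, traces are computed from complex eigenvalues of multiplication
  matrices. Irreducibility of the cyclotomic polynomial takes the place of Galois theory: a
  polynomial over \<open>L\<close> that vanishes at one primitive root vanishes at all of them, so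
  another root may be substituted for \<zeta>. The condition modulo 4 matters at
  \<open>p = 2\<close>: a root of unity of order 2 would only give \<open>\<rho> = 2\<close>, whose
  square does not divide 2, whereas order 4 gives an element whose square is 2 up to a unit.\<close>

lemma algebraic_int_eigenvalue:
  fixes x :: "'a :: field_char_0" and v :: "nat \<Rightarrow> 'a" and A :: "nat \<Rightarrow> nat \<Rightarrow> int"
  assumes nz: "\<exists>i<n. v i \<noteq> 0"
    and eig: "\<And>i. i < n \<Longrightarrow> x * v i = (\<Sum>j<n. of_int (A i j) * v j)"
  shows "algebraic_int x"
proof -
  define M where "M = mat n n (\<lambda>(i, j). A i j)"
  define N :: "'a mat" where "N = map_mat of_int M"
  have M: "M \<in> carrier_mat n n" by (simp add: M_def)
  hence N: "N \<in> carrier_mat n n" by (simp add: N_def)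
  have "eigenvector N (vec n v) x"
    unfolding eigenvector_def
  proof (intro conjI)
    show "vec n v \<in> carrier_vec (dim_row N)" using N by simp
    show "vec n v \<noteq> 0\<^sub>v (dim_row N)"
    proof
      assume "vec n v = 0\<^sub>v (dim_row N)"
      hence "vec n v $ i = 0" if "i < n" for i using that N by simp
      thus False using nz by auto
    qed
    show "N *\<^sub>v vec n v = x \<cdot>\<^sub>v vec n v"
      by (rule eq_vecI) (use eig in \<open>auto simp: N_def M_def scalar_prod_def lessThan_atLeast0\<close>)
  qed
  hence "eigenvalue N x" unfolding eigenvalue_def by blast
  hence "poly (char_poly N) x = 0" using eigenvalue_root_char_poly[OF N] by simp
  \<comment> \<open>The characteristic polynomial of an integer matrix is monic with integer
    coefficients; it is the integral equation for \<open>x\<close>.\<close>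
  moreover have cp: "char_poly N = map_poly of_int (char_poly M)"
    unfolding N_def by (rule of_int_hom.char_poly_hom[OF M])
  moreover have "lead_coeff (char_poly N) = 1" using degree_monic_char_poly[OF N] by auto
  ultimately show ?thesis
    by (intro algebraic_int.intros[of "char_poly N"]) (auto simp: cp coeff_map_poly)
qed

lemma int_span_mult_left:
  assumes "\<And>s. s \<in> S \<Longrightarrow> x * s \<in> int_mod.span T" and "y \<in> int_mod.span S"
  shows "x * y \<in> int_mod.span T"
  using assms(2)
proof (induction rule: int_mod.span_induct_alt)
  case base
  show ?case by (simp add: int_mod.span_zero)
next
  case (step c s y)
  have "of_int c * (x * s) + x * y \<in> int_mod.span T"
    by (intro int_mod.span_add int_mod.span_scale step assms)
  thus ?case by (simp add: algebra_simps)
qed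

text \<open>Determinant trick: multiplication by \<open>x\<close> is given by an integer matrix on
  the generators, and the vector of generators is itself an eigenvector. The element
  \<open>s\<close> keeps that vector nonzero.\<close>

lemma algebraic_int_if_stable_span:
  fixes x :: "'a :: field_char_0"
  assumes "finite S" "s \<in> S" "s \<noteq> 0" and stable: "\<And>s. s \<in> S \<Longrightarrow> x * s \<in> int_mod.span S"
  shows "algebraic_int x"
proof -
  obtain v where v: "bij_betw v {..<card S} S"
    using assms(1) by (metis ex_bij_betw_nat_finite lessThan_atLeast0)
  have "\<exists>u. x * s = (\<Sum>t\<in>S. of_int (u t) * t)" if "s \<in> S" for s
    using stable[OF that] unfolding int_mod.span_finite[OF assms(1)] by auto
  then obtain u where u: "\<And>s. s \<in> S \<Longrightarrow> x * s = (\<Sum>t\<in>S. of_int (u s t) * t)" by metis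
  show ?thesis
  proof (rule algebraic_int_eigenvalue[where v = v and n = "card S" and A = "\<lambda>i j. u (v i) (v j)"])
    show "\<exists>i<card S. v i \<noteq> 0"
      using v assms(2,3) by (force simp: bij_betw_def)
    fix i assume "i < card S"
    hence "v i \<in> S" using v by (auto simp: bij_betw_def)
    from u[OF this] show "x * v i = (\<Sum>j<card S. of_int (u (v i) (v j)) * v j)"
      by (simp add: sum.reindex_bij_betw[OF v, where g = "\<lambda>t. of_int (u (v i) t) * t"])
  qed
qed

lemma algebraic_int_power_in_span:
  assumes "algebraic_int (x :: 'a :: field_char_0)"
  obtains k where "k > 0" "x ^ k \<in> int_mod.span ((\<lambda>i. x ^ i) ` {..<k})"
proof -
  from assms obtain p where p: "lead_coeff p = 1" "\<And>i. coeff p i \<in> \<int>" "poly p x = 0"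
    by (auto elim: algebraic_int.cases)
  define k where "k = degree p"
  have "k > 0"
  proof (rule ccontr)
    assume "\<not> k > 0"
    hence "degree p = 0" by (simp add: k_def)
    with p show False by (metis degree_eq_zeroE coeff_pCons_0 degree_pCons_0 poly_const_conv zero_neq_one)
  qed
  have "0 = (\<Sum>i\<le>k. coeff p i * x ^ i)" using p(3) by (simp add: poly_altdef k_def)
  also have "\<dots> = (\<Sum>i<k. coeff p i * x ^ i) + x ^ k"
    using p(1) by (simp add: k_def lessThan_Suc_atMost[symmetric])
  finally have eq: "x ^ k = - (\<Sum>i<k. coeff p i * x ^ i)" by (simp add: eq_neg_iff_add_eq_0 add.commute)
  have "(\<Sum>i<k. coeff p i * x ^ i) \<in> int_mod.span ((\<lambda>i. x ^ i) ` {..<k})"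
  proof (rule int_mod.span_sum)
    fix i assume i: "i \<in> {..<k}"
    obtain c where "coeff p i = of_int c" using p(2) by (metis Ints_cases)
    thus "coeff p i * x ^ i \<in> int_mod.span ((\<lambda>i. x ^ i) ` {..<k})"
      using i by (simp add: int_mod.span_scale int_mod.span_base)
  qed
  with eq have "x ^ k \<in> int_mod.span ((\<lambda>i. x ^ i) ` {..<k})" by (simp add: int_mod.span_neg)
  with \<open>k > 0\<close> show ?thesis by (rule that)
qed

text \<open>The monomials \<open>x ^ i * y ^ j\<close> with exponents below those of the two
  integral equations span a group that both \<open>x\<close> and \<open>y\<close> map into itself,
  so their sum and product do as well.\<close>

lemma
  fixes x y :: "'a :: field_char_0"
  assumes "algebraic_int x" "algebraic_int y"
  shows algebraic_int_add: "algebraic_int (x + y)"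
    and algebraic_int_mult: "algebraic_int (x * y)"
proof -
  obtain k where k: "k > 0" "x ^ k \<in> int_mod.span ((\<lambda>i. x ^ i) ` {..<k})"
    using algebraic_int_power_in_span[OF assms(1)] .
  obtain l where l: "l > 0" "y ^ l \<in> int_mod.span ((\<lambda>i. y ^ i) ` {..<l})"
    using algebraic_int_power_in_span[OF assms(2)] .
  define S where "S = (\<lambda>(i, j). x ^ i * y ^ j) ` ({..<k} \<times> {..<l})"
  have fin: "finite S" by (simp add: S_def)
  have memb: "x ^ i * y ^ j \<in> int_mod.span S" if "i < k" "j < l" for i j
    using that by (auto simp: S_def intro!: int_mod.span_base)
  have one: "1 \<in> S" unfolding S_def by (rule image_eqI[of _ _ "(0, 0)"]) (use k l in auto)
  have X: "x * s \<in> int_mod.span S" if sS: "s \<in> S" for s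
  proof -
    obtain i j where s: "s = x ^ i * y ^ j" "i < k" "j < l" using sS unfolding S_def by force
    show ?thesis
    proof (cases "Suc i = k")
      case False
      thus ?thesis using s memb[of "Suc i" j] by (simp add: algebra_simps)
    next
      \<comment> \<open>The product leaves the range of exponents here, and the integral equation of
        \<open>x\<close> brings it back.\<close>
      case True
      have "y ^ j * x ^ k \<in> int_mod.span S"
        by (rule int_span_mult_left[OF _ k(2)]) (use s memb in \<open>auto simp: mult.commute\<close>)
      thus ?thesis using s True by (auto simp: algebra_simps)
    qed
  qed
  have Y: "y * s \<in> int_mod.span S" if sS: "s \<in> S" for s
  proof -
    obtain i j where s: "s = x ^ i * y ^ j" "i < k" "j < l" using sS unfolding S_def by force
    show ?thesis
    proof (cases "Suc j = l")
      case False
      thus ?thesis using s memb[of i "Suc j"] by (simp add: algebra_simps)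
    next
      case True
      have "x ^ i * y ^ l \<in> int_mod.span S"
        by (rule int_span_mult_left[OF _ l(2)]) (use s memb in auto)
      thus ?thesis using s True by (auto simp: algebra_simps)
    qed
  qed
  show "algebraic_int (x + y)"
    by (rule algebraic_int_if_stable_span[OF fin one])
      (auto simp: distrib_right intro!: int_mod.span_add X Y)
  show "algebraic_int (x * y)"
  proof (rule algebraic_int_if_stable_span[OF fin one])
    fix s assume "s \<in> S"
    thus "x * y * s \<in> int_mod.span S"
      using int_span_mult_left[OF X Y] by (simp add: mult.assoc)
  qed auto
qed

lemma algebraic_int_of_int [simp]: "algebraic_int (of_int k :: 'a :: field_char_0)"
  by (rule int_imp_algebraic_int) auto

lemma algebraic_int_of_nat [simp]: "algebraic_int (of_nat k :: 'a :: field_char_0)"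
  by (rule int_imp_algebraic_int) auto

lemma algebraic_int_power: "algebraic_int x \<Longrightarrow> algebraic_int (x ^ k :: 'a :: field_char_0)"
  by (induction k) (auto intro: algebraic_int_mult)

lemma algebraic_int_sum:
  "(\<And>i. i \<in> I \<Longrightarrow> algebraic_int (f i :: 'a :: field_char_0)) \<Longrightarrow> algebraic_int (sum f I)"
  by (induction I rule: infinite_finite_induct) (auto intro: algebraic_int_add)

text \<open>Otherwise \<open>1 / p\<close> would be a rational algebraic integer, hence an integer.
  This is how \<open>p\<close> is seen to be a non-unit among the algebraic integers.\<close>

lemma not_algebraic_int_inverse_prime:
  assumes "prime (p :: nat)" "algebraic_int (x :: 'a :: field_char_0)"
  shows "of_nat p * x \<noteq> 1"
proof
  assume *: "of_nat p * x = 1"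
  hence p0: "x = 1 / of_nat p"
    using assms(1) by (auto simp: field_simps)
  hence "x \<in> \<rat>" by (simp add: Rats_divide)
  with assms(2) have "x \<in> \<int>" using rational_algebraic_int_is_int by blast
  then obtain k where "x = of_int k" by (auto elim: Ints_cases)
  with * have "of_int (int p * k) = (1 :: 'a)" by simp
  hence "int p * k = 1" by (simp only: of_int_eq_1_iff)
  hence "\<bar>int p\<bar> = 1" using zmult_eq_1_iff[of "int p" k] by auto
  thus False using prime_gt_1_nat[OF assms(1)] by simp
qed

section \<open>Subrings and polynomials over them\<close>

text \<open>A predicate on sets over any commutative ring, so that the same closure lemmas serve
  \<open>\<int>\<close>, \<open>L\<close>, its integers, rings obtained by adjoining a root, the
  algebraic integers of the ambient field and sets of polynomials.\<close>

definition is_subring :: "'a :: comm_ring_1 set \<Rightarrow> bool" where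
  "is_subring R \<longleftrightarrow> 0 \<in> R \<and> 1 \<in> R \<and> (\<forall>x\<in>R. \<forall>y\<in>R. x + y \<in> R \<and> x * y \<in> R) \<and> (\<forall>x\<in>R. - x \<in> R)"

context
  fixes R :: "'a :: comm_ring_1 set"
  assumes R: "is_subring R"
begin

lemma subring_0: "0 \<in> R" and subring_1: "1 \<in> R"
  and subring_add: "x \<in> R \<Longrightarrow> y \<in> R \<Longrightarrow> x + y \<in> R"
  and subring_mult: "x \<in> R \<Longrightarrow> y \<in> R \<Longrightarrow> x * y \<in> R"
  and subring_uminus: "x \<in> R \<Longrightarrow> - x \<in> R"
  using R by (auto simp: is_subring_def)

lemma subring_diff: "x \<in> R \<Longrightarrow> y \<in> R \<Longrightarrow> x - y \<in> R"
  using subring_add[of x "- y"] subring_uminus by simp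

lemma subring_sum: "(\<And>i. i \<in> I \<Longrightarrow> f i \<in> R) \<Longrightarrow> sum f I \<in> R"
  by (induction I rule: infinite_finite_induct) (auto intro: subring_0 subring_add)

lemma subring_prod: "(\<And>i. i \<in> I \<Longrightarrow> f i \<in> R) \<Longrightarrow> prod f I \<in> R"
  by (induction I rule: infinite_finite_induct) (auto intro: subring_1 subring_mult)

lemma subring_power: "x \<in> R \<Longrightarrow> x ^ k \<in> R"
  by (induction k) (auto intro: subring_1 subring_mult)

lemma subring_of_nat: "of_nat k \<in> R"
  by (induction k) (auto intro: subring_0 subring_1 subring_add)

lemma subring_of_int: "of_int k \<in> R"
  by (cases k) (auto intro!: subring_of_nat subring_uminus simp del: of_nat_Suc)

lemma Ints_subset_subring: "\<int> \<subseteq> R"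
  by (auto elim!: Ints_cases intro: subring_of_int)

lemma poly_in_subring: "p \<in> polys_over R \<Longrightarrow> x \<in> R \<Longrightarrow> poly p x \<in> R"
  unfolding poly_altdef polys_over_def by (auto intro!: subring_sum subring_mult subring_power)

lemma polys_over_monom: "c \<in> R \<Longrightarrow> monom c k \<in> polys_over R"
  by (auto simp: polys_over_def subring_0)

lemma polys_over_mult: "p \<in> polys_over R \<Longrightarrow> q \<in> polys_over R \<Longrightarrow> p * q \<in> polys_over R"
  by (auto simp: polys_over_def coeff_mult intro!: subring_sum subring_mult)

lemma is_subring_polys_over: "is_subring (polys_over R)"
  unfolding is_subring_def
  by (auto intro: polys_over_mult)
    (auto simp: polys_over_def coeff_1 subring_0 subring_1 subring_add subring_uminus)

lemma polys_over_pcompose: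
  assumes "p \<in> polys_over R" "q \<in> polys_over R"
  shows "pcompose p q \<in> polys_over R"
  using assms(1)
proof (induction p)
  case 0
  show ?case by (simp add: polys_over_def subring_0)
next
  case (pCons a p)
  have "a \<in> R" "p \<in> polys_over R"
    using pCons.prems unfolding polys_over_def mem_Collect_eq by (metis coeff_pCons_0 coeff_pCons_Suc)+
  moreover from this have "[:a:] \<in> polys_over R"
    using polys_over_monom[of a 0] by (simp add: monom_0)
  ultimately show ?case
    using pCons.IH assms(2) is_subring_polys_over
    by (auto simp: pcompose_pCons is_subring_def)
qed

text \<open>A monic divisor lets the leading term be cancelled without dividing coefficients, so
  quotient and remainder stay over the subring. Later this keeps coefficients in
  \<open>\<int>\<close>, in the integers of \<open>L\<close> or in \<open>L\<close>.\<close>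

lemma monic_division:
  assumes "g \<in> polys_over R" "lead_coeff g = 1" "degree g > 0" "f \<in> polys_over R"
  shows "\<exists>q\<in>polys_over R. \<exists>r\<in>polys_over R. f = g * q + r \<and> degree r < degree g"
  using assms(4)
proof (induction "degree f" arbitrary: f rule: less_induct)
  case less
  note sub = is_subring_polys_over
  show ?case
  proof (cases "degree f < degree g")
    case True
    with less show ?thesis
      by (intro bexI[of _ 0] bexI[of _ f]) (auto simp: polys_over_def subring_0)
  next
    case False
    define h where "h = monom (lead_coeff f) (degree f - degree g)"
    have h: "h \<in> polys_over R"
      unfolding h_def using less.prems by (intro polys_over_monom) (auto simp: polys_over_def)
    define f' where "f' = f - g * h"
    have f': "f' \<in> polys_over R"
      using less.prems h assms(1) sub by (auto simp: f'_def is_subring_def diff_conv_add_uminus simp del: add_uminus_conv_diff)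
    have deg: "degree (g * h) \<le> degree f"
      using degree_mult_le[of g h] degree_monom_le[of "lead_coeff f" "degree f - degree g"] False
      unfolding h_def by linarith
    have "coeff (g * h) (degree f) = lead_coeff f"
      using False assms(2) by (simp add: h_def mult.commute[of g] coeff_monom_mult)
    hence top: "coeff f' (degree f) = 0" by (simp add: f'_def)
    have "degree f' \<le> degree f" unfolding f'_def using deg by (simp add: degree_diff_le)
    hence "degree f' < degree f \<or> f' = 0 \<or> degree f = 0"
      using top by (metis leading_coeff_0_iff order_le_less)
    hence "degree f' < degree f"
    proof (elim disjE)
      assume "f' = 0"
      thus ?thesis using False assms(3) by auto
    next
      assume "degree f = 0" thus ?thesis using False assms(3) by simp
    qed
    from less.hyps[OF this f'] obtain q r where
      qr: "q \<in> polys_over R" "r \<in> polys_over R" "f' = g * q + r" "degree r < degree g" by blast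
    have "f = g * (q + h) + r" using qr(3) by (simp add: f'_def algebra_simps)
    moreover have "q + h \<in> polys_over R" using qr h sub by (auto simp: is_subring_def)
    ultimately show ?thesis using qr by blast
  qed
qed

lemma adjoin_ring_I: "p \<in> polys_over R \<Longrightarrow> poly p a \<in> adjoin_ring R a"
  by (simp add: adjoin_ring_def)

lemma adjoin_ring_base: "c \<in> R \<Longrightarrow> c \<in> adjoin_ring R a"
  using adjoin_ring_I[OF polys_over_monom[of c 0], of a] by (simp add: poly_monom)

lemma adjoin_ring_gen: "a \<in> adjoin_ring R a"
  using adjoin_ring_I[OF polys_over_monom[of 1 1], of a] by (simp add: poly_monom subring_1)

lemma is_subring_adjoin_ring: "is_subring (adjoin_ring R a)"
proof -
  have "\<exists>r\<in>polys_over R. poly p a + poly q a = poly r a"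
    "\<exists>r\<in>polys_over R. poly p a * poly q a = poly r a" "\<exists>r\<in>polys_over R. - poly p a = poly r a"
    if "p \<in> polys_over R" "q \<in> polys_over R" for p q
    using that is_subring_polys_over
    by (auto simp: is_subring_def simp flip: poly_add poly_mult poly_minus)
  thus ?thesis
    using adjoin_ring_base[OF subring_0] adjoin_ring_base[OF subring_1]
    unfolding is_subring_def by (auto simp: adjoin_ring_def image_iff)
qed

end

lemma polys_over_mono: "R \<subseteq> S \<Longrightarrow> polys_over R \<subseteq> polys_over S"
  by (auto simp: polys_over_def)

lemma adjoin_ring_mono: "R \<subseteq> S \<Longrightarrow> adjoin_ring R a \<subseteq> adjoin_ring S a"
  unfolding adjoin_ring_def using polys_over_mono by blast

lemma is_subring_Ints: "is_subring (\<int> :: 'a :: comm_ring_1 set)"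
  by (auto simp: is_subring_def)

lemma is_subring_algebraic_ints: "is_subring {x :: 'a :: field_char_0. algebraic_int x}"
  by (auto simp: is_subring_def algebraic_int_add algebraic_int_mult)

lemma is_subring_subfield: "is_subfield K \<Longrightarrow> is_subring K"
  by (auto simp: is_subfield_def is_subring_def)

lemma ring_of_integers_eq: "ring_of_integers L = L \<inter> {x. algebraic_int x}"
  by (auto simp: ring_of_integers_def)

lemma is_subring_Int: "is_subring R \<Longrightarrow> is_subring S \<Longrightarrow> is_subring (R \<inter> S)"
  by (auto simp: is_subring_def)

section \<open>Additivity of p-power maps modulo p\<close>

text \<open>The inner binomial coefficients are divisible by the prime, and the congruence survives
  iteration. The error \<open>c\<close> is kept inside \<open>R\<close> because divisibility has to
  hold in that ring.\<close>

lemma add_power_prime_power: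
  assumes R: "is_subring R" and p: "prime (p :: nat)" and x: "x \<in> R" "y \<in> R"
  shows "\<exists>c\<in>R. (x + y) ^ p ^ k = x ^ p ^ k + y ^ p ^ k + of_nat p * c"
proof (induction k)
  case 0
  show ?case using subring_0[OF R] by (intro bexI[of _ 0]) auto
next
  case (Suc k)
  have step: "\<exists>c\<in>R. (x + y) ^ p = x ^ p + y ^ p + of_nat p * c" if "x \<in> R" "y \<in> R" for x y
  proof -
    have p0: "p > 0" using p by (simp add: prime_gt_0_nat)
    have "(x + y) ^ p = (\<Sum>i\<le>p. of_nat (p choose i) * x ^ i * y ^ (p - i))"
      by (rule binomial_ring)
    also have "{..p} = insert 0 (insert p {0<..<p})" using p0 by auto
    also have "(\<Sum>i\<in>\<dots>. of_nat (p choose i) * x ^ i * y ^ (p - i))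
        = x ^ p + y ^ p + (\<Sum>i\<in>{0<..<p}. of_nat (p choose i) * x ^ i * y ^ (p - i))"
      using p0 by (simp add: algebra_simps)
    also have "(\<Sum>i\<in>{0<..<p}. of_nat (p choose i) * x ^ i * y ^ (p - i)) =
        of_nat p * (\<Sum>i\<in>{0<..<p}. of_nat ((p choose i) div p) * x ^ i * y ^ (p - i))"
      unfolding sum_distrib_left
    proof (rule sum.cong)
      fix i assume i: "i \<in> {0<..<p}"
      have "p dvd (p choose i)" using i p by (auto intro!: dvd_choose_prime)
      hence "(of_nat (p choose i) :: 'a) = of_nat p * of_nat ((p choose i) div p)"
        by (metis dvd_mult_div_cancel of_nat_mult)
      thus "of_nat (p choose i) * x ^ i * y ^ (p - i) =
          of_nat p * (of_nat ((p choose i) div p) * x ^ i * y ^ (p - i))" by (simp add: mult.assoc)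
    qed auto
    finally show ?thesis
      using that by (metis (no_types, lifting) subring_sum[OF R] subring_mult[OF R] subring_power[OF R] subring_of_nat[OF R])
  qed
  from Suc obtain c where c: "c \<in> R" "(x + y) ^ p ^ k = x ^ p ^ k + y ^ p ^ k + of_nat p * c" by blast
  have mem: "x ^ p ^ k \<in> R" "y ^ p ^ k \<in> R" "of_nat p * c \<in> R"
    by (intro subring_power[OF R] subring_mult[OF R] subring_of_nat[OF R] x c)+
  note c1 = step[OF mem(1,2)] and c2 = step[OF subring_add[OF R mem(1,2)] mem(3)]
  from c1 obtain c1 where c1: "c1 \<in> R"
    "(x ^ p ^ k + y ^ p ^ k) ^ p = (x ^ p ^ k) ^ p + (y ^ p ^ k) ^ p + of_nat p * c1" ..
  from c2 obtain c2 where c2: "c2 \<in> R" "(x ^ p ^ k + y ^ p ^ k + of_nat p * c) ^ p =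
      (x ^ p ^ k + y ^ p ^ k) ^ p + (of_nat p * c) ^ p + of_nat p * c2" ..
  \<comment> \<open>The error of the previous stage, raised to the power \<open>p\<close>, is again
    a multiple of \<open>p\<close>; splitting off one factor uses \<open>p > 0\<close>.\<close>
  have "(of_nat p * c) ^ p = of_nat p * (c * (of_nat p * c) ^ (p - 1))"
    using prime_gt_0_nat[OF p] by (simp add: power_eq_if[of _ p] mult.assoc)
  with c c1 c2 have "(x + y) ^ p ^ Suc k = x ^ p ^ Suc k + y ^ p ^ Suc k +
      of_nat p * (c1 + c * (of_nat p * c) ^ (p - 1) + c2)"
    by (simp only: power_Suc2 power_mult) (simp add: algebra_simps)
  moreover have "c1 + c * (of_nat p * c) ^ (p - 1) + c2 \<in> R"
    using c c1 c2 R by (intro subring_add[OF R] subring_mult[OF R] subring_power[OF R] subring_of_nat[OF R])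
  ultimately show ?case by blast
qed

lemma sum_power_prime_power:
  assumes R: "is_subring R" and p: "prime (p :: nat)" and f: "\<And>i. i \<in> I \<Longrightarrow> f i \<in> R"
  shows "\<exists>c\<in>R. sum f I ^ p ^ k = (\<Sum>i\<in>I. f i ^ p ^ k) + of_nat p * c"
  using f
proof (induction I rule: infinite_finite_induct)
  case (insert i I)
  then obtain c where c: "c \<in> R" "sum f I ^ p ^ k = (\<Sum>i\<in>I. f i ^ p ^ k) + of_nat p * c" by auto
  obtain d where "d \<in> R" "(f i + sum f I) ^ p ^ k = f i ^ p ^ k + sum f I ^ p ^ k + of_nat p * d"
    using add_power_prime_power[OF R p, of "f i" "sum f I" k] insert.prems subring_sum[OF R, of I f] by auto
  with c insert.hyps have "sum f (insert i I) ^ p ^ k = (\<Sum>i\<in>insert i I. f i ^ p ^ k) + of_nat p * (c + d)"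
    by (simp only: sum.insert) (simp add: distrib_left)
  with c \<open>d \<in> R\<close> show ?case using subring_add[OF R] by blast
qed (use p subring_0[OF R] in \<open>auto intro!: bexI[of _ 0] simp: prime_gt_0_nat power_0_left\<close>)

section \<open>The trace\<close>

definition mat_trace :: "'a :: comm_ring_1 mat \<Rightarrow> 'a" where
  "mat_trace A = (\<Sum>i<dim_row A. A $$ (i, i))"

lemma mat_trace_comm:
  assumes "A \<in> carrier_mat n m" "B \<in> carrier_mat m n"
  shows "mat_trace (A * B) = mat_trace (B * A)"
proof -
  have "mat_trace (A * B) = (\<Sum>i<n. \<Sum>j<m. A $$ (i, j) * B $$ (j, i))"
    using assms by (auto simp: mat_trace_def scalar_prod_def lessThan_atLeast0)
  also have "\<dots> = (\<Sum>j<m. \<Sum>i<n. A $$ (i, j) * B $$ (j, i))" by (rule sum.swap)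
  also have "\<dots> = mat_trace (B * A)"
    using assms by (auto simp: mat_trace_def scalar_prod_def lessThan_atLeast0 mult.commute)
  finally show ?thesis .
qed

text \<open>Schur decomposition gives a similar triangular matrix with the eigenvalues, counted with
  multiplicity, on its diagonal, and the trace is invariant under similarity. Complex entries ensure
  that the characteristic polynomial splits.\<close>

lemma mat_trace_eq_sum_eigenvalues:
  fixes A :: "complex mat"
  assumes A: "A \<in> carrier_mat n n"
  obtains es where "mat_trace A = sum_list es" "\<And>e. e \<in> set es \<Longrightarrow> eigenvalue A e"
proof -
  obtain es where es: "char_poly A = (\<Prod>a\<leftarrow>es. [:- a, 1:])" "length es = n"
    using char_poly_factorized[OF A] by blast
  obtain B P Q where dec: "schur_decomposition A es = (B, P, Q)" by (metis prod_cases3)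
  from schur_decomposition[OF A es(1) dec]
  have wit: "similar_mat_wit A B P Q" and diag: "diag_mat B = es" by auto
  from similar_mat_witD2[OF A wit] have carr: "B \<in> carrier_mat n n" "P \<in> carrier_mat n n" "Q \<in> carrier_mat n n"
    and PQ: "Q * P = 1\<^sub>m n" and eq: "A = P * B * Q" by auto
  have "mat_trace A = mat_trace (P * (B * Q))" using carr by (simp add: eq)
  also have "\<dots> = mat_trace (B * Q * P)" using carr by (intro mat_trace_comm[of _ n n]) auto
  also have "B * Q * P = B" using carr PQ by simp
  also have "mat_trace B = sum_list (diag_mat B)"
    by (simp add: mat_trace_def diag_mat_def interv_sum_list_conv_sum_set_nat lessThan_atLeast0)
  finally have "mat_trace A = sum_list es" by (simp add: diag)
  moreover have "eigenvalue A e" if "e \<in> set es" for e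
    using that eigenvalue_root_char_poly[OF A] by (auto simp: es(1) poly_prod_list prod_list_zero_iff)
  ultimately show ?thesis by (rule that)
qed

lemma finite_rational_basis:
  assumes "number_field L" "rat_vec.independent B" "rat_vec.span B = L"
  shows "finite B"
  using assms rat_vec.independent_span_bound rat_vec.span_superset unfolding number_field_def by blast

lemma rational_basis_sum:
  assumes "number_field L" "rat_vec.independent B" "rat_vec.span B = L" "x \<in> L"
  shows "(\<Sum>b\<in>B. of_rat (rat_vec.representation B x b) * b) = x"
  using rat_vec.sum_representation_eq[of B x B] finite_rational_basis[OF assms(1-3)] assms by auto

lemma ex_rational_basis_subset:
  fixes V L :: "'a :: field_char_0 set"
  assumes "V \<subseteq> L" "rat_vec.subspace L" "L \<subseteq> rat_vec.span V"
  obtains B where "B \<subseteq> V" "rat_vec.independent B" "rat_vec.span B = L"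
proof -
  obtain B where B: "B \<subseteq> V" "rat_vec.independent B" "V \<subseteq> rat_vec.span B"
    using rat_vec.maximal_independent_subset by blast
  moreover have "rat_vec.span V \<subseteq> rat_vec.span B"
    using B(3) by (rule rat_vec.span_minimal) simp
  moreover have "rat_vec.span B \<subseteq> L" using B assms by (intro rat_vec.span_minimal) auto
  ultimately show ?thesis using that assms by blast
qed

context
  fixes L :: "'a :: field_char_0 set"
  assumes L: "number_field L"
begin

lemma number_field_subring: "is_subring L"
  using L by (auto simp: number_field_def is_subring_subfield)

lemma number_field_inverse: "x \<in> L \<Longrightarrow> inverse x \<in> L"
  using L by (auto simp: number_field_def is_subfield_def)

lemma number_field_subspace: "rat_vec.subspace L"
  using L rat_vec.subspace_span unfolding number_field_def by metis

lemma number_field_scale: "x \<in> L \<Longrightarrow> of_rat q * x \<in> L"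
  by (rule rat_vec.subspace_scale[OF number_field_subspace])

lemma ex_rational_basis: obtains B where "rat_vec.independent B" "rat_vec.span B = L"
  by (rule ex_rational_basis_subset[OF order_refl number_field_subspace rat_vec.span_superset]) blast

lemma representation_sum_scale:
  assumes B: "rat_vec.independent B" "rat_vec.span B = L" and f: "\<And>i. i \<in> I \<Longrightarrow> f i \<in> L"
  shows "rat_vec.representation B (\<Sum>i\<in>I. of_rat (q i) * f i) b =
    (\<Sum>i\<in>I. q i * rat_vec.representation B (f i) b)"
proof -
  have "of_rat (q i) * f i \<in> rat_vec.span B" if "i \<in> I" for i
    using number_field_scale f[OF that] B(2) by simp
  thus ?thesis using f B by (simp add: rat_vec.representation_sum rat_vec.representation_scale)
qed

text \<open>Basis independence as a double sum: expanding \<open>b\<close> in the basis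
  \<open>C\<close> on one side and \<open>x * c\<close> in \<open>B\<close> on the other gives the
  same expression, the trace of a product of two matrices taken in either order.\<close>

lemma field_trace_eq:
  assumes B: "rat_vec.independent B" "rat_vec.span B = L" and x: "x \<in> L"
  shows "field_trace L x = (\<Sum>b\<in>B. rat_vec.representation B (x * b) b)"
proof -
  define C where "C = (SOME B. rat_vec.independent B \<and> rat_vec.span B = L)"
  have C: "rat_vec.independent C" "rat_vec.span C = L"
    using someI[of "\<lambda>B. rat_vec.independent B \<and> rat_vec.span B = L" B] B by (auto simp: C_def)
  note mult = subring_mult[OF number_field_subring]
  have sub: "B \<subseteq> L" "C \<subseteq> L" using rat_vec.span_superset B C by metis+
  let ?r = rat_vec.representation
  have "?r B (x * b) b = (\<Sum>c\<in>C. ?r C b c * ?r B (x * c) b)" if b: "b \<in> B" for b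
  proof -
    have "x * b = (\<Sum>c\<in>C. of_rat (?r C b c) * (x * c))"
      using rational_basis_sum[OF L C subsetD[OF sub(1) b]]
      by (simp add: mult.left_commute[of _ x] flip: sum_distrib_left)
    thus ?thesis
      using sub x by (simp only:) (intro representation_sum_scale[OF B] mult, auto)
  qed
  hence "(\<Sum>b\<in>B. ?r B (x * b) b) = (\<Sum>b\<in>B. \<Sum>c\<in>C. ?r C b c * ?r B (x * c) b)" by simp
  also have "\<dots> = (\<Sum>c\<in>C. \<Sum>b\<in>B. ?r C b c * ?r B (x * c) b)" by (rule sum.swap)
  also have "\<dots> = (\<Sum>c\<in>C. ?r C (x * c) c)"
  proof (rule sum.cong)
    fix c assume c: "c \<in> C"
    have "x * c = (\<Sum>b\<in>B. of_rat (?r B (x * c) b) * b)"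
      using rational_basis_sum[OF L B, of "x * c"] c sub x mult by auto
    hence "?r C (x * c) c = ?r C (\<Sum>b\<in>B. of_rat (?r B (x * c) b) * b) c" by simp
    also have "\<dots> = (\<Sum>b\<in>B. ?r B (x * c) b * ?r C b c)"
      using sub by (intro representation_sum_scale[OF C]) auto
    finally show "(\<Sum>b\<in>B. ?r C b c * ?r B (x * c) b) = ?r C (x * c) c" by (simp add: mult.commute)
  qed simp
  finally show ?thesis by (simp add: field_trace_def C_def Let_def)
qed

lemma field_trace_add: "x \<in> L \<Longrightarrow> y \<in> L \<Longrightarrow> field_trace L (x + y) = field_trace L x + field_trace L y"
proof -
  assume xy: "x \<in> L" "y \<in> L"
  obtain B where B: "rat_vec.independent B" "rat_vec.span B = L" by (rule ex_rational_basis)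
  note mult = subring_mult[OF number_field_subring]
  have "B \<subseteq> L" using rat_vec.span_superset B by metis
  thus ?thesis
    using xy B subring_add[OF number_field_subring xy]
    by (simp add: field_trace_eq[OF B] distrib_right rat_vec.representation_add mult subset_iff sum.distrib)
qed

lemma field_trace_scale: "x \<in> L \<Longrightarrow> field_trace L (of_rat q * x) = q * field_trace L x"
proof -
  assume x: "x \<in> L"
  obtain B where B: "rat_vec.independent B" "rat_vec.span B = L" by (rule ex_rational_basis)
  note mult = subring_mult[OF number_field_subring]
  have "B \<subseteq> L" using rat_vec.span_superset B by metis
  thus ?thesis
    using x B number_field_scale[OF x, of q]
    by (simp add: field_trace_eq[OF B] mult.assoc rat_vec.representation_scale mult subset_iff sum_distrib_left)
qed

lemma field_trace_sum:
  "(\<And>i. i \<in> I \<Longrightarrow> f i \<in> L) \<Longrightarrow> field_trace L (sum f I) = (\<Sum>i\<in>I. field_trace L (f i))"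
proof (induction I rule: infinite_finite_induct)
  case (insert i I)
  thus ?case by (simp add: field_trace_add subring_sum[OF number_field_subring])
qed (use field_trace_scale[of 0 0] subring_0[OF number_field_subring] in simp_all)

lemma field_trace_sum_scale:
  assumes "\<And>i. i \<in> I \<Longrightarrow> f i \<in> L"
  shows "field_trace L (\<Sum>i\<in>I. of_rat (q i) * f i) = (\<Sum>i\<in>I. q i * field_trace L (f i))"
  using assms by (subst field_trace_sum) (auto intro: number_field_scale simp: field_trace_scale)

text \<open>The value is the degree of \<open>L\<close>; the basis is not empty because
  \<open>1 \<in> L\<close>. Pairing an element with its inverse then shows that the trace form is
  nondegenerate.\<close>

lemma field_trace_1: "field_trace L 1 > 0"
proof -
  obtain B where B: "rat_vec.independent B" "rat_vec.span B = L" by (rule ex_rational_basis)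
  have 1: "1 \<in> L" by (rule subring_1[OF number_field_subring])
  hence "B \<noteq> {}" using B by auto
  moreover have "field_trace L 1 = of_nat (card B)"
    using B by (simp add: field_trace_eq[OF B 1] rat_vec.representation_basis)
  ultimately show ?thesis using finite_rational_basis[OF L B] by (simp add: card_gt_0_iff)
qed

text \<open>
  Left eigenvectors of the matrix of multiplication by \<open>z\<close> are linear functionals on \<open>L\<close> on which
  multiplication by \<open>z\<close> acts as a scalar; they replace the embeddings of \<open>L\<close> into the complex numbers.
\<close>

definition eigenfunctional :: "'a \<Rightarrow> complex \<Rightarrow> ('a \<Rightarrow> complex) \<Rightarrow> bool" where
  "eigenfunctional z c l \<longleftrightarrow>
     (\<forall>x\<in>L. \<forall>y\<in>L. l (x + y) = l x + l y) \<and> (\<forall>q. \<forall>x\<in>L. l (of_rat q * x) = of_rat q * l x) \<and>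
     (\<exists>x\<in>L. l x \<noteq> 0) \<and> (\<forall>x\<in>L. l (z * x) = c * l x)"

lemma field_trace_eigenfunctionals:
  assumes z: "z \<in> L"
  obtains es where "of_rat (field_trace L z) = sum_list es"
    "\<And>c. c \<in> set es \<Longrightarrow> \<exists>l. eigenfunctional z c l"
proof -
  obtain B where B: "rat_vec.independent B" "rat_vec.span B = L" by (rule ex_rational_basis)
  have BL: "B \<subseteq> L" using rat_vec.span_superset B by metis
  have fin: "finite B" by (rule finite_rational_basis[OF L B])
  define n where "n = card B"
  obtain v where v: "bij_betw v {..<n} B"
    using fin by (metis n_def ex_bij_betw_nat_finite lessThan_atLeast0)
  hence vB: "v i \<in> B" if "i < n" for i using that by (auto simp: bij_betw_def)
  note mult = subring_mult[OF number_field_subring]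
  let ?r = "rat_vec.representation B"
  \<comment> \<open>Row \<open>i\<close> holds the coordinates of \<open>z * v i\<close>, the
    transpose of the usual matrix of multiplication. Its right eigenvectors \<open>w\<close> are
    therefore the values on the basis of a functional on which \<open>z\<close> acts as a
    scalar.\<close>
  define A :: "complex mat" where "A = mat n n (\<lambda>(i, j). of_rat (?r (z * v i) (v j)))"
  have A: "A \<in> carrier_mat n n" by (simp add: A_def)
  obtain es where es: "mat_trace A = sum_list es" "\<And>e. e \<in> set es \<Longrightarrow> eigenvalue A e"
    by (rule mat_trace_eq_sum_eigenvalues[OF A]) blast
  have "of_rat (field_trace L z) = (\<Sum>b\<in>B. (of_rat (?r (z * b) b) :: complex))"
    by (simp add: field_trace_eq[OF B z] of_rat_sum)
  also have "\<dots> = (\<Sum>i<n. of_rat (?r (z * v i) (v i)))"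
    by (rule sum.reindex_bij_betw[OF v, symmetric])
  also have "\<dots> = mat_trace A" by (simp add: A_def mat_trace_def)
  also note es(1)
  finally have tr: "of_rat (field_trace L z) = sum_list es" .
  have "\<exists>l. eigenfunctional z c l" if c: "c \<in> set es" for c
  proof -
    obtain w where w: "w \<in> carrier_vec n" "w \<noteq> 0\<^sub>v n" "A *\<^sub>v w = c \<cdot>\<^sub>v w"
      using es(2)[OF c] A by (auto simp: eigenvalue_def eigenvector_def)
    define l where "l x = (\<Sum>j<n. of_rat (?r x (v j)) * w $ j)" for x
    have add: "l (x + y) = l x + l y" if "x \<in> L" "y \<in> L" for x y
      unfolding l_def sum.distrib[symmetric]
      by (intro sum.cong refl) (simp add: rat_vec.representation_add[OF B(1)] B(2) that of_rat_add distrib_right)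
    have scale: "l (of_rat q * x) = of_rat q * l x" if "x \<in> L" for x q
      unfolding l_def sum_distrib_left
      by (intro sum.cong refl) (simp add: rat_vec.representation_scale[OF B(1)] B(2) that of_rat_mult)
    have lv: "l (v i) = w $ i" if "i < n" for i
    proof -
      have "l (v i) = (\<Sum>j<n. if j = i then w $ j else 0)"
        unfolding l_def using that v B
        by (intro sum.cong) (auto simp: rat_vec.representation_basis vB bij_betw_def dest: inj_onD)
      thus ?thesis using that by simp
    qed
    have lsum: "l (sum f I) = (\<Sum>i\<in>I. l (f i))" if "\<And>i. i \<in> I \<Longrightarrow> f i \<in> L" for f and I :: "nat set"
      using that
    proof (induction I rule: infinite_finite_induct)
      case (insert i I)
      thus ?case by (simp add: add subring_sum[OF number_field_subring])
    qed (use scale[of 0 0] subring_0[OF number_field_subring] in simp_all)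
    have eig: "l (z * v i) = c * l (v i)" if "i < n" for i
    proof -
      have "l (z * v i) = (A *\<^sub>v w) $ i"
        using that w(1) by (simp add: l_def A_def scalar_prod_def lessThan_atLeast0)
      also have "\<dots> = c * w $ i" unfolding w(3) using that w(1) by simp
      finally show ?thesis using that by (simp add: lv)
    qed
    have "l (z * x) = c * l x" if x: "x \<in> L" for x
    proof -
      have "x = (\<Sum>b\<in>B. of_rat (?r x b) * b)" by (rule rational_basis_sum[OF L B x, symmetric])
      also have "\<dots> = (\<Sum>i<n. of_rat (?r x (v i)) * v i)"
        by (rule sum.reindex_bij_betw[OF v, symmetric])
      finally have x_eq: "x = (\<Sum>i<n. of_rat (?r x (v i)) * v i)" .
      have vL: "v i \<in> L" if "i < n" for i using vB that BL by auto
      have "l (z * x) = l (\<Sum>i<n. of_rat (?r x (v i)) * (z * v i))"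
        by (subst x_eq) (simp add: sum_distrib_left mult.left_commute)
      also have "\<dots> = (\<Sum>i<n. of_rat (?r x (v i)) * (c * l (v i)))"
        using z vL by (subst lsum) (auto simp: scale mult eig intro!: number_field_scale)
      also have "\<dots> = c * (\<Sum>i<n. of_rat (?r x (v i)) * l (v i))"
        by (simp add: sum_distrib_left mult.left_commute)
      also have "(\<Sum>i<n. of_rat (?r x (v i)) * l (v i)) = l (\<Sum>i<n. of_rat (?r x (v i)) * v i)"
        using vL by (subst lsum) (auto simp: scale intro!: number_field_scale)
      also have "\<dots> = l x" using x_eq by simp
      finally show ?thesis .
    qed
    moreover have "\<exists>x\<in>L. l x \<noteq> 0"
    proof -
      obtain i where "i < n" "w $ i \<noteq> 0" using w(1,2) by (auto simp: vec_eq_iff)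
      thus ?thesis using lv[of i] vB[of i] BL by (intro bexI[of _ "v i"]) auto
    qed
    ultimately have "eigenfunctional z c l" using add scale by (auto simp: eigenfunctional_def)
    thus ?thesis by blast
  qed
  with tr show ?thesis by (rule that)
qed

text \<open>A polynomial expression in \<open>z\<close> acts through \<open>l\<close> as the same
  expression in \<open>c\<close>. A monic integer equation of \<open>z\<close> therefore also holds
  for \<open>c\<close>, because \<open>l\<close> is nonzero somewhere on \<open>L\<close>.\<close>

lemma eigenfunctional_algebraic_int:
  assumes "eigenfunctional z c l" "z \<in> L" "algebraic_int z"
  shows "algebraic_int c"
proof -
  obtain h :: "int poly" where h: "poly (map_poly of_int h) z = 0" "lead_coeff h = 1"
    using assms(3) by (auto simp: algebraic_int_altdef_ipoly)
  obtain x where x: "x \<in> L" "l x \<noteq> 0" using assms(1) by (auto simp: eigenfunctional_def)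
  have add: "l (u + v) = l u + l v" if "u \<in> L" "v \<in> L" for u v
    using that assms(1) by (auto simp: eigenfunctional_def)
  have scale: "l (of_rat q * u) = of_rat q * l u" if "u \<in> L" for u q
    using that assms(1) by (auto simp: eigenfunctional_def)
  have eig: "l (z * u) = c * l u" if "u \<in> L" for u
    using that assms(1) by (auto simp: eigenfunctional_def)
  have mem: "poly (map_poly of_int g) z * x \<in> L" for g :: "int poly"
    using assms(2) x subring_of_int[OF number_field_subring]
    by (intro subring_mult[OF number_field_subring] poly_in_subring[OF number_field_subring])
      (auto simp: polys_over_def coeff_map_poly)
  have "l (poly (map_poly of_int g) z * x) = poly (map_poly of_int g) c * l x" for g :: "int poly"
  proof (induction g)
    case 0
    show ?case using scale[of 0 0] subring_0[OF number_field_subring] by simp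
  next
    case (pCons a g)
    have "l (of_rat (of_int a) * x + z * (poly (map_poly of_int g) z * x)) =
        of_rat (of_int a) * l x + c * (poly (map_poly of_int g) c * l x)"
      using x assms(2) mem[of g] subring_mult[OF number_field_subring]
      by (simp only: add number_field_scale scale eig pCons.IH)
    thus ?case by (simp add: of_int_hom.map_poly_pCons_hom algebra_simps)
  qed
  from this[of h] h(1) x scale[of 0 0] subring_0[OF number_field_subring]
  have "poly (map_poly of_int h) c = 0" by simp
  with h(2) show ?thesis by (auto simp: algebraic_int_altdef_ipoly)
qed

text \<open>As a sum of eigenvalues that are algebraic integers, the trace is a rational algebraic
  integer.\<close>

lemma field_trace_algebraic_int:
  assumes "z \<in> L" "algebraic_int z"
  shows "field_trace L z \<in> \<int>"
proof -
  obtain es where es: "of_rat (field_trace L z) = sum_list es"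
    "\<And>c. c \<in> set es \<Longrightarrow> \<exists>l. eigenfunctional z c l"
    by (rule field_trace_eigenfunctionals[OF assms(1)]) blast
  have "algebraic_int c" if "c \<in> set es" for c
    using es(2)[OF that] eigenfunctional_algebraic_int assms by blast
  hence "algebraic_int (\<Sum>i<length es. es ! i)" by (intro algebraic_int_sum) auto
  hence "algebraic_int (of_rat (field_trace L z) :: complex)"
    by (simp add: es(1) sum_list_sum_nth lessThan_atLeast0)
  hence "(of_rat (field_trace L z) :: complex) \<in> \<int>"
    by (intro rational_algebraic_int_is_int) auto
  then obtain k where "(of_rat (field_trace L z) :: complex) = of_rat (of_int k)"
    by (auto elim: Ints_cases)
  thus ?thesis by (simp only: of_rat_eq_iff) auto
qed

text \<open>If \<open>z\<close> acts as \<open>c\<close> on a functional, then \<open>w\<close> acts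
  as \<open>c\<^sup>2 / p\<close>, which is therefore an algebraic integer; so \<open>p\<close>
  divides \<open>c ^ p\<close>. As \<open>p\<close>-th powers are additive modulo \<open>p\<close>,
  it divides the \<open>p\<close>-th power of the trace, and hence the trace itself, which is an
  ordinary integer.\<close>

lemma field_trace_nilpotent_mod_prime:
  assumes z: "z \<in> L" "algebraic_int z" and w: "w \<in> L" "algebraic_int w"
    and p: "prime (p :: nat)" and sq: "z\<^sup>2 = of_nat p * w"
  shows "\<exists>k. field_trace L z = of_int (int p * k)"
proof -
  obtain es where es: "of_rat (field_trace L z) = sum_list es"
    "\<And>c. c \<in> set es \<Longrightarrow> \<exists>l. eigenfunctional z c l"
    by (rule field_trace_eigenfunctionals[OF z(1)]) blast
  define R where "R = {x :: complex. algebraic_int x}"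
  have R: "is_subring R" unfolding R_def by (rule is_subring_algebraic_ints)
  have p0: "p > 0" and p2: "p \<ge> 2" using p by (auto simp: prime_gt_0_nat prime_ge_2_nat)
  have pow: "\<exists>d\<in>R. c ^ p = of_nat p * d" and int: "c \<in> R" if c: "c \<in> set es" for c
  proof -
    obtain l where l: "eigenfunctional z c l" using es(2)[OF c] by blast
    show cR: "c \<in> R" using eigenfunctional_algebraic_int[OF l z] by (simp add: R_def)
    have "l (w * x) = c\<^sup>2 / of_nat p * l x" if x: "x \<in> L" for x
    proof -
      have "w * x = of_rat (1 / of_nat p) * (z * (z * x))"
        using sq p0 by (simp add: of_rat_divide power2_eq_square field_simps)
      hence "l (w * x) = l (of_rat (1 / of_nat p) * (z * (z * x)))" by (simp only:)
      also have "\<dots> = of_rat (1 / of_nat p) * (c * (c * l x))"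
        using l x z subring_mult[OF number_field_subring] by (simp add: eigenfunctional_def del: of_rat_divide)
      finally show ?thesis by (simp add: of_rat_divide power2_eq_square)
    qed
    hence "eigenfunctional w (c\<^sup>2 / of_nat p) l" using l by (simp add: eigenfunctional_def)
    hence "c\<^sup>2 / of_nat p \<in> R" using eigenfunctional_algebraic_int w by (simp add: R_def)
    hence "c\<^sup>2 / of_nat p * c ^ (p - 2) \<in> R"
      using cR subring_mult[OF R] subring_power[OF R] by blast
    moreover have "c ^ p = c\<^sup>2 * c ^ (p - 2)"
      using p2 by (simp only: power_add[symmetric] le_add_diff_inverse)
    hence "c ^ p = of_nat p * (c\<^sup>2 / of_nat p * c ^ (p - 2))" using p0 by simp
    ultimately show "\<exists>d\<in>R. c ^ p = of_nat p * d" by blast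
  qed
  have "\<exists>d. \<forall>i\<in>{..<length es}. d i \<in> R \<and> (es ! i) ^ p = of_nat p * d i"
    by (rule bchoice) (use pow in force)
  then obtain d where d: "\<And>i. i < length es \<Longrightarrow> d i \<in> R \<and> (es ! i) ^ p = of_nat p * d i" by auto
  obtain e where e: "e \<in> R" "(\<Sum>i<length es. es ! i) ^ p ^ 1 = (\<Sum>i<length es. (es ! i) ^ p ^ 1) + of_nat p * e"
    using sum_power_prime_power[OF R p, of "{..<length es}" "(!) es" 1] int by auto
  obtain k where k: "field_trace L z = of_int k"
    using field_trace_algebraic_int[OF z] by (auto elim: Ints_cases)
  have "(of_int k :: complex) = (\<Sum>i<length es. es ! i)"
    using es(1) by (simp add: k sum_list_sum_nth lessThan_atLeast0)
  hence "of_int (k ^ p) = of_nat p * ((\<Sum>i<length es. d i) + e)"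
    using e(2) d by (simp add: distrib_left sum_distrib_left)
  moreover have "(\<Sum>i<length es. d i) + e \<in> R"
    using d e by (auto intro!: subring_add[OF R] subring_sum[OF R])
  ultimately have *: "of_int (k ^ p) / of_nat p \<in> R" using p0 by simp
  have "(of_int (k ^ p) / of_nat p :: complex) \<in> \<int>"
    by (rule rational_algebraic_int_is_int) (use * in \<open>auto simp: R_def intro!: Rats_divide Rats_power\<close>)
  then obtain t where "(of_int (k ^ p) :: complex) = of_int (int p * t)"
    using p0 by (auto elim!: Ints_cases simp: field_simps)
  hence "int p dvd k ^ p" by (simp only: of_int_eq_iff) simp
  hence "int p dvd k" using p prime_dvd_power by (metis prime_nat_int_transfer)
  thus ?thesis using k by (auto elim: dvdE)
qed

end

section \<open>Integral bases and the discriminant\<close>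

lemma common_denominator:
  assumes "finite (S :: rat set)"
  obtains N :: nat where "N > 0" "\<And>q. q \<in> S \<Longrightarrow> of_nat N * q \<in> \<int>"
proof -
  have "\<exists>N::nat. N > 0 \<and> (\<forall>q\<in>S. of_nat N * q \<in> \<int>)"
    using assms
  proof (induction S rule: finite_induct)
    case empty
    show ?case by (intro exI[of _ 1]) auto
  next
    case (insert q S)
    then obtain N :: nat where N: "N > 0" "\<And>q. q \<in> S \<Longrightarrow> of_nat N * q \<in> \<int>" by blast
    obtain a b where ab: "quotient_of q = (a, b)" by fastforce
    have b: "b > 0" "q = of_int a / of_int b"
      using quotient_of_denom_pos[OF ab] quotient_of_div[OF ab] by auto
    have 1: "of_nat (N * nat b) * q = of_int (int N * a)" using b by simp
    have 2: "of_nat (N * nat b) * x = of_int b * (of_nat N * x)" for x :: rat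
      using b by simp
    show ?case
    proof (intro exI[of _ "N * nat b"] conjI ballI)
      fix x assume "x \<in> insert q S"
      thus "of_nat (N * nat b) * x \<in> \<int>"
        using N(2)[of x] by (metis "1" "2" Ints_mult Ints_of_int insertE)
    qed (use N b in simp)
  qed
  thus ?thesis using that by blast
qed

text \<open>The Gram matrix of the trace form that occurs in \<open>discriminant\<close>, for
  arbitrary lists: the minimality argument also needs it for lists not yet known to be integral
  bases.\<close>

definition trace_mat :: "'a :: field_char_0 set \<Rightarrow> 'a list \<Rightarrow> rat mat" where
  "trace_mat L bs = mat (length bs) (length bs) (\<lambda>(i, j). field_trace L (bs ! i * bs ! j))"

definition list_basis :: "'a :: field_char_0 set \<Rightarrow> 'a list \<Rightarrow> bool" where
  "list_basis L bs \<longleftrightarrow> distinct bs \<and> rat_vec.independent (set bs) \<and> rat_vec.span (set bs) = L"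

lemma trace_mat_carrier: "trace_mat L bs \<in> carrier_mat (length bs) (length bs)"
  by (simp add: trace_mat_def)

lemma sum_nth_distinct: "distinct bs \<Longrightarrow> (\<Sum>i<length bs. f (bs ! i)) = (\<Sum>b\<in>set bs. f b)"
  by (rule sum.reindex_bij_betw[OF bij_betw_nth]) auto

context
  fixes L :: "'a :: field_char_0 set"
  assumes L: "number_field L"
begin

lemma list_basis_subset: "list_basis L bs \<Longrightarrow> set bs \<subseteq> L"
  using rat_vec.span_superset by (auto simp: list_basis_def)

lemma list_basis_sum:
  assumes "list_basis L bs" "x \<in> L"
  shows "x = (\<Sum>i<length bs. of_rat (rat_vec.representation (set bs) x (bs ! i)) * bs ! i)"
proof -
  have "(\<Sum>i<length bs. of_rat (rat_vec.representation (set bs) x (bs ! i)) * bs ! i) =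
      (\<Sum>b\<in>set bs. of_rat (rat_vec.representation (set bs) x b) * b)"
    using assms by (intro sum_nth_distinct) (simp add: list_basis_def)
  thus ?thesis using rational_basis_sum[OF L, of "set bs" x] assms by (simp add: list_basis_def)
qed

lemma list_basis_unique:
  assumes bs: "list_basis L bs" and eq: "x = (\<Sum>i<length bs. of_rat (q i) * bs ! i)" and k: "k < length bs"
  shows "rat_vec.representation (set bs) x (bs ! k) = q k"
proof -
  have d: "distinct bs" and ind: "rat_vec.independent (set bs)" and sp: "rat_vec.span (set bs) = L"
    using bs by (auto simp: list_basis_def)
  have "rat_vec.representation (set bs) x (bs ! k) =
      (\<Sum>i<length bs. q i * rat_vec.representation (set bs) (bs ! i) (bs ! k))"
    unfolding eq using list_basis_subset[OF bs] by (intro representation_sum_scale[OF L ind sp]) auto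
  also have "\<dots> = (\<Sum>i<length bs. if i = k then q i else 0)"
    using k d by (intro sum.cong) (auto simp: rat_vec.representation_basis[OF ind] nth_eq_iff_index_eq)
  finally show ?thesis using k by simp
qed

lemma list_basis_length_eq:
  assumes "list_basis L bs" "list_basis L cs"
  shows "length bs = length cs"
proof -
  have "card (set bs) \<le> card (set cs)" if "list_basis L bs" "list_basis L cs" for bs cs
    using rat_vec.independent_span_bound[of "set cs" "set bs"] that list_basis_subset[of bs]
    by (auto simp: list_basis_def)
  from this[OF assms] this[OF assms(2,1)] show ?thesis
    using assms by (simp add: list_basis_def distinct_card)
qed

text \<open>Clearing the denominators in the rational matrix of multiplication by \<open>x\<close>
  leaves an integer matrix for multiplication by \<open>N * x\<close>.\<close>

lemma algebraic_int_multiple: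
  assumes x: "x \<in> L"
  obtains N :: nat where "N > 0" "algebraic_int (of_nat N * x)"
proof -
  obtain B where B: "rat_vec.independent B" "rat_vec.span B = L" by (rule ex_rational_basis[OF L])
  have fin: "finite B" by (rule finite_rational_basis[OF L B])
  have BL: "B \<subseteq> L" using rat_vec.span_superset B by metis
  have "1 \<in> L" by (rule subring_1[OF number_field_subring[OF L]])
  hence "B \<noteq> {}" using B by auto
  then obtain b where b: "b \<in> B" by blast
  hence "b \<noteq> 0" using B rat_vec.dependent_zero by blast
  define S where "S = (\<lambda>(b, c). rat_vec.representation B (x * b) c) ` (B \<times> B)"
  have "finite S" using fin by (simp add: S_def)
  then obtain N :: nat where N: "N > 0" "\<And>q. q \<in> S \<Longrightarrow> of_nat N * q \<in> \<int>"
    by (rule common_denominator) blast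
  have "algebraic_int (of_nat N * x)"
  proof (rule algebraic_int_if_stable_span[OF fin b \<open>b \<noteq> 0\<close>])
    fix s assume s: "s \<in> B"
    hence "x * s \<in> L" using x BL subring_mult[OF number_field_subring[OF L]] by auto
    from rational_basis_sum[OF L B this]
    have "of_nat N * x * s = (\<Sum>c\<in>B. of_rat (of_nat N * rat_vec.representation B (x * s) c) * c)"
      by (simp add: of_rat_mult mult.assoc flip: sum_distrib_left)
    also have "\<dots> \<in> int_mod.span B"
    proof (rule int_mod.span_sum)
      fix c assume c: "c \<in> B"
      have "of_nat N * rat_vec.representation B (x * s) c \<in> \<int>"
        by (rule N(2)) (use s c in \<open>auto simp: S_def\<close>)
      then obtain k where "of_nat N * rat_vec.representation B (x * s) c = of_int k"
        by (auto elim: Ints_cases)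
      thus "of_rat (of_nat N * rat_vec.representation B (x * s) c) * c \<in> int_mod.span B"
        using c by (simp add: int_mod.span_scale int_mod.span_base del: of_rat_mult)
    qed
    finally show "of_nat N * x * s \<in> int_mod.span B" .
  qed
  with N(1) show ?thesis by (rule that)
qed

lemma det_trace_mat_change:
  assumes bs: "set bs \<subseteq> L" and len: "length cs = length bs"
    and cs: "\<And>i. i < length bs \<Longrightarrow> cs ! i = (\<Sum>j<length bs. of_rat (C i j) * bs ! j)"
  shows "det (trace_mat L cs) =
    (det (mat (length bs) (length bs) (\<lambda>(i, j). C i j)))\<^sup>2 * det (trace_mat L bs)"
proof -
  define n where "n = length bs"
  define M where "M = mat n n (\<lambda>(i, j). C i j)"
  have M: "M \<in> carrier_mat n n" by (simp add: M_def)
  have T: "trace_mat L bs \<in> carrier_mat n n" by (simp add: n_def trace_mat_carrier)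
  have mem: "bs ! i * bs ! j \<in> L" if "i < n" "j < n" for i j
    using bs that by (intro subring_mult[OF number_field_subring[OF L]]) (auto simp: n_def)
  have "trace_mat L cs = M * trace_mat L bs * transpose_mat M"
  proof (rule eq_matI)
    fix i k assume "i < dim_row (M * trace_mat L bs * transpose_mat M)" "k < dim_col (M * trace_mat L bs * transpose_mat M)"
    hence ik: "i < n" "k < n" using M by auto
    have "cs ! i * cs ! k = (\<Sum>l<n. \<Sum>j<n. of_rat (C i j * C k l) * (bs ! j * bs ! l))"
      using ik cs by (simp add: n_def sum_product of_rat_mult) (subst sum.swap, simp add: mult_ac)
    also have "field_trace L \<dots> = (\<Sum>l<n. \<Sum>j<n. C i j * C k l * field_trace L (bs ! j * bs ! l))"
    proof (subst field_trace_sum[OF L])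
      show "(\<Sum>j<n. of_rat (C i j * C k l) * (bs ! j * bs ! l)) \<in> L" if "l \<in> {..<n}" for l
        using that mem by (intro subring_sum[OF number_field_subring[OF L]] number_field_scale[OF L]) auto
      show "(\<Sum>l<n. field_trace L (\<Sum>j<n. of_rat (C i j * C k l) * (bs ! j * bs ! l))) =
          (\<Sum>l<n. \<Sum>j<n. C i j * C k l * field_trace L (bs ! j * bs ! l))"
        using mem by (intro sum.cong refl field_trace_sum_scale[OF L]) auto
    qed
    also have "\<dots> = (M * trace_mat L bs * transpose_mat M) $$ (i, k)"
      using ik by (simp add: M_def trace_mat_def n_def[symmetric] scalar_prod_def lessThan_atLeast0
          sum_distrib_left sum_distrib_right mult_ac)
    finally show "trace_mat L cs $$ (i, k) = (M * trace_mat L bs * transpose_mat M) $$ (i, k)"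
      using ik len by (simp add: trace_mat_def n_def)
  qed (use len M in \<open>auto simp: trace_mat_def n_def\<close>)
  hence "det (trace_mat L cs) = det M * det (trace_mat L bs) * det M"
    using M T by (simp add: det_mult[of _ n] det_transpose)
  thus ?thesis by (simp add: power2_eq_square M_def n_def)
qed

text \<open>A kernel vector would give a nonzero \<open>x\<close> orthogonal to the basis, hence to
  \<open>inverse x\<close>, although the trace of 1 is positive.\<close>

lemma det_trace_mat_nonzero:
  assumes bs: "list_basis L bs"
  shows "det (trace_mat L bs) \<noteq> 0"
proof
  define n where "n = length bs"
  note R = number_field_subring[OF L]
  assume "det (trace_mat L bs) = 0"
  then obtain v where v: "v \<in> carrier_vec n" "v \<noteq> 0\<^sub>v n" "trace_mat L bs *\<^sub>v v = 0\<^sub>v n"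
    using det_0_iff_vec_prod_zero_field[OF trace_mat_carrier] by (auto simp: n_def)
  define x where "x = (\<Sum>j<n. of_rat (v $ j) * bs ! j)"
  have bL: "bs ! i \<in> L" if "i < n" for i using that list_basis_subset[OF bs] by (auto simp: n_def)
  have xL: "x \<in> L" unfolding x_def using bL by (auto intro!: subring_sum[OF R] number_field_scale[OF L])
  obtain k where k: "k < n" "v $ k \<noteq> 0" using v(1,2) by (auto simp: vec_eq_iff)
  have "rat_vec.representation (set bs) x (bs ! k) = v $ k"
    by (rule list_basis_unique[OF bs]) (use k in \<open>auto simp: x_def n_def\<close>)
  hence x0: "x \<noteq> 0" using k by (auto simp: rat_vec.representation_zero)
  have tr: "field_trace L (bs ! i * x) = 0" if i: "i < n" for i
  proof -
    have "field_trace L (bs ! i * x) = (\<Sum>j<n. field_trace L (of_rat (v $ j) * (bs ! i * bs ! j)))"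
      unfolding x_def sum_distrib_left using i bL
      by (subst field_trace_sum[OF L, symmetric])
        (auto intro!: number_field_scale[OF L] subring_mult[OF R] simp: mult.left_commute)
    also have "\<dots> = (trace_mat L bs *\<^sub>v v) $ i"
      using i v(1) bL subring_mult[OF R]
      by (simp add: field_trace_scale[OF L] trace_mat_def n_def[symmetric] scalar_prod_def lessThan_atLeast0 mult.commute)
    finally show ?thesis using v(3) i by simp
  qed
  let ?y = "inverse x"
  have yL: "?y \<in> L" using number_field_inverse[OF L xL] .
  have "field_trace L (?y * x) =
      field_trace L (\<Sum>i<n. of_rat (rat_vec.representation (set bs) ?y (bs ! i)) * (bs ! i * x))"
    by (subst list_basis_sum[OF bs yL]) (simp add: n_def sum_distrib_right mult.assoc)
  also have "\<dots> = 0"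
    by (subst field_trace_sum[OF L])
      (auto intro!: number_field_scale[OF L] subring_mult[OF R] bL xL simp: field_trace_scale[OF L] subring_mult[OF R] bL xL tr)
  finally show False using field_trace_1[OF L] x0 by simp
qed

text \<open>A relation among the entries is a kernel vector of the trace matrix, and the right
  number of independent elements spans. This recognises a modified basis by its determinant
  alone.\<close>

lemma list_basis_if_det_nonzero:
  assumes cs: "set cs \<subseteq> L" and det: "det (trace_mat L cs) \<noteq> 0"
    and bs: "list_basis L bs" and len: "length cs = length bs"
  shows "list_basis L cs"
proof -
  define n where "n = length cs"
  note R = number_field_subring[OF L]
  have cL: "cs ! i \<in> L" if "i < n" for i using that cs by (auto simp: n_def)
  have indep: "q i = 0" if sum: "(\<Sum>j<n. of_rat (q j) * cs ! j) = 0" and i: "i < n" for q i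
  proof (rule ccontr)
    assume nz: "q i \<noteq> 0"
    have "trace_mat L cs *\<^sub>v vec n q = 0\<^sub>v n"
    proof (rule eq_vecI)
      fix k assume "k < dim_vec (0\<^sub>v n :: rat vec)"
      hence k: "k < n" by simp
      have "(trace_mat L cs *\<^sub>v vec n q) $ k = (\<Sum>j<n. field_trace L (of_rat (q j) * (cs ! k * cs ! j)))"
        using k cL subring_mult[OF R]
        by (simp add: field_trace_scale[OF L] trace_mat_def n_def[symmetric] scalar_prod_def lessThan_atLeast0 mult.commute)
      also have "\<dots> = field_trace L (cs ! k * (\<Sum>j<n. of_rat (q j) * cs ! j))"
        unfolding sum_distrib_left using k cL
        by (subst field_trace_sum[OF L, symmetric])
          (auto intro!: number_field_scale[OF L] subring_mult[OF R] simp: mult.left_commute)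
      also have "\<dots> = 0" using field_trace_scale[OF L subring_0[OF R], of 0] by (simp add: sum)
      finally show "(trace_mat L cs *\<^sub>v vec n q) $ k = 0\<^sub>v n $ k" using k by simp
    qed (simp add: trace_mat_def n_def)
    moreover have "vec n q \<noteq> 0\<^sub>v n"
    proof
      assume "vec n q = 0\<^sub>v n"
      hence "vec n q $ i = 0" using i by simp
      thus False using nz i by simp
    qed
    ultimately have "det (trace_mat L cs) = 0"
      using det_0_iff_vec_prod_zero_field[OF trace_mat_carrier, of L cs]
      by (auto simp: n_def intro!: exI[of _ "vec n q"])
    with det show False by contradiction
  qed
  have dist: "distinct cs"
  proof (rule ccontr)
    assume "\<not> distinct cs"
    then obtain i j where ij: "i < n" "j < n" "i \<noteq> j" "cs ! i = cs ! j"
      by (auto simp: distinct_conv_nth n_def)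
    \<comment> \<open>A repeated entry yields the relation with coefficients 1 and -1.\<close>
    define q where "q k = (if k = i then 1 else if k = j then -1 else 0 :: rat)" for k
    have "(\<Sum>k<n. of_rat (q k) * cs ! k) = (\<Sum>k\<in>{i, j}. of_rat (q k) * cs ! k)"
      using ij by (intro sum.mono_neutral_right) (auto simp: q_def)
    also have "\<dots> = 0" using ij by (simp add: q_def)
    finally have "q i = 0" using indep ij by blast
    thus False by (simp add: q_def)
  qed
  have ind: "rat_vec.independent (set cs)"
  proof (rule rat_vec.independent_if_scalars_zero)
    fix f x assume "(\<Sum>x\<in>set cs. of_rat (f x) * x) = 0" "x \<in> set cs"
    thus "f x = 0"
      using indep[of "\<lambda>j. f (cs ! j)"] sum_nth_distinct[OF dist, of "\<lambda>x. of_rat (f x) * x"]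
      by (auto simp: n_def in_set_conv_nth)
  qed simp
  have "L \<subseteq> rat_vec.span (set cs)"
  proof
    fix x assume x: "x \<in> L"
    show "x \<in> rat_vec.span (set cs)"
    proof (rule ccontr)
      assume nin: "x \<notin> rat_vec.span (set cs)"
      hence "rat_vec.independent (insert x (set cs))" using ind by (rule rat_vec.independent_insertI)
      moreover have "insert x (set cs) \<subseteq> rat_vec.span (set bs)" using x cs bs by (auto simp: list_basis_def)
      ultimately have "card (insert x (set cs)) \<le> card (set bs)"
        using rat_vec.independent_span_bound[of "set bs"] by blast
      moreover have "x \<notin> set cs" using nin rat_vec.span_base by blast
      ultimately show False using dist bs len by (simp add: distinct_card list_basis_def)
    qed
  qed
  moreover have "rat_vec.span (set cs) \<subseteq> L"
    using cs number_field_subspace[OF L] by (rule rat_vec.span_minimal)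
  ultimately show ?thesis using dist ind by (auto simp: list_basis_def)
qed

lemma det_trace_mat_Ints:
  assumes "set bs \<subseteq> ring_of_integers L"
  shows "det (trace_mat L bs) \<in> \<int>"
proof -
  have "field_trace L (bs ! i * bs ! j) \<in> \<int>" if "i < length bs" "j < length bs" for i j
  proof -
    have "bs ! i \<in> ring_of_integers L" "bs ! j \<in> ring_of_integers L" using that assms by auto
    thus ?thesis
      by (intro field_trace_algebraic_int[OF L])
        (auto simp: ring_of_integers_def intro: algebraic_int_mult subring_mult[OF number_field_subring[OF L]])
  qed
  hence t: "field_trace L (bs ! i * bs ! j) = of_int \<lfloor>field_trace L (bs ! i * bs ! j)\<rfloor>"
    if "i < length bs" "j < length bs" for i j
    using that by (force elim: Ints_cases)
  have "trace_mat L bs = map_mat of_int (mat (length bs) (length bs) (\<lambda>(i, j). \<lfloor>field_trace L (bs ! i * bs ! j)\<rfloor>))"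
    by (rule eq_matI) (simp_all add: trace_mat_def flip: t)
  thus ?thesis by (simp add: of_int_hom.hom_det)
qed

lemma ring_of_integers_subring: "is_subring (ring_of_integers L)"
  unfolding ring_of_integers_eq
  by (intro is_subring_Int number_field_subring[OF L] is_subring_algebraic_ints)

lemma ex_list_basis_integers: obtains bs where "list_basis L bs" "set bs \<subseteq> ring_of_integers L"
proof -
  have "L \<subseteq> rat_vec.span (ring_of_integers L)"
  proof
    fix x assume x: "x \<in> L"
    obtain N :: nat where N: "N > 0" "algebraic_int (of_nat N * x)" by (rule algebraic_int_multiple[OF x])
    have "of_nat N * x \<in> ring_of_integers L"
      using N x subring_mult[OF number_field_subring[OF L]] subring_of_nat[OF number_field_subring[OF L]]
      by (auto simp: ring_of_integers_def)
    hence "of_rat (1 / of_nat N) * (of_nat N * x) \<in> rat_vec.span (ring_of_integers L)"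
      by (intro rat_vec.span_scale rat_vec.span_base)
    thus "x \<in> rat_vec.span (ring_of_integers L)" using N by (simp add: of_rat_divide)
  qed
  then obtain B where B: "B \<subseteq> ring_of_integers L" "rat_vec.independent B" "rat_vec.span B = L"
    using ex_rational_basis_subset[OF _ number_field_subspace[OF L], of "ring_of_integers L"]
    by (auto simp: ring_of_integers_def)
  obtain bs where "set bs = B" "distinct bs"
    using finite_distinct_list[OF finite_rational_basis[OF L B(2,3)]] by blast
  with B show ?thesis by (intro that[of bs]) (auto simp: list_basis_def)
qed

lemma det_identity_replace_row:
  fixes a :: "nat \<Rightarrow> 'b :: comm_ring_1"
  assumes "k < n"
  shows "det (mat n n (\<lambda>(i, j). if i = k then a j else if i = j then 1 else 0)) = a k"
proof -
  let ?A = "mat n n (\<lambda>(i, j). if i = k then a j else if i = j then 1 else 0)"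
  have "det ?A = (\<Sum>i<n. ?A $$ (i, k) * cofactor ?A i k)"
    by (rule laplace_expansion_column) (use assms in auto)
  also have "\<dots> = (\<Sum>i<n. if i = k then a k * cofactor ?A k k else 0)"
    using assms by (intro sum.cong) auto
  also have "\<dots> = a k * cofactor ?A k k" using assms by simp
  also have "mat_delete ?A k k = 1\<^sub>m (n - 1)"
    using assms by (intro eq_matI) (auto simp: mat_delete_def)
  hence "cofactor ?A k k = 1" by (simp add: cofactor_def)
  finally show ?thesis by simp
qed

text \<open>A rational basis of integers whose discriminant has minimal absolute value is an integral basis.\<close>

lemma ex_integral_basis: obtains bs where "integral_basis L bs"
proof -
  let ?O = "ring_of_integers L"
  note OR = ring_of_integers_subring
  obtain bs0 where bs0: "list_basis L bs0" "set bs0 \<subseteq> ?O" by (rule ex_list_basis_integers)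
  define P where "P bs \<longleftrightarrow> list_basis L bs \<and> set bs \<subseteq> ?O" for bs
  \<comment> \<open>The determinants compared are integers, so the floor loses nothing and
    minimality becomes a question about natural numbers.\<close>
  define f where "f bs = nat \<lfloor>\<bar>det (trace_mat L bs)\<bar>\<rfloor>" for bs
  have "P bs0" using bs0 by (simp add: P_def)
  then obtain bs where bs: "P bs" and min: "\<And>cs. P cs \<Longrightarrow> f bs \<le> f cs"
    using ex_has_least_nat[of P bs0 f] by blast
  have lb: "list_basis L bs" and bO: "set bs \<subseteq> ?O" using bs by (auto simp: P_def)
  define n where "n = length bs"
  have int: "rat_vec.representation (set bs) w (bs ! k) \<in> \<int>" if w: "w \<in> ?O" and k: "k < n" for w k
  proof (rule ccontr)
    define a where "a i = rat_vec.representation (set bs) w (bs ! i)" for i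
    assume "\<not> ?thesis"
    hence ak: "a k \<notin> \<int>" by (simp add: a_def)
    define r where "r = frac (a k)"
    have r: "0 < r" "r < 1" using ak by (auto simp: r_def frac_gt_0_iff frac_lt_1)
    \<comment> \<open>Subtracting the integer part leaves only the fractional part \<open>r\<close>
      of the offending coordinate. Swapping the result in for \<open>bs ! k\<close> changes the
      basis by a matrix of determinant \<open>r\<close>, so the discriminant shrinks by the factor
      \<open>r\<^sup>2 < 1\<close>.\<close>
    define cs where "cs = bs[k := w - of_int \<lfloor>a k\<rfloor> * bs ! k]"
    have wL: "w \<in> L" using w by (simp add: ring_of_integers_def)
    have len: "length cs = length bs" by (simp add: cs_def)
    have csO: "set cs \<subseteq> ?O"
    proof -
      have "w - of_int \<lfloor>a k\<rfloor> * bs ! k \<in> ?O"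
        using w k bO by (intro subring_diff[OF OR] subring_mult[OF OR] subring_of_int[OF OR]) (auto simp: n_def)
      thus ?thesis using bO set_update_subset_insert[of bs k] unfolding cs_def by blast
    qed
    define C where "C i j = (if i = k then (if j = k then r else a j) else if i = j then 1 else 0)" for i j
    have "cs ! i = (\<Sum>j<length bs. of_rat (C i j) * bs ! j)" if i: "i < length bs" for i
    proof (cases "i = k")
      case False
      have "(\<Sum>j<length bs. of_rat (C i j) * bs ! j) = (\<Sum>j<length bs. if j = i then bs ! j else 0)"
        using False by (intro sum.cong) (auto simp: C_def)
      thus ?thesis using False i by (simp add: cs_def)
    next
      case True
      have "(\<Sum>j<length bs. of_rat (C i j) * bs ! j) =
          (\<Sum>j<length bs. of_rat (a j) * bs ! j - (if j = k then of_int \<lfloor>a k\<rfloor> * bs ! j else 0))"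
        using True by (intro sum.cong) (auto simp: C_def r_def frac_def of_rat_diff algebra_simps)
      also have "\<dots> = w - of_int \<lfloor>a k\<rfloor> * bs ! k"
        using list_basis_sum[OF lb wL] k by (simp add: sum_subtractf a_def n_def)
      finally show ?thesis using True i by (simp add: cs_def)
    qed
    hence "det (trace_mat L cs) = (det (mat n n (\<lambda>(i, j). C i j)))\<^sup>2 * det (trace_mat L bs)"
      unfolding n_def using list_basis_subset[OF lb] by (intro det_trace_mat_change len)
    also have "det (mat n n (\<lambda>(i, j). C i j)) = r"
      using det_identity_replace_row[OF k, of "\<lambda>j. if j = k then r else a j"] by (simp add: C_def)
    finally have det: "det (trace_mat L cs) = r\<^sup>2 * det (trace_mat L bs)" .
    note nz = det_trace_mat_nonzero[OF lb]
    have "P cs"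
      unfolding P_def using csO det nz r len
      by (auto intro!: list_basis_if_det_nonzero[OF _ _ lb] simp: ring_of_integers_def)
    have "r\<^sup>2 < 1" using r by (simp add: power_less_one_iff)
    hence lt: "\<bar>det (trace_mat L cs)\<bar> < \<bar>det (trace_mat L bs)\<bar>"
      unfolding det using nz by (simp add: abs_mult)
    obtain u v where uv: "det (trace_mat L cs) = of_int u" "det (trace_mat L bs) = of_int v"
      using det_trace_mat_Ints[OF csO] det_trace_mat_Ints[OF bO] by (auto elim!: Ints_cases)
    have "f cs < f bs" using lt unfolding f_def uv by (simp flip: of_int_abs)
    with min[OF \<open>P cs\<close>] show False by simp
  qed
  have "?O \<subseteq> int_mod.span (set bs)"
  proof
    fix w assume w: "w \<in> ?O"
    hence wL: "w \<in> L" by (simp add: ring_of_integers_def)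
    have "(\<Sum>i<length bs. of_rat (rat_vec.representation (set bs) w (bs ! i)) * bs ! i) \<in> int_mod.span (set bs)"
    proof (rule int_mod.span_sum)
      fix i assume "i \<in> {..<length bs}"
      hence i: "i < n" by (simp add: n_def)
      obtain c where "rat_vec.representation (set bs) w (bs ! i) = of_int c"
        using int[OF w i] by (auto elim: Ints_cases)
      thus "of_rat (rat_vec.representation (set bs) w (bs ! i)) * bs ! i \<in> int_mod.span (set bs)"
        using i by (simp add: int_mod.span_scale int_mod.span_base n_def)
    qed
    thus "w \<in> int_mod.span (set bs)" by (subst list_basis_sum[OF lb wL])
  qed
  moreover have "int_mod.span (set bs) \<subseteq> ?O"
    using bO by (rule int_mod.span_minimal)
      (auto simp: int_mod.subspace_def subring_0[OF OR] intro!: subring_add[OF OR] subring_mult[OF OR] subring_of_int[OF OR])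
  moreover have "int_mod.independent (set bs)"
    unfolding int_mod.independent_explicit_module
  proof (intro allI impI)
    fix t u v assume t: "finite t" "t \<subseteq> set bs" "(\<Sum>v\<in>t. of_int (u v) * v) = 0" "v \<in> t"
    have "(of_int (u v) :: rat) = 0"
      using lb t by (intro rat_vec.independentD[of "set bs" t "\<lambda>v. of_int (u v)"]) (auto simp: list_basis_def)
    thus "u v = 0" by simp
  qed
  ultimately have "integral_basis L bs" using lb by (auto simp: integral_basis_def list_basis_def)
  thus ?thesis by (rule that)
qed

text \<open>Independence over the integers extends to the rationals by clearing denominators, and
  the integers of \<open>L\<close> span \<open>L\<close> because every element has an integral
  multiple.\<close>

lemma integral_basis_list_basis:
  assumes bs: "integral_basis L bs"
  shows "list_basis L bs"
proof -
  have O: "int_mod.span (set bs) = ring_of_integers L" and d: "distinct bs"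
    and ind: "int_mod.independent (set bs)" using bs by (auto simp: integral_basis_def)
  have sub: "set bs \<subseteq> ring_of_integers L" using O int_mod.span_superset by metis
  hence subL: "set bs \<subseteq> L" by (auto simp: ring_of_integers_def)
  have "rat_vec.independent (set bs)"
  proof (rule rat_vec.independent_if_scalars_zero)
    fix q x assume q: "(\<Sum>x\<in>set bs. of_rat (q x) * x) = 0" and x: "x \<in> set bs"
    obtain N :: nat where N: "N > 0" "\<And>r. r \<in> q ` set bs \<Longrightarrow> of_nat N * r \<in> \<int>"
      using common_denominator[of "q ` set bs"] by auto
    have "\<exists>u. \<forall>x\<in>set bs. of_nat N * q x = of_int (u x)"
      by (rule bchoice) (use N(2) in \<open>auto elim: Ints_cases\<close>)
    then obtain u where u: "\<And>x. x \<in> set bs \<Longrightarrow> of_nat N * q x = of_int (u x)" by blast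
    have u': "of_int (u x) = of_nat N * (of_rat (q x) :: 'a)" if "x \<in> set bs" for x
      using arg_cong[OF u[OF that], of "of_rat :: rat \<Rightarrow> 'a"] by (simp add: of_rat_mult)
    have "(\<Sum>x\<in>set bs. of_int (u x) * x) = of_nat N * (\<Sum>x\<in>set bs. of_rat (q x) * x)"
      unfolding sum_distrib_left by (intro sum.cong) (auto simp: u' mult.assoc)
    hence "u x = 0" using q x by (intro int_mod.independentD[OF ind, of "set bs"]) auto
    thus "q x = 0" using u[OF x] N by simp
  qed simp
  moreover have "L \<subseteq> rat_vec.span (set bs)"
  proof
    fix x assume x: "x \<in> L"
    obtain N :: nat where N: "N > 0" "algebraic_int (of_nat N * x)" by (rule algebraic_int_multiple[OF x])
    have "of_nat N * x \<in> ring_of_integers L"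
      using N x subring_mult[OF number_field_subring[OF L]] subring_of_nat[OF number_field_subring[OF L]]
      by (auto simp: ring_of_integers_def)
    hence "of_nat N * x \<in> int_mod.span (set bs)" by (simp add: O)
    moreover have "int_mod.span (set bs) \<subseteq> rat_vec.span (set bs)"
    proof (rule int_mod.span_minimal[OF rat_vec.span_superset])
      show "int_mod.subspace (rat_vec.span (set bs))"
        unfolding int_mod.subspace_def
        using rat_vec.span_scale[of _ "set bs" "of_int _"]
        by (auto intro: rat_vec.span_zero rat_vec.span_add)
    qed
    ultimately have "of_rat (1 / of_nat N) * (of_nat N * x) \<in> rat_vec.span (set bs)"
      by (intro rat_vec.span_scale) auto
    thus "x \<in> rat_vec.span (set bs)" using N by (simp add: of_rat_divide)
  qed
  moreover have "rat_vec.span (set bs) \<subseteq> L"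
    using subL number_field_subspace[OF L] by (rule rat_vec.span_minimal)
  ultimately show ?thesis using d by (auto simp: list_basis_def)
qed

lemma integral_basis_subset: "integral_basis L bs \<Longrightarrow> set bs \<subseteq> ring_of_integers L"
  using int_mod.span_superset by (auto simp: integral_basis_def)

lemma integral_basis_coordinates:
  assumes bs: "integral_basis L bs" and x: "x \<in> ring_of_integers L"
  shows "\<exists>u. x = (\<Sum>i<length bs. of_int (u i) * bs ! i)"
proof -
  have "x \<in> int_mod.span (set bs)" using bs x by (simp add: integral_basis_def)
  then obtain u where "x = (\<Sum>b\<in>set bs. of_int (u b) * b)" by (auto simp: int_mod.span_finite)
  moreover have "distinct bs" using bs by (simp add: integral_basis_def)
  ultimately show ?thesis
    by (intro exI[of _ "\<lambda>i. u (bs ! i)"]) (simp add: sum_nth_distinct[where f = "\<lambda>b. of_int (u b) * b"])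
qed

text \<open>This evaluates the \<open>THE\<close> in \<open>discriminant\<close>. Two integral bases
  are integer combinations of each other, so their determinants differ by integer square factors in
  both directions; the determinants being nonzero, these squares are 1.\<close>

lemma of_int_discriminant:
  assumes bs: "integral_basis L bs"
  shows "of_int (discriminant L) = det (trace_mat L bs)"
proof -
  have change: "\<exists>c::int. det (trace_mat L cs) = of_int (c\<^sup>2) * det (trace_mat L bs)"
    if bs: "integral_basis L bs" and cs: "integral_basis L cs" for bs cs
  proof -
    have len: "length cs = length bs"
      using list_basis_length_eq integral_basis_list_basis bs cs by blast
    have "\<forall>i<length bs. \<exists>u. cs ! i = (\<Sum>j<length bs. of_int (u j) * bs ! j)"
      using integral_basis_subset[OF cs] len by (auto intro!: integral_basis_coordinates[OF bs])
    then obtain C where C: "\<And>i. i < length bs \<Longrightarrow> cs ! i = (\<Sum>j<length bs. of_int (C i j) * bs ! j)" by metis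
    let ?n = "length bs"
    have "det (trace_mat L cs) = (det (mat ?n ?n (\<lambda>(i, j). of_int (C i j))))\<^sup>2 * det (trace_mat L bs)"
      by (rule det_trace_mat_change[OF _ len])
        (use C list_basis_subset[OF integral_basis_list_basis[OF bs]] in auto)
    also have "mat ?n ?n (\<lambda>(i, j). of_int (C i j) :: rat) = map_mat of_int (mat ?n ?n (\<lambda>(i, j). C i j))"
      by (rule eq_matI) auto
    finally show ?thesis by (auto simp: of_int_hom.hom_det)
  qed
  have nz: "det (trace_mat L bs) \<noteq> 0" if "integral_basis L bs" for bs
    using det_trace_mat_nonzero integral_basis_list_basis that by blast
  have same: "det (trace_mat L cs) = det (trace_mat L bs)" if cs: "integral_basis L cs" for cs
  proof -
    obtain c e :: int where ce: "det (trace_mat L cs) = of_int (c\<^sup>2) * det (trace_mat L bs)"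
      "det (trace_mat L bs) = of_int (e\<^sup>2) * det (trace_mat L cs)"
      using change[OF bs cs] change[OF cs bs] by blast
    hence "det (trace_mat L bs) = of_int (e\<^sup>2 * c\<^sup>2) * det (trace_mat L bs)"
      by (metis mult.assoc of_int_mult)
    hence "of_int (e\<^sup>2 * c\<^sup>2) = (1 :: rat)" using nz[OF bs] by simp
    hence "e\<^sup>2 * c\<^sup>2 = 1" by (simp only: of_int_eq_1_iff)
    hence "c\<^sup>2 = 1" using zmult_eq_1_iff[of "e\<^sup>2" "c\<^sup>2"] zero_le_power2[of c] by linarith
    thus ?thesis using ce(1) by simp
  qed
  obtain d where d: "det (trace_mat L bs) = of_int d"
    using det_trace_mat_Ints[OF integral_basis_subset[OF bs]] by (auto elim: Ints_cases)
  have "discriminant L = d"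
    unfolding discriminant_def trace_mat_def[symmetric]
  proof (rule the_equality)
    show "\<exists>bs. integral_basis L bs \<and> of_int d = det (trace_mat L bs)" using bs d by metis
    fix d' assume "\<exists>bs. integral_basis L bs \<and> of_int d' = det (trace_mat L bs)"
    then obtain cs where "integral_basis L cs" "of_int d' = det (trace_mat L cs)" by blast
    with same have "(of_int d' :: rat) = of_int d" using d by simp
    thus "d' = d" by simp
  qed
  thus ?thesis using d by simp
qed

end

section \<open>The primes dividing the discriminant\<close>

context
  fixes L :: "'a :: field_char_0 set" and bs :: "'a list" and p :: nat
  assumes L: "number_field L" and bs: "integral_basis L bs" and p: "prime p"
begin

abbreviation (input) "OL \<equiv> ring_of_integers L"

text \<open>The floor only changes the type: on \<open>OL\<close> these coordinates are integers.
  The same holds for \<open>int_trace\<close>.\<close>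

definition coord :: "'a \<Rightarrow> nat \<Rightarrow> int" where
  "coord x i = \<lfloor>rat_vec.representation (set bs) x (bs ! i)\<rfloor>"

definition int_trace :: "'a \<Rightarrow> int" where
  "int_trace x = \<lfloor>field_trace L x\<rfloor>"

definition pcong :: "'a \<Rightarrow> 'a \<Rightarrow> bool" where
  "pcong x y \<longleftrightarrow> (\<exists>z\<in>OL. x - y = of_nat p * z)"

text \<open>The representative of a class modulo \<open>p\<close> with all coordinates in
  \<open>{0..<p}\<close>. The quotient of \<open>OL\<close> by \<open>p\<close> is not formed as a
  type; its ideals are finite sets of such representatives.\<close>

definition residue :: "'a \<Rightarrow> 'a" where
  "residue x = (\<Sum>i<length bs. of_int (coord x i mod int p) * bs ! i)"

lemma OL_subring: "is_subring OL"
  by (rule ring_of_integers_subring[OF L])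

lemmas OL_closed = subring_0[OF OL_subring] subring_1[OF OL_subring] subring_add[OF OL_subring]
  subring_mult[OF OL_subring] subring_uminus[OF OL_subring] subring_diff[OF OL_subring]
  subring_of_nat[OF OL_subring] subring_of_int[OF OL_subring] subring_power[OF OL_subring]

lemma OL_subset: "x \<in> OL \<Longrightarrow> x \<in> L"
  by (simp add: ring_of_integers_def)

lemma nth_OL: "i < length bs \<Longrightarrow> bs ! i \<in> OL"
  using integral_basis_subset[OF L bs] by auto

lemma coord_eq:
  assumes "x = (\<Sum>i<length bs. of_int (u i) * bs ! i)" "k < length bs"
  shows "coord x k = u k"
  using list_basis_unique[OF L integral_basis_list_basis[OF L bs], of x "\<lambda>i. of_int (u i)" k] assms
  by (simp add: coord_def)

lemma sum_coord: "x \<in> OL \<Longrightarrow> (\<Sum>i<length bs. of_int (coord x i) * bs ! i) = x"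
proof -
  assume "x \<in> OL"
  then obtain u where u: "x = (\<Sum>i<length bs. of_int (u i) * bs ! i)"
    using integral_basis_coordinates[OF L bs] by blast
  have "(\<Sum>i<length bs. of_int (coord x i) * bs ! i) = (\<Sum>i<length bs. of_int (u i) * bs ! i)"
    using coord_eq[OF u] by (intro sum.cong) auto
  thus ?thesis using u by simp
qed

lemma int_combination_OL: "(\<Sum>i<length bs. of_int (u i) * bs ! i) \<in> OL"
  by (intro subring_sum[OF OL_subring] OL_closed nth_OL) auto

lemma coord_add:
  assumes "x \<in> OL" "y \<in> OL" "i < length bs"
  shows "coord (x + y) i = coord x i + coord y i"
proof (rule coord_eq[where u = "\<lambda>i. coord x i + coord y i", OF _ assms(3)])
  have "(\<Sum>i<length bs. of_int (coord x i + coord y i) * bs ! i) =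
      (\<Sum>i<length bs. of_int (coord x i) * bs ! i) + (\<Sum>i<length bs. of_int (coord y i) * bs ! i)"
    by (simp add: sum.distrib distrib_right)
  thus "x + y = (\<Sum>i<length bs. of_int (coord x i + coord y i) * bs ! i)"
    using sum_coord[OF assms(1)] sum_coord[OF assms(2)] by simp
qed

lemma coord_of_int_mult:
  assumes "x \<in> OL" "i < length bs"
  shows "coord (of_int k * x) i = k * coord x i"
proof -
  have "of_int k * x = of_int k * (\<Sum>i<length bs. of_int (coord x i) * bs ! i)"
    using sum_coord[OF assms(1)] by simp
  also have "\<dots> = (\<Sum>i<length bs. of_int (k * coord x i) * bs ! i)"
    by (simp only: sum_distrib_left of_int_mult mult.assoc)
  finally show ?thesis by (rule coord_eq[OF _ assms(2)])
qed

lemma int_trace: "x \<in> OL \<Longrightarrow> of_int (int_trace x) = field_trace L x"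
  using field_trace_algebraic_int[OF L, of x] by (auto simp: int_trace_def ring_of_integers_def elim!: Ints_cases)

lemma int_trace_add: "x \<in> OL \<Longrightarrow> y \<in> OL \<Longrightarrow> int_trace (x + y) = int_trace x + int_trace y"
  using int_trace[of "x + y"] int_trace[of x] int_trace[of y] field_trace_add[OF L OL_subset OL_subset, of x y]
  by (simp add: OL_closed flip: of_int_add)

lemma int_trace_of_int_mult: "x \<in> OL \<Longrightarrow> int_trace (of_int k * x) = k * int_trace x"
proof -
  assume x: "x \<in> OL"
  have "(of_int (int_trace (of_int k * x)) :: rat) = of_int (k * int_trace x)"
    using x field_trace_scale[OF L OL_subset[OF x], of "of_int k"] by (simp add: int_trace OL_closed)
  thus ?thesis by (simp only: of_int_eq_iff)
qed

lemma int_trace_sum: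
  "(\<And>i. i \<in> I \<Longrightarrow> f i \<in> OL) \<Longrightarrow> int_trace (\<Sum>i\<in>I. of_int (u i) * f i) = (\<Sum>i\<in>I. u i * int_trace (f i))"
proof (induction I rule: infinite_finite_induct)
  case (insert i I)
  thus ?case
    by (simp add: int_trace_add int_trace_of_int_mult OL_closed subring_sum[OF OL_subring])
qed (use int_trace_of_int_mult[of 0 0] OL_closed in simp_all)

lemma int_trace_eq_sum_coord:
  assumes x: "x \<in> OL"
  shows "int_trace x = (\<Sum>i<length bs. coord (x * bs ! i) i)"
proof -
  note lb = integral_basis_list_basis[OF L bs]
  have rep: "rat_vec.representation (set bs) (x * bs ! i) (bs ! i) = of_int (coord (x * bs ! i) i)"
    if i: "i < length bs" for i
    using x i by (intro list_basis_unique[OF L lb]) (simp_all add: sum_coord OL_closed nth_OL)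
  have "of_int (int_trace x) = field_trace L x" by (rule int_trace[OF x])
  also have "\<dots> = (\<Sum>b\<in>set bs. rat_vec.representation (set bs) (x * b) b)"
    using lb OL_subset[OF x] by (intro field_trace_eq[OF L]) (auto simp: list_basis_def)
  also have "\<dots> = (\<Sum>i<length bs. rat_vec.representation (set bs) (x * bs ! i) (bs ! i))"
    using lb by (intro sum_nth_distinct[symmetric]) (auto simp: list_basis_def)
  also have "\<dots> = of_int (\<Sum>i<length bs. coord (x * bs ! i) i)" by (simp add: rep)
  finally show ?thesis by (simp only: of_int_eq_iff)
qed

lemma pcong_refl: "pcong x x"
  unfolding pcong_def by (intro bexI[of _ 0]) (auto simp: OL_closed)

lemma pcong_sym: "pcong x y \<Longrightarrow> pcong y x"
  unfolding pcong_def by (metis OL_closed(5) minus_diff_eq mult_minus_right)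

lemma pcong_add: "pcong x y \<Longrightarrow> pcong x' y' \<Longrightarrow> pcong (x + x') (y + y')"
  unfolding pcong_def by (metis OL_closed(3) add_diff_add distrib_left)

lemma pcong_trans [trans]: "pcong x y \<Longrightarrow> pcong y z \<Longrightarrow> pcong x z"
  using pcong_add[of x y y z] unfolding pcong_def by simp

lemma pcong_mult_left: "pcong x y \<Longrightarrow> z \<in> OL \<Longrightarrow> pcong (z * x) (z * y)"
  unfolding pcong_def by (metis OL_closed(4) mult.left_commute right_diff_distrib)

lemma pcong_mult_right: "pcong x y \<Longrightarrow> z \<in> OL \<Longrightarrow> pcong (x * z) (y * z)"
  using pcong_mult_left[of x y z] by (simp add: mult.commute)

lemma pcong_diff: "pcong x y \<Longrightarrow> pcong x' y' \<Longrightarrow> pcong (x - x') (y - y')"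
proof -
  assume a: "pcong x y" "pcong x' y'"
  have "pcong (- 1 * x') (- 1 * y')" by (rule pcong_mult_left[OF a(2)]) (simp add: OL_closed)
  with pcong_add[OF a(1)] show ?thesis by fastforce
qed

lemma pcong_sum: "(\<And>i. i \<in> I \<Longrightarrow> pcong (f i) (g i)) \<Longrightarrow> pcong (sum f I) (sum g I)"
  by (induction I rule: infinite_finite_induct) (auto intro: pcong_refl pcong_add)

lemma pcong_of_int: "int p dvd k - l \<Longrightarrow> pcong (of_int k) (of_int l)"
proof -
  assume "int p dvd k - l"
  then obtain t where "k - l = int p * t" by (elim dvdE)
  hence "(of_int (k - l) :: 'a) = of_int (int p * t)" by (simp only:)
  thus ?thesis unfolding pcong_def by (intro bexI[of _ "of_int t"]) (auto simp: OL_closed)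
qed

lemma pcong_0_iff: "pcong x 0 \<longleftrightarrow> x \<in> (*) (of_nat p) ` OL"
  by (auto simp: pcong_def)

lemma pcong_imp_coord:
  assumes "x \<in> OL" "y \<in> OL" "pcong x y" "i < length bs"
  shows "int p dvd coord x i - coord y i"
proof -
  obtain z where z: "z \<in> OL" "x = of_int (int p) * z + y"
    using assms(3) by (auto simp: pcong_def diff_eq_eq)
  hence "coord x i = int p * coord z i + coord y i"
    using assms by (simp only: coord_add coord_of_int_mult OL_closed)
  thus ?thesis by simp
qed

lemma pcong_iff_coord:
  assumes "x \<in> OL" "y \<in> OL"
  shows "pcong x y \<longleftrightarrow> (\<forall>i<length bs. coord x i mod int p = coord y i mod int p)"
proof
  assume "pcong x y"
  thus "\<forall>i<length bs. coord x i mod int p = coord y i mod int p"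
    using pcong_imp_coord[OF assms] by (simp add: mod_eq_dvd_iff)
next
  assume *: "\<forall>i<length bs. coord x i mod int p = coord y i mod int p"
  have "pcong (\<Sum>i<length bs. of_int (coord x i) * bs ! i) (\<Sum>i<length bs. of_int (coord y i) * bs ! i)"
    using * by (intro pcong_sum pcong_mult_right pcong_of_int nth_OL) (auto simp: mod_eq_dvd_iff)
  thus "pcong x y" using assms by (simp add: sum_coord)
qed

lemma residue_OL: "residue x \<in> OL"
  unfolding residue_def by (rule int_combination_OL)

lemma coord_residue: "i < length bs \<Longrightarrow> coord (residue x) i = coord x i mod int p"
  by (rule coord_eq) (simp_all add: residue_def)

lemma pcong_residue: "x \<in> OL \<Longrightarrow> pcong (residue x) x"
  by (subst pcong_iff_coord) (auto simp: residue_OL coord_residue)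

lemma residue_eq_iff: "x \<in> OL \<Longrightarrow> y \<in> OL \<Longrightarrow> residue x = residue y \<longleftrightarrow> pcong x y"
proof
  assume xy: "x \<in> OL" "y \<in> OL"
  show "pcong x y" if "residue x = residue y"
    using pcong_residue[OF xy(1)] pcong_residue[OF xy(2)] that pcong_sym pcong_trans by metis
  show "residue x = residue y" if "pcong x y"
    using that xy by (auto simp: residue_def pcong_iff_coord intro!: sum.cong)
qed

lemma finite_residues: "finite (residue ` A)"
proof -
  have "residue ` A \<subseteq> (\<lambda>u. \<Sum>i<length bs. of_int (u i) * bs ! i) ` (PiE {..<length bs} (\<lambda>_. {0..<int p}))"
  proof
    fix y assume "y \<in> residue ` A"
    then obtain x where y: "y = residue x" by blast
    define u where "u = restrict (\<lambda>i. coord x i mod int p) {..<length bs}"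
    have "y = (\<Sum>i<length bs. of_int (u i) * bs ! i)" by (simp add: y residue_def u_def)
    moreover have "u \<in> PiE {..<length bs} (\<lambda>_. {0..<int p})"
      using prime_gt_0_nat[OF p] by (auto simp: u_def)
    ultimately show "y \<in> (\<lambda>u. \<Sum>i<length bs. of_int (u i) * bs ! i) ` (PiE {..<length bs} (\<lambda>_. {0..<int p}))"
      by blast
  qed
  thus ?thesis by (rule finite_subset) (auto intro!: finite_imageI finite_PiE)
qed

lemma int_trace_pcong:
  assumes "x \<in> OL" "y \<in> OL" "pcong x y"
  shows "int p dvd int_trace x - int_trace y"
proof -
  obtain z where z: "z \<in> OL" "x = of_int (int p) * z + y"
    using assms(3) by (auto simp: pcong_def diff_eq_eq)
  have "int_trace x = int p * int_trace z + int_trace y"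
    using assms z by (simp only: int_trace_add int_trace_of_int_mult OL_closed)
  thus ?thesis by simp
qed

section \<open>The trace form modulo p\<close>

definition int_trace_mat :: "int mat" where
  "int_trace_mat = mat (length bs) (length bs) (\<lambda>(i, j). int_trace (bs ! i * bs ! j))"

lemma discriminant_eq_det: "discriminant L = det int_trace_mat"
proof -
  have "trace_mat L bs = map_mat of_int int_trace_mat"
    by (rule eq_matI) (auto simp: trace_mat_def int_trace_mat_def int_trace nth_OL OL_closed)
  hence "of_int (discriminant L) = (of_int (det int_trace_mat) :: rat)"
    by (simp add: of_int_discriminant[OF L bs] of_int_hom.hom_det)
  thus ?thesis by simp
qed

text \<open>Elements of square zero modulo \<open>p\<close> lie in the radical of the trace form.\<close>

lemma prime_dvd_discriminant_if_not_reduced: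
  assumes v: "v \<in> OL" "\<not> pcong v 0" "pcong (v\<^sup>2) 0"
  shows "int p dvd discriminant L"
proof (rule ccontr)
  assume ndvd: "\<not> int p dvd discriminant L"
  define n where "n = length bs"
  define T where "T = int_trace_mat"
  have T: "T \<in> carrier_mat n n" by (simp add: T_def int_trace_mat_def n_def)
  define c where "c = vec n (coord v)"
  have c: "c \<in> carrier_vec n" by (simp add: c_def)
  obtain w where w: "w \<in> OL" "v\<^sup>2 = of_nat p * w" using v(3) by (auto simp: pcong_def)
  have dvd: "int p dvd int_trace (bs ! i * v)" if i: "i < n" for i
  proof -
    have b: "bs ! i \<in> OL" using i by (simp add: n_def nth_OL)
    have "(bs ! i * v)\<^sup>2 = of_nat p * ((bs ! i)\<^sup>2 * w)" using w by (simp add: power_mult_distrib)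
    moreover have "bs ! i * v \<in> OL" "(bs ! i)\<^sup>2 * w \<in> OL" using b v w by (auto intro!: OL_closed)
    ultimately obtain k where "field_trace L (bs ! i * v) = of_int (int p * k)"
      using field_trace_nilpotent_mod_prime[OF L _ _ _ _ p, of "bs ! i * v" "(bs ! i)\<^sup>2 * w"]
      by (auto simp: ring_of_integers_def)
    with int_trace[OF \<open>bs ! i * v \<in> OL\<close>] have "int_trace (bs ! i * v) = int p * k"
      by (simp only: of_int_eq_iff)
    thus ?thesis by simp
  qed
  have Tc: "(T *\<^sub>v c) $ i = int_trace (bs ! i * v)" if i: "i < n" for i
  proof -
    have b: "bs ! i \<in> OL" using i by (simp add: n_def nth_OL)
    have "bs ! i * v = (\<Sum>j<n. of_int (coord v j) * (bs ! i * bs ! j))"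
      by (subst sum_coord[OF v(1), symmetric]) (simp add: n_def sum_distrib_left mult.left_commute)
    hence "int_trace (bs ! i * v) = (\<Sum>j<n. coord v j * int_trace (bs ! i * bs ! j))"
      using b i by (simp only:) (intro int_trace_sum OL_closed nth_OL, auto simp: n_def)
    also have "\<dots> = (T *\<^sub>v c) $ i"
      using i by (simp add: T_def int_trace_mat_def c_def n_def[symmetric] scalar_prod_def lessThan_atLeast0 mult.commute)
    finally show ?thesis ..
  qed
  \<comment> \<open>The adjugate solves \<open>T c = 0\<close> modulo \<open>p\<close> while staying
    over the integers: it yields \<open>det T * c = 0\<close> modulo \<open>p\<close>, and
    \<open>det T\<close> is prime to \<open>p\<close>.\<close>
  have adj: "adj_mat T \<in> carrier_mat n n" "adj_mat T * T = det T \<cdot>\<^sub>m 1\<^sub>m n"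
    using adj_mat[OF T] by auto
  have "int p dvd coord v k" if k: "k < n" for k
  proof -
    have "det T * coord v k = ((adj_mat T * T) *\<^sub>v c) $ k"
      using k by (simp add: adj(2) c_def)
    also have "(adj_mat T * T) *\<^sub>v c = adj_mat T *\<^sub>v (T *\<^sub>v c)"
      by (rule assoc_mult_mat_vec[OF adj(1) T c])
    also have "\<dots> $ k = (\<Sum>i<n. adj_mat T $$ (k, i) * (T *\<^sub>v c) $ i)"
      using k adj(1) T c by (simp add: scalar_prod_def lessThan_atLeast0)
    also have "int p dvd \<dots>" by (intro dvd_sum) (auto simp: Tc dvd)
    finally have "int p dvd det T * coord v k" .
    thus ?thesis
      using ndvd p discriminant_eq_det by (simp add: T_def prime_dvd_mult_iff)
  qed
  hence "pcong v 0"
    using v(1) coord_of_int_mult[of 0 _ 0] by (subst pcong_iff_coord) (auto simp: OL_closed n_def)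
  with v(2) show False by contradiction
qed

text \<open>If the radical modulo \<open>p\<close> were trivial, pairing with the basis would be an
  injective map from the finite set of coordinate vectors modulo \<open>p\<close> to itself, hence
  surjective. Preimages of the unit vectors would form an inverse of the trace matrix modulo
  \<open>p\<close>, so its determinant could not be divisible by \<open>p\<close>.\<close>

lemma ex_trace_radical:
  assumes "int p dvd discriminant L"
  obtains v where "v \<in> OL" "\<not> pcong v 0" "\<And>y. y \<in> OL \<Longrightarrow> int p dvd int_trace (v * y)"
proof (rule ccontr)
  assume contr: "\<not> thesis"
  define n where "n = length bs"
  define Bx where "Bx = PiE {..<n} (\<lambda>_. {0..<int p})"
  define el where "el u = (\<Sum>i<n. of_int (u i) * bs ! i)" for u
  define \<Theta> where "\<Theta> u = restrict (\<lambda>j. int_trace (el u * bs ! j) mod int p) {..<n}" for u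
  have p0: "int p > 0" using prime_gt_0_nat[OF p] by simp
  have el: "el u \<in> OL" for u unfolding el_def n_def by (rule int_combination_OL)
  have "inj_on \<Theta> Bx"
  proof (rule inj_onI)
    fix u u' assume u: "u \<in> Bx" "u' \<in> Bx" and eq: "\<Theta> u = \<Theta> u'"
    define v where "v = el u - el u'"
    have vO: "v \<in> OL" unfolding v_def by (intro OL_closed el)
    have "int p dvd int_trace (v * bs ! j)" if j: "j < n" for j
    proof -
      have b: "bs ! j \<in> OL" using j by (simp add: n_def nth_OL)
      have "\<Theta> u j = \<Theta> u' j" using eq by simp
      hence "int p dvd int_trace (el u * bs ! j) - int_trace (el u' * bs ! j)"
        using j by (simp add: \<Theta>_def mod_eq_dvd_iff)
      moreover have "int_trace (el u * bs ! j) = int_trace (v * bs ! j) + int_trace (el u' * bs ! j)"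
        using int_trace_add[of "v * bs ! j" "el u' * bs ! j"] b vO el by (simp add: OL_closed v_def left_diff_distrib)
      ultimately show ?thesis by simp
    qed
    hence "int p dvd int_trace (v * y)" if y: "y \<in> OL" for y
    proof -
      have "v * y = (\<Sum>j<n. of_int (coord y j) * (v * bs ! j))"
        by (subst sum_coord[OF y, symmetric]) (simp add: n_def sum_distrib_left mult.left_commute)
      hence "int_trace (v * y) = (\<Sum>j<n. coord y j * int_trace (v * bs ! j))"
        using vO by (simp only:) (intro int_trace_sum OL_closed nth_OL, auto simp: n_def)
      also have "int p dvd \<dots>" using \<open>\<And>j. j < n \<Longrightarrow> int p dvd int_trace (v * bs ! j)\<close> by (intro dvd_sum) auto
      finally show ?thesis .
    qed
    with contr vO that have "pcong v 0" by blast
    hence "pcong (el u) (el u')" by (simp add: pcong_def v_def)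
    hence "u i = u' i" if "i < n" for i
    proof -
      have "coord (el u) i mod int p = coord (el u') i mod int p"
        using \<open>pcong (el u) (el u')\<close> that el by (simp add: pcong_iff_coord n_def)
      moreover have "coord (el u) i = u i" "coord (el u') i = u' i"
        using that coord_eq[of _ _ i] by (simp_all add: el_def n_def)
      moreover have "u i \<in> {0..<int p}" "u' i \<in> {0..<int p}" using u that by (auto simp: Bx_def PiE_def)
      ultimately show ?thesis by simp
    qed
    thus "u = u'" using u by (auto simp: Bx_def intro: PiE_ext)
  qed
  moreover have fin: "finite Bx" unfolding Bx_def by (intro finite_PiE) auto
  moreover have "\<Theta> u \<in> Bx" for u
    unfolding \<Theta>_def Bx_def restrict_PiE_iff using p0 by simp
  hence "\<Theta> ` Bx \<subseteq> Bx" by blast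
  ultimately have surj: "\<Theta> ` Bx = Bx" by (intro endo_inj_surj)
  have p1: "int p > 1" using prime_gt_1_nat[OF p] by simp
  have "\<exists>u. \<forall>j<n. int p dvd int_trace (el u * bs ! j) - (if i = j then 1 else 0)" if i: "i < n" for i
  proof -
    have "restrict (\<lambda>j. if i = j then 1 else 0) {..<n} \<in> Bx"
      unfolding Bx_def restrict_PiE_iff using p1 by simp
    then obtain u where u: "\<Theta> u = restrict (\<lambda>j. if i = j then 1 else 0) {..<n}" using surj by (metis imageE)
    show ?thesis
    proof (intro exI[of _ u] allI impI)
      fix j assume j: "j < n"
      have "int_trace (el u * bs ! j) mod int p = (if i = j then 1 else 0)"
        using fun_cong[OF u, of j] j by (simp add: \<Theta>_def)
      hence "int_trace (el u * bs ! j) mod int p = (if i = j then 1 else 0) mod int p" using p1 by auto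
      thus "int p dvd int_trace (el u * bs ! j) - (if i = j then 1 else 0)" by (simp add: mod_eq_dvd_iff)
    qed
  qed
  then obtain E where E: "\<And>i j. i < n \<Longrightarrow> j < n \<Longrightarrow> int p dvd int_trace (el (E i) * bs ! j) - (if i = j then 1 else 0)"
    by metis
  define M where "M = mat n n (\<lambda>(i, j). E i j)"
  define T where "T = int_trace_mat"
  have carr: "M \<in> carrier_mat n n" "T \<in> carrier_mat n n" by (simp_all add: M_def T_def int_trace_mat_def n_def)
  have entry: "(M * T) $$ (i, j) = int_trace (el (E i) * bs ! j)" if "i < n" "j < n" for i j
  proof -
    have "el (E i) * bs ! j = (\<Sum>k<n. of_int (E i k) * (bs ! k * bs ! j))"
      by (simp add: el_def sum_distrib_right mult.assoc)
    hence "int_trace (el (E i) * bs ! j) = (\<Sum>k<n. E i k * int_trace (bs ! k * bs ! j))"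
      using that by (simp only:) (intro int_trace_sum OL_closed nth_OL, auto simp: n_def)
    thus ?thesis using that
      by (simp add: M_def T_def int_trace_mat_def n_def[symmetric] scalar_prod_def lessThan_atLeast0)
  qed
  \<comment> \<open>By the Leibniz formula, entrywise congruent matrices have congruent
    determinants.\<close>
  have "[det (M * T) = det (1\<^sub>m n)] (mod int p)"
  proof -
    have "[signof \<pi> * (\<Prod>i = 0..<n. (M * T) $$ (i, \<pi> i)) = signof \<pi> * (\<Prod>i = 0..<n. (1\<^sub>m n :: int mat) $$ (i, \<pi> i))] (mod int p)"
      if \<pi>: "\<pi> permutes {0..<n}" for \<pi>
    proof (intro cong_mult cong_refl cong_prod)
      fix i assume i: "i \<in> {0..<n}"
      hence "i < n" "\<pi> i < n" using permutes_in_image[OF \<pi>, of i] by auto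
      thus "[(M * T) $$ (i, \<pi> i) = (1\<^sub>m n :: int mat) $$ (i, \<pi> i)] (mod int p)"
        using E[of i "\<pi> i"] entry[of i "\<pi> i"] by (auto simp: cong_iff_dvd_diff)
    qed
    thus ?thesis
      using carr by (subst (1 2) det_def') (auto intro!: cong_sum)
  qed
  hence "[det M * det T = 1] (mod int p)" using carr by (simp add: det_mult)
  moreover have "int p dvd det M * det T" using assms discriminant_eq_det by (simp add: T_def)
  ultimately have "int p dvd 1" by (metis cong_dvd_iff)
  thus False using p1 by simp
qed

text \<open>
  If \<open>v \<noteq> 0\<close> lies in the radical of the trace form of the reduced ring \<open>O / p\<close> and \<open>v O / p\<close> has
  least cardinality, then \<open>v O / p\<close> is a finite field with some unit element \<open>e\<close>. Its elements \<open>u\<close>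
  satisfy \<open>(\<Sum>u\<noteq>0. Tr u / u) = - e\<close>: expand the trace in coordinates and substitute \<open>u b\<close> for \<open>u\<close>.
\<close>

lemma not_reduced_if_prime_dvd_discriminant:
  assumes "int p dvd discriminant L"
  shows "\<exists>v\<in>OL. \<not> pcong v 0 \<and> pcong (v\<^sup>2) 0"
proof (rule ccontr)
  assume "\<not> ?thesis"
  hence red: "pcong v 0" if "v \<in> OL" "pcong (v\<^sup>2) 0" for v using that by blast
  define P where "P v \<longleftrightarrow> v \<in> OL \<and> \<not> pcong v 0 \<and> (\<forall>y\<in>OL. int p dvd int_trace (v * y))" for v
  define I where "I v = residue ` ((*) v ` OL)" for v
  obtain v0 where "v0 \<in> OL" "\<not> pcong v0 0" "\<And>y. y \<in> OL \<Longrightarrow> int p dvd int_trace (v0 * y)"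
    by (rule ex_trace_radical[OF assms]) blast
  hence "P v0" by (simp add: P_def)
  then obtain v where v: "P v" and min: "\<And>w. P w \<Longrightarrow> card (I v) \<le> card (I w)"
    using ex_has_least_nat[of P v0 "\<lambda>v. card (I v)"] by blast
  have vO: "v \<in> OL" and v0: "\<not> pcong v 0" and vtr: "\<And>y. y \<in> OL \<Longrightarrow> int p dvd int_trace (v * y)"
    using v by (auto simp: P_def)
  \<comment> \<open>The radical is an ideal, so \<open>v * y\<close> competes with \<open>v\<close>
    in the minimality unless it vanishes modulo \<open>p\<close>. Both then generate the same ideal,
    and \<open>v\<close> is a multiple of \<open>v * y\<close>.\<close>
  have generate: "\<exists>z\<in>OL. pcong (v * y * z) v" if y: "y \<in> OL" and nz: "\<not> pcong (v * y) 0" for y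
  proof -
    have "P (v * y)" using y nz vO vtr by (auto simp: P_def OL_closed mult.assoc)
    hence "card (I v) \<le> card (I (v * y))" by (rule min)
    moreover have "I (v * y) \<subseteq> I v" using y by (auto simp: I_def mult.assoc intro!: imageI OL_closed)
    ultimately have "I (v * y) = I v"
      by (intro card_seteq) (auto simp: I_def finite_residues)
    moreover have "residue (v * 1) \<in> I v" unfolding I_def by (intro imageI OL_closed)
    ultimately have "residue (v * 1) \<in> I (v * y)" by simp
    then obtain z where "z \<in> OL" "residue (v * 1) = residue (v * y * z)" by (auto simp: I_def)
    thus ?thesis using y vO by (auto simp: residue_eq_iff OL_closed intro!: pcong_sym)
  qed
  have "\<not> pcong (v * v) 0" using red[OF vO] v0 by (auto simp: power2_eq_square)
  then obtain x0 where x0: "x0 \<in> OL" "pcong (v * v * x0) v" using generate[OF vO] by blast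
  \<comment> \<open>Reducedness makes \<open>v * v\<close> nonzero modulo \<open>p\<close>, so
    \<open>v * v * x0\<close> is congruent to \<open>v\<close> for some \<open>x0\<close>; hence
    \<open>v * x0\<close> acts as the identity on the ideal generated by \<open>v\<close>.\<close>
  define e where "e = v * x0"
  have eO: "e \<in> OL" using vO x0 by (simp add: e_def OL_closed)
  have ev: "pcong (e * v) v" using x0 by (simp add: e_def mult_ac)
  have e0: "\<not> pcong e 0"
  proof
    assume "pcong e 0"
    from pcong_mult_right[OF this vO] have "pcong (e * v) 0" by simp
    with ev v0 pcong_sym pcong_trans show False by blast
  qed
  have eI: "pcong (e * (v * y)) (v * y)" if "y \<in> OL" for y
    using pcong_mult_right[OF ev that] by (simp add: mult.assoc)
  define U where "U = I v - {residue 0}"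
  have finI: "finite (I v)" by (simp add: I_def finite_residues)
  have IO: "w \<in> OL" if "w \<in> I v" for w using that by (auto simp: I_def residue_OL)
  have eI': "pcong (e * w) w" if wI: "w \<in> I v" for w
  proof -
    obtain y where y: "y \<in> OL" "w = residue (v * y)" using wI by (auto simp: I_def)
    have w: "pcong w (v * y)" using y vO by (simp add: pcong_residue OL_closed)
    have "pcong (e * w) (e * (v * y))" by (rule pcong_mult_left[OF w eO])
    also have "pcong \<dots> (v * y)" by (rule eI[OF y(1)])
    also have "pcong \<dots> w" by (rule pcong_sym[OF w])
    finally show ?thesis .
  qed
  have residue_idem: "residue w = w" if "w \<in> I v" for w
    using that vO by (auto simp: I_def residue_eq_iff residue_OL pcong_residue OL_closed)
  have memI: "residue (x * w) \<in> I v" if x: "x \<in> OL" and w: "w \<in> I v" for x w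
  proof -
    obtain y where y: "y \<in> OL" "w = residue (v * y)" using w by (auto simp: I_def)
    have "pcong (x * w) (x * (v * y))"
      using x y vO by (intro pcong_mult_left) (simp_all add: pcong_residue OL_closed)
    hence "residue (x * w) = residue (v * (x * y))"
      using x y vO IO[OF w] by (subst residue_eq_iff) (auto simp: OL_closed mult_ac)
    thus ?thesis using x y by (auto simp: I_def intro!: imageI OL_closed)
  qed
  have inverse: "\<exists>w'\<in>OL. pcong (w * w') e \<and> pcong (e * w') w'" if w: "w \<in> OL" "\<not> pcong w 0" "pcong (e * w) w" for w
  proof -
    have "\<not> pcong (v * (x0 * w)) 0"
    proof
      assume "pcong (v * (x0 * w)) 0"
      hence "pcong (e * w) 0" by (simp add: e_def mult.assoc)
      thus False using w pcong_sym pcong_trans by blast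
    qed
    then obtain z where z: "z \<in> OL" "pcong (v * (x0 * w) * z) v"
      using generate[of "x0 * w"] w x0 by (auto simp: OL_closed)
    define w' where "w' = e * (z * x0)"
    have w'O: "w' \<in> OL" using z x0 eO by (simp add: w'_def OL_closed)
    have "pcong (v * (x0 * w) * z * x0) (v * x0)" by (rule pcong_mult_right[OF z(2) x0(1)])
    hence "pcong (w * w') e" by (simp add: w'_def e_def mult_ac)
    moreover have "pcong (e * w') w'"
      using pcong_mult_right[OF ev, of "x0 * (z * x0)"] z x0 by (simp add: w'_def e_def OL_closed mult_ac)
    ultimately show ?thesis using w'O by blast
  qed
  have UO: "u \<in> OL" and U0: "\<not> pcong u 0" and Ue: "pcong (e * u) u" if "u \<in> U" for u
  proof -
    have uI: "u \<in> I v" "u \<noteq> residue 0" using that by (auto simp: U_def)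
    show "u \<in> OL" by (rule IO[OF uI(1)])
    show "pcong (e * u) u" by (rule eI'[OF uI(1)])
    show "\<not> pcong u 0"
      using uI residue_idem[OF uI(1)] residue_eq_iff[OF IO[OF uI(1)] OL_closed(1)] by simp
  qed
  obtain inv' where inv': "\<And>u. u \<in> U \<Longrightarrow> inv' u \<in> OL \<and> pcong (u * inv' u) e \<and> pcong (e * inv' u) (inv' u)"
    using inverse UO U0 Ue by metis
  define n where "n = length bs"
  have trU: "int p dvd int_trace u" if uU: "u \<in> U" for u
  proof -
    obtain y where y: "y \<in> OL" "u = residue (v * y)" using uU by (auto simp: U_def I_def)
    have "int p dvd int_trace u - int_trace (v * y)"
      using y vO by (intro int_trace_pcong) (simp_all add: residue_OL pcong_residue OL_closed)
    from dvd_add[OF this vtr[OF y(1)]] show ?thesis by simp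
  qed
  have "pcong (\<Sum>u\<in>U. of_int (int_trace u) * inv' u) (\<Sum>u\<in>U. 0)"
  proof (intro pcong_sum)
    fix u assume u: "u \<in> U"
    have "pcong (of_int (int_trace u) * inv' u) (of_int 0 * inv' u)"
      using trU[OF u] inv'[OF u] by (intro pcong_mult_right pcong_of_int) auto
    thus "pcong (of_int (int_trace u) * inv' u) 0" by simp
  qed
  hence zero: "pcong (\<Sum>u\<in>U. of_int (int_trace u) * inv' u) 0" by simp
  have subst: "pcong (\<Sum>u\<in>U. of_int (coord (u * bs ! i) i) * inv' u)
      (\<Sum>w\<in>U. of_int (coord w i) * (e * bs ! i * inv' w))" if i: "i < n" for i
  proof (cases "pcong (e * bs ! i) 0")
    \<comment> \<open>Multiplication by this basis vector kills the whole field, so both sides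
      vanish.\<close>
    case True
    have b: "bs ! i \<in> OL" using i by (simp add: n_def nth_OL)
    have "pcong (\<Sum>u\<in>U. of_int (coord (u * bs ! i) i) * inv' u) (\<Sum>u\<in>U. 0)"
    proof (intro pcong_sum)
      fix u assume u: "u \<in> U"
      have "pcong (u * bs ! i) (e * u * bs ! i)"
        by (rule pcong_mult_right[OF pcong_sym[OF Ue[OF u]] b])
      also have "pcong (e * u * bs ! i) 0"
        using pcong_mult_left[OF True UO[OF u]] by (simp add: mult_ac)
      finally have "int p dvd coord (u * bs ! i) i - coord 0 i"
        using i UO[OF u] b by (intro pcong_imp_coord) (auto simp: n_def OL_closed)
      moreover have "coord 0 i = 0" using coord_of_int_mult[of 0 i 0] i by (simp add: n_def OL_closed)
      ultimately have "pcong (of_int (coord (u * bs ! i) i) * inv' u) (of_int 0 * inv' u)"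
        using inv'[OF u] by (intro pcong_mult_right pcong_of_int) auto
      thus "pcong (of_int (coord (u * bs ! i) i) * inv' u) 0" by simp
    qed
    moreover have "pcong (\<Sum>w\<in>U. of_int (coord w i) * (e * bs ! i * inv' w)) (\<Sum>w\<in>U. 0)"
    proof (intro pcong_sum)
      fix w assume w: "w \<in> U"
      have "pcong (e * bs ! i * (of_int (coord w i) * inv' w)) (0 * (of_int (coord w i) * inv' w))"
        by (rule pcong_mult_right[OF True]) (use inv'[OF w] in \<open>simp add: OL_closed\<close>)
      thus "pcong (of_int (coord w i) * (e * bs ! i * inv' w)) 0" by (simp add: mult_ac)
    qed
    ultimately show ?thesis using pcong_sym pcong_trans by blast
  next
    case False
    have b: "bs ! i \<in> OL" using i by (simp add: n_def nth_OL)
    have eb: "e * bs ! i \<in> OL" using b eO by (simp add: OL_closed)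
    have "pcong (e * (e * bs ! i)) (e * bs ! i)"
      using eI[of "x0 * bs ! i"] x0 b by (simp add: e_def OL_closed mult.assoc)
    then obtain b' where b': "b' \<in> OL" "pcong (e * bs ! i * b') e" using inverse[OF eb False] by blast
    \<comment> \<open>Now \<open>e * bs ! i\<close> is a nonzero element of the field, so
      multiplication by \<open>bs ! i\<close> permutes the nonzero elements, and
      \<open>inv' u\<close> becomes \<open>e * bs ! i * inv' (\<tau> u)\<close>.\<close>
    define \<tau> where "\<tau> u = residue (u * bs ! i)" for u
    have \<tau>: "pcong (\<tau> u) (u * bs ! i)" if "u \<in> U" for u
      using UO[OF that] b by (simp add: \<tau>_def pcong_residue OL_closed)
    have cancel: "pcong (u * bs ! i * (e * b')) u" if "u \<in> U" for u
    proof -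
      have "pcong (u * (e * bs ! i * b')) (u * e)" by (rule pcong_mult_left[OF b'(2) UO[OF that]])
      also have "pcong (u * e) u" using Ue[OF that] by (simp add: mult.commute)
      finally show ?thesis by (simp add: mult_ac)
    qed
    have "\<tau> u \<in> U" if u: "u \<in> U" for u
    proof -
      have "\<tau> u \<in> I v" using memI[OF b, of u] u by (auto simp: \<tau>_def U_def mult.commute)
      moreover have "\<tau> u \<noteq> residue 0"
      proof
        assume "\<tau> u = residue 0"
        hence "pcong (u * bs ! i) 0" using UO[OF u] b by (simp add: \<tau>_def residue_eq_iff OL_closed)
        from pcong_mult_right[OF this, of "e * b'"] have "pcong (u * bs ! i * (e * b')) 0"
          using eO b' by (simp add: OL_closed)
        thus False using cancel[OF u] U0[OF u] pcong_sym pcong_trans by blast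
      qed
      ultimately show ?thesis by (simp add: U_def)
    qed
    moreover have "inj_on \<tau> U"
    proof (rule inj_onI)
      fix u u' assume u: "u \<in> U" "u' \<in> U" and eq: "\<tau> u = \<tau> u'"
      have "pcong (u * bs ! i) (u' * bs ! i)"
        using eq u UO b by (simp add: \<tau>_def residue_eq_iff OL_closed)
      from pcong_mult_right[OF this, of "e * b'"]
      have "pcong (u * bs ! i * (e * b')) (u' * bs ! i * (e * b'))" using eO b' by (simp add: OL_closed)
      hence "pcong u u'" using cancel[OF u(1)] cancel[OF u(2)] pcong_sym pcong_trans by blast
      hence "residue u = residue u'" using u UO by (simp add: residue_eq_iff)
      thus "u = u'" using residue_idem u by (simp add: U_def)
    qed
    ultimately have bij: "bij_betw \<tau> U U"
      using finI by (metis U_def bij_betw_def endo_inj_surj finite_Diff image_subsetI)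
    have "pcong (\<Sum>u\<in>U. of_int (coord (u * bs ! i) i) * inv' u)
        (\<Sum>u\<in>U. of_int (coord (\<tau> u) i) * (e * bs ! i * inv' (\<tau> u)))"
    proof (intro pcong_sum)
      fix u assume u: "u \<in> U"
      have \<tau>U: "\<tau> u \<in> U" using bij u by (auto simp: bij_betw_def)
      have O: "u \<in> OL" "\<tau> u \<in> OL" "inv' u \<in> OL" "inv' (\<tau> u) \<in> OL"
        using u \<tau>U UO inv' by auto
      have "pcong (u * bs ! i * inv' (\<tau> u)) (\<tau> u * inv' (\<tau> u))"
        by (rule pcong_mult_right[OF pcong_sym[OF \<tau>[OF u]] O(4)])
      also have "pcong \<dots> e" using inv'[OF \<tau>U] by blast
      finally have "pcong (inv' u * (u * bs ! i * inv' (\<tau> u))) (inv' u * e)" using O by (intro pcong_mult_left)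
      also have "pcong (inv' u * e) (inv' u)" using inv'[OF u] by (simp add: mult.commute)
      finally have 1: "pcong (u * inv' u * (bs ! i * inv' (\<tau> u))) (inv' u)" by (simp add: mult_ac)
      have "pcong (u * inv' u * (bs ! i * inv' (\<tau> u))) (e * (bs ! i * inv' (\<tau> u)))"
        using inv'[OF u] b O by (intro pcong_mult_right) (auto simp: OL_closed)
      hence 2: "pcong (inv' u) (e * bs ! i * inv' (\<tau> u))"
        using 1 pcong_sym pcong_trans by (metis mult.assoc)
      have "pcong (of_int (coord (u * bs ! i) i) * inv' u) (of_int (coord (u * bs ! i) i) * (e * bs ! i * inv' (\<tau> u)))"
        by (rule pcong_mult_left[OF 2]) (rule OL_closed)
      also have "pcong \<dots> (of_int (coord (\<tau> u) i) * (e * bs ! i * inv' (\<tau> u)))"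
        using i O b eO pcong_sym[OF \<tau>[OF u]]
        by (intro pcong_mult_right pcong_of_int pcong_imp_coord) (auto simp: OL_closed n_def)
      finally show "pcong (of_int (coord (u * bs ! i) i) * inv' u)
          (of_int (coord (\<tau> u) i) * (e * bs ! i * inv' (\<tau> u)))" .
    qed
    also have "(\<Sum>u\<in>U. of_int (coord (\<tau> u) i) * (e * bs ! i * inv' (\<tau> u))) =
        (\<Sum>w\<in>U. of_int (coord w i) * (e * bs ! i * inv' w))"
      by (rule sum.reindex_bij_betw[OF bij])
    finally show ?thesis .
  qed
  have "(\<Sum>u\<in>U. of_int (int_trace u) * inv' u) = (\<Sum>u\<in>U. \<Sum>i<n. of_int (coord (u * bs ! i) i) * inv' u)"
    using UO by (intro sum.cong) (auto simp: int_trace_eq_sum_coord n_def sum_distrib_right)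
  also have "\<dots> = (\<Sum>i<n. \<Sum>u\<in>U. of_int (coord (u * bs ! i) i) * inv' u)" by (rule sum.swap)
  finally have "pcong (\<Sum>u\<in>U. of_int (int_trace u) * inv' u)
      (\<Sum>i<n. \<Sum>w\<in>U. of_int (coord w i) * (e * bs ! i * inv' w))"
    using subst by (auto intro: pcong_sum)
  also have "(\<Sum>i<n. \<Sum>w\<in>U. of_int (coord w i) * (e * bs ! i * inv' w)) =
      (\<Sum>w\<in>U. \<Sum>i<n. of_int (coord w i) * (e * bs ! i * inv' w))" by (rule sum.swap)
  \<comment> \<open>The substitution has moved the basis vectors out of the coordinates, so the
    inner sum reassembles \<open>w\<close>.\<close>
  also have "\<dots> = (\<Sum>w\<in>U. e * inv' w * w)"
  proof (rule sum.cong)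
    fix w assume w: "w \<in> U"
    have "e * inv' w * w = e * inv' w * (\<Sum>i<n. of_int (coord w i) * bs ! i)"
      using sum_coord[OF UO[OF w]] by (simp add: n_def)
    thus "(\<Sum>i<n. of_int (coord w i) * (e * bs ! i * inv' w)) = e * inv' w * w"
      by (simp add: sum_distrib_left mult_ac)
  qed simp
  also have "pcong \<dots> (\<Sum>w\<in>U. e)"
  proof (intro pcong_sum)
    fix w assume w: "w \<in> U"
    have "pcong (w * (e * inv' w)) (w * inv' w)"
      using inv'[OF w] UO[OF w] by (intro pcong_mult_left) auto
    also have "pcong (w * inv' w) e" using inv'[OF w] by blast
    finally show "pcong (e * inv' w * w) e" by (simp add: mult_ac)
  qed
  \<comment> \<open>Each summand is \<open>w / w = e\<close>, while the sum of traces vanishes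
    because \<open>v\<close> lies in the radical.\<close>
  finally have U_e: "pcong (of_nat (card U) * e) 0"
    using zero pcong_sym pcong_trans by (metis sum_constant)
  \<comment> \<open>Translation by \<open>e\<close> permutes the ideal; comparing the sums of its
    elements shows that its cardinality kills \<open>e\<close>. Since \<open>U\<close> omits just
    the zero class, the two multiples of \<open>e\<close> known to vanish differ by \<open>e\<close>
    itself.\<close>
  define \<sigma> where "\<sigma> x = residue (x + e)" for x
  have \<sigma>I: "\<sigma> x \<in> I v" if xI: "x \<in> I v" for x
  proof -
    obtain y where y: "y \<in> OL" "x = residue (v * y)" using xI by (auto simp: I_def)
    have "pcong (x + e) (v * y + e)"
      using y vO by (intro pcong_add pcong_refl) (simp add: pcong_residue OL_closed)
    hence "\<sigma> x = residue (v * (y + x0))"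
      using y vO x0 eO IO[OF xI] unfolding \<sigma>_def
      by (subst residue_eq_iff) (auto simp: OL_closed e_def distrib_left)
    thus ?thesis using y x0 by (auto simp: I_def intro!: imageI OL_closed)
  qed
  moreover have "inj_on \<sigma> (I v)"
  proof (rule inj_onI)
    fix x y assume xy: "x \<in> I v" "y \<in> I v" "\<sigma> x = \<sigma> y"
    hence "pcong (x + e) (y + e)" using IO eO by (simp add: \<sigma>_def residue_eq_iff OL_closed)
    from pcong_diff[OF this pcong_refl, of e] have "pcong x y" by simp
    thus "x = y" using residue_idem IO xy by (metis residue_eq_iff)
  qed
  ultimately have bij: "bij_betw \<sigma> (I v) (I v)"
    using finI by (metis bij_betw_def endo_inj_surj image_subsetI)
  have "pcong (\<Sum>x\<in>I v. \<sigma> x) (\<Sum>x\<in>I v. x + e)"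
    using IO eO by (intro pcong_sum) (simp add: \<sigma>_def pcong_residue OL_closed)
  also have "(\<Sum>x\<in>I v. \<sigma> x) = (\<Sum>x\<in>I v. x)"
    by (rule sum.reindex_bij_betw[OF bij])
  finally have "pcong (\<Sum>x\<in>I v. x) (\<Sum>x\<in>I v. x + e)" .
  from pcong_diff[OF pcong_sym[OF this] pcong_refl, of "\<Sum>x\<in>I v. x"]
  have I_e: "pcong (of_nat (card (I v)) * e) 0" by (simp add: sum.distrib)
  have "residue (v * 0) \<in> I v" unfolding I_def by (intro imageI OL_closed)
  hence "card (I v) = Suc (card U)" using card.remove[OF finI, of "residue 0"] by (simp add: U_def)
  hence "of_nat (card (I v)) * e - of_nat (card U) * e = e" by (simp add: algebra_simps)
  with pcong_diff[OF I_e U_e] e0 show False by simp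
qed

end

theorem prime_dvd_discriminant_iff:
  fixes L :: "'a :: field_char_0 set"
  assumes L: "number_field L" and p: "prime p"
  shows "int p dvd discriminant L \<longleftrightarrow>
    (\<exists>v\<in>ring_of_integers L. v \<notin> (*) (of_nat p) ` ring_of_integers L \<and> v\<^sup>2 \<in> (*) (of_nat p) ` ring_of_integers L)"
proof -
  obtain bs where bs: "integral_basis L bs" by (rule ex_integral_basis[OF L])
  show ?thesis
    using prime_dvd_discriminant_if_not_reduced[OF L bs p] not_reduced_if_prime_dvd_discriminant[OF L bs p]
    unfolding pcong_0_iff[OF L bs p] by blast
qed

section \<open>Roots of unity\<close>

lemma poly_eq_0_if_many_roots:
  fixes f :: "'a :: idom poly"
  assumes "\<And>a. a \<in> A \<Longrightarrow> poly f a = 0" "degree f < card A"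
  shows "f = 0"
proof (rule ccontr)
  assume "f \<noteq> 0"
  have "card A \<le> card {x. poly f x = 0}"
    using assms(1) poly_roots_finite[OF \<open>f \<noteq> 0\<close>] by (intro card_mono) auto
  also have "\<dots> \<le> degree f" by (rule poly_roots_degree[OF \<open>f \<noteq> 0\<close>])
  finally show False using assms(2) by simp
qed

lemma
  fixes A :: "'a :: idom set"
  assumes "finite A"
  shows degree_prod_linear: "degree (\<Prod>z\<in>A. [:- z, 1:]) = card A"
    and monic_prod_linear: "lead_coeff (\<Prod>z\<in>A. [:- z, 1:]) = 1"
proof -
  have "degree (\<Prod>z\<in>A. [:- z, 1:]) = (\<Sum>z\<in>A. degree [:- z, 1:])"
    by (rule degree_prod_eq_sum_degree) auto
  thus "degree (\<Prod>z\<in>A. [:- z, 1:]) = card A" by simp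
  show "lead_coeff (\<Prod>z\<in>A. [:- z, 1:]) = 1" by (simp add: lead_coeff_prod)
qed

lemma geometric_sum_root_of_unity:
  fixes w :: "'a :: field"
  assumes "w ^ m = 1" "w \<noteq> 1"
  shows "(\<Sum>i<m. w ^ i) = 0"
  using geometric_sum[OF assms(2), of m] assms(1) by simp

lemma primitive_root_power_eq_1_iff:
  assumes "primitive_root_of_unity n z"
  shows "z ^ k = 1 \<longleftrightarrow> n dvd k"
proof
  have n: "n > 0" "z ^ n = 1" and min: "\<And>i. 0 < i \<Longrightarrow> i < n \<Longrightarrow> z ^ i \<noteq> 1"
    using assms by (auto simp: primitive_root_of_unity_def)
  show "z ^ k = 1" if "n dvd k" using that n by (auto simp: power_mult elim!: dvdE)
  assume k: "z ^ k = 1"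
  have "z ^ k = z ^ (n * (k div n) + k mod n)" by simp
  also have "\<dots> = z ^ (k mod n)" using n by (simp only: power_add power_mult) simp
  finally have "z ^ (k mod n) = 1" using k by simp
  hence "k mod n = 0" using min[of "k mod n"] n by (cases "k mod n = 0") auto
  thus "n dvd k" by (simp add: mod_eq_0_iff_dvd)
qed

lemma primitive_root_nonzero: "primitive_root_of_unity n z \<Longrightarrow> z \<noteq> 0"
  by (auto simp: primitive_root_of_unity_def power_0_left)

lemma primitive_root_power_eq_iff:
  assumes "primitive_root_of_unity n z"
  shows "z ^ i = z ^ j \<longleftrightarrow> [i = j] (mod n)"
proof -
  have *: "z ^ i = z ^ j \<longleftrightarrow> [i = j] (mod n)" if "i \<le> j" for i j
  proof -
    have "z ^ j = z ^ i * z ^ (j - i)" using that by (simp flip: power_add)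
    hence "z ^ i = z ^ j \<longleftrightarrow> z ^ (j - i) = 1" using primitive_root_nonzero[OF assms] by simp
    also have "\<dots> \<longleftrightarrow> n dvd j - i" by (rule primitive_root_power_eq_1_iff[OF assms])
    also have "\<dots> \<longleftrightarrow> [i = j] (mod n)" using that by (metis cong_altdef_nat cong_sym_eq)
    finally show ?thesis .
  qed
  show ?thesis using *[of i j] *[of j i] by (cases "i \<le> j") (auto simp: cong_sym_eq)
qed

lemma primitive_root_power:
  assumes "primitive_root_of_unity n z" "m > 0" "\<And>i. n dvd k * i \<longleftrightarrow> m dvd i"
  shows "primitive_root_of_unity m (z ^ k)"
  using assms unfolding primitive_root_of_unity_def[of m]
  by (auto simp: primitive_root_power_eq_1_iff[OF assms(1)] dest: dvd_imp_le simp flip: power_mult)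

lemma roots_of_unity_eq:
  assumes "primitive_root_of_unity n (z :: 'a :: field)"
  shows "{w. w ^ n = 1} = (\<lambda>i. z ^ i) ` {..<n}" and "card {w :: 'a. w ^ n = 1} = n"
proof -
  have n: "n > 0" using assms by (auto simp: primitive_root_of_unity_def)
  have inj: "inj_on (\<lambda>i. z ^ i) {..<n}"
    using primitive_root_power_eq_iff[OF assms] by (auto intro!: inj_onI simp: cong_def)
  have sub: "(\<lambda>i. z ^ i) ` {..<n} \<subseteq> {w. w ^ n = 1}"
    by (auto simp: primitive_root_power_eq_1_iff[OF assms] simp flip: power_mult)
  define f :: "'a poly" where "f = monom 1 n - 1"
  have f: "poly f w = w ^ n - 1" for w by (simp add: f_def poly_monom)
  have "coeff f n = 1" using n by (simp add: f_def coeff_1)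
  hence f0: "f \<noteq> 0" by auto
  have deg: "degree f \<le> n" unfolding f_def by (intro degree_diff_le degree_monom_le) simp
  have "card {w. poly f w = 0} \<le> n" using poly_roots_degree[OF f0] deg by linarith
  hence card: "card {w :: 'a. w ^ n = 1} \<le> n" by (simp add: f)
  have fin: "finite {w :: 'a. w ^ n = 1}" using poly_roots_finite[OF f0] by (simp add: f)
  show eq: "{w. w ^ n = 1} = (\<lambda>i. z ^ i) ` {..<n}"
    using card_seteq[OF fin sub] card by (simp add: card_image[OF inj])
  show "card {w :: 'a. w ^ n = 1} = n" unfolding eq by (simp add: card_image[OF inj])
qed

lemma primitive_roots_eq:
  assumes z: "primitive_root_of_unity n (z :: 'a :: field)"
  shows "primitive_root_of_unity n w \<longleftrightarrow> (\<exists>c. coprime c n \<and> w = z ^ c)"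
proof
  have n: "n > 0" using z by (auto simp: primitive_root_of_unity_def)
  show "primitive_root_of_unity n w" if w: "\<exists>c. coprime c n \<and> w = z ^ c"
  proof -
    obtain c where c: "coprime c n" "w = z ^ c" using w by blast
    have "n dvd c * i \<longleftrightarrow> n dvd i" for i
      using c(1) by (simp add: coprime_commute coprime_dvd_mult_right_iff)
    with primitive_root_power[OF z n] c(2) show ?thesis by blast
  qed
  assume w: "primitive_root_of_unity n w"
  hence "w \<in> {w. w ^ n = 1}" by (simp add: primitive_root_of_unity_def)
  then obtain c where c: "w = z ^ c" "c < n" unfolding roots_of_unity_eq(1)[OF z] by blast
  have "coprime c n"
  proof (rule ccontr)
    assume nc: "\<not> coprime c n"
    define g where "g = gcd c n"
    have g: "g > 1" "g dvd c" "g dvd n" "g > 0"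
      using nc n by (auto simp: g_def coprime_iff_gcd_eq_1 nat_neq_iff)
    have "n dvd c * (n div g)" using g by (metis div_mult_swap dvd_def dvd_div_mult mult.commute)
    hence "w ^ (n div g) = 1"
      unfolding c(1) by (simp add: primitive_root_power_eq_1_iff[OF z] flip: power_mult)
    hence "n dvd n div g" by (simp add: primitive_root_power_eq_1_iff[OF w])
    moreover have "0 < n div g" "n div g < n" using g n by (auto simp: div_greater_zero_iff dvd_imp_le)
    ultimately show False by (auto dest: dvd_imp_le)
  qed
  with c show "\<exists>c. coprime c n \<and> w = z ^ c" by blast
qed

lemma finite_primitive_roots: "finite {z :: 'a :: field. primitive_root_of_unity n z}"
proof (cases "\<exists>z :: 'a. primitive_root_of_unity n z")
  case True
  then obtain z :: 'a where z: "primitive_root_of_unity n z" by blast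
  have "{z :: 'a. primitive_root_of_unity n z} \<subseteq> {w. w ^ n = 1}" by (auto simp: primitive_root_of_unity_def)
  thus ?thesis using roots_of_unity_eq(1)[OF z] finite_subset by fastforce
qed auto

lemma degree_cyclotomic_poly:
  "degree (cyclotomic_poly n :: 'a :: field_char_0 poly) = card {z :: 'a. primitive_root_of_unity n z}"
  unfolding cyclotomic_poly_def by (rule degree_prod_linear[OF finite_primitive_roots])

lemma monic_cyclotomic_poly: "lead_coeff (cyclotomic_poly n :: 'a :: field_char_0 poly) = 1"
  unfolding cyclotomic_poly_def by (rule monic_prod_linear[OF finite_primitive_roots])

lemma poly_cyclotomic_poly_eq_0_iff:
  "poly (cyclotomic_poly n) z = 0 \<longleftrightarrow> primitive_root_of_unity n (z :: 'a :: field_char_0)"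
  unfolding cyclotomic_poly_def poly_prod using finite_primitive_roots[of n, where ?'a = 'a]
  by (auto simp: prod_zero_iff)

text \<open>The root \<open>z\<close> guarantees that the primitive \<open>d\<close>-th roots for
  all divisors \<open>d\<close> lie in the field; by their orders they partition the
  \<open>n\<close> roots of \<open>X ^ n - 1\<close>.\<close>

lemma prod_cyclotomic_polys:
  assumes z: "primitive_root_of_unity n (z :: 'a :: field_char_0)"
  shows "(\<Prod>d | d dvd n. cyclotomic_poly d) = (monom 1 n - 1 :: 'a poly)"
proof -
  have n: "n > 0" using z by (auto simp: primitive_root_of_unity_def)
  have part: "{w :: 'a. w ^ n = 1} = (\<Union>d\<in>{d. d dvd n}. {w. primitive_root_of_unity d w})"
  proof (intro equalityI subsetI)
    fix w :: 'a assume "w \<in> {w. w ^ n = 1}"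
    hence w: "w ^ n = 1" by simp
    define d where "d = (LEAST d. d > 0 \<and> w ^ d = 1)"
    have d: "d > 0 \<and> w ^ d = 1" unfolding d_def using w n LeastI[of "\<lambda>d. d > 0 \<and> w ^ d = 1" n] by simp
    have "w ^ k \<noteq> 1" if "0 < k" "k < d" for k
      using not_less_Least[of k "\<lambda>d. d > 0 \<and> w ^ d = 1"] that by (auto simp: d_def)
    hence prim: "primitive_root_of_unity d w" using d by (auto simp: primitive_root_of_unity_def)
    moreover have "d dvd n" using primitive_root_power_eq_1_iff[OF prim] w by blast
    ultimately show "w \<in> (\<Union>d\<in>{d. d dvd n}. {w. primitive_root_of_unity d w})" by blast
  next
    fix w :: 'a assume "w \<in> (\<Union>d\<in>{d. d dvd n}. {w. primitive_root_of_unity d w})"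
    then obtain d where d: "d dvd n" "primitive_root_of_unity d w" by blast
    show "w \<in> {w. w ^ n = 1}" using primitive_root_power_eq_1_iff[OF d(2), of n] d(1) by simp
  qed
  have "d = e" if "primitive_root_of_unity d w" "primitive_root_of_unity e w" for d e and w :: 'a
    using primitive_root_power_eq_1_iff[OF that(1), of e] primitive_root_power_eq_1_iff[OF that(2), of d] that
    by (auto simp: primitive_root_of_unity_def intro: dvd_antisym)
  hence disj: "{w :: 'a. primitive_root_of_unity d w} \<inter> {w. primitive_root_of_unity e w} = {}" if "d \<noteq> e" for d e
    using that by blast
  have fin: "finite {w :: 'a. w ^ n = 1}" using roots_of_unity_eq(1)[OF z] by simp
  have "(\<Prod>d | d dvd n. cyclotomic_poly d) = (\<Prod>w | w ^ n = 1. [:- w, 1 :: 'a:])"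
    unfolding part cyclotomic_poly_def using n disj
    by (subst prod.UNION_disjoint) (auto simp: finite_primitive_roots)
  also have "\<dots> = monom 1 n - 1"
  proof -
    define f :: "'a poly" where "f = monom 1 n - 1"
    define g where "g = (\<Prod>w | w ^ n = 1. [:- w, 1 :: 'a:])"
    have dg: "degree g = n" "coeff g n = 1"
      using degree_prod_linear[OF fin] monic_prod_linear[OF fin] roots_of_unity_eq(2)[OF z] by (auto simp: g_def)
    have cf: "coeff f n = 1" using n by (simp add: f_def coeff_1)
    have df: "degree f \<le> n" unfolding f_def by (intro degree_diff_le degree_monom_le) simp
    have "degree (g - f) \<le> n" using dg df by (intro degree_diff_le) auto
    moreover have "coeff (g - f) n = 0" using dg cf by simp
    ultimately have "degree (g - f) < n"
      using n by (metis degree_0 leading_coeff_0_iff order_le_less)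
    moreover have "poly (g - f) w = 0" if "w \<in> {w. w ^ n = 1}" for w
      using that fin by (auto simp: g_def f_def poly_monom poly_prod prod_zero_iff)
    ultimately have "g - f = 0"
      using roots_of_unity_eq(2)[OF z] by (intro poly_eq_0_if_many_roots[of "{w. w ^ n = 1}"]) auto
    thus ?thesis by (simp add: f_def g_def)
  qed
  finally show ?thesis .
qed

text \<open>The polynomial is built from its roots in the ambient field, so integrality is not
  visible. By induction the product over the proper divisors is monic with integer coefficients, and
  the division of \<open>X ^ n - 1\<close> by it has a unique quotient.\<close>

lemma cyclotomic_poly_Ints:
  assumes "primitive_root_of_unity n (z :: 'a :: field_char_0)"
  shows "cyclotomic_poly n \<in> polys_over (\<int> :: 'a set)"
  using assms
proof (induction n arbitrary: z rule: less_induct)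
  case (less n)
  note R = is_subring_polys_over[OF is_subring_Ints, where ?'a = 'a]
  have n: "n > 0" using less.prems by (auto simp: primitive_root_of_unity_def)
  define G :: "'a poly" where "G = (\<Prod>d\<in>{d. d dvd n} - {n}. cyclotomic_poly d)"
  have fin: "finite {d. d dvd n}" using n by simp
  have eq: "cyclotomic_poly n * G = monom 1 n - 1"
    using prod_cyclotomic_polys[OF less.prems] prod.remove[OF fin, of n "cyclotomic_poly :: nat \<Rightarrow> 'a poly"] by (simp add: G_def)
  have "cyclotomic_poly d \<in> polys_over (\<int> :: 'a set)" if d: "d \<in> {d. d dvd n} - {n}" for d
  proof -
    obtain e where e: "n = d * e" using d by auto
    have "d \<le> n" "d \<noteq> n" using d n by (simp_all add: dvd_imp_le)
    hence "d < n" by simp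
    moreover have "primitive_root_of_unity d (z ^ e)"
      by (rule primitive_root_power[OF less.prems]) (use n e in \<open>simp_all add: mult.commute[of d]\<close>)
    ultimately show ?thesis by (rule less.IH)
  qed
  hence G: "G \<in> polys_over \<int>" unfolding G_def by (rule subring_prod[OF R])
  have Gm: "lead_coeff G = 1" by (simp add: G_def lead_coeff_prod monic_cyclotomic_poly)
  have X: "monom 1 n - 1 \<in> polys_over (\<int> :: 'a set)"
    by (intro subring_diff[OF R] polys_over_monom[OF is_subring_Ints] subring_1[OF R]) auto
  show ?case
  proof (cases "degree G = 0")
    case True
    hence "G = 1" using Gm by (metis degree_0_id one_pCons)
    thus ?thesis using eq X by simp
  next
    case False
    obtain Q r where Qr: "Q \<in> polys_over \<int>" "monom 1 n - 1 = G * Q + r" "degree r < degree G"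
      using monic_division[OF is_subring_Ints G Gm _ X] False by auto
    have "G * (cyclotomic_poly n - Q) = r" using eq Qr(2) by (simp add: algebra_simps)
    moreover have "degree (G * (cyclotomic_poly n - Q)) \<ge> degree G" if "cyclotomic_poly n \<noteq> Q"
      using that Gm by (subst degree_mult_eq) auto
    ultimately have "cyclotomic_poly n = Q" using Qr(3) by (metis not_le)
    thus ?thesis using Qr(1) by simp
  qed
qed

text \<open>For \<open>m = 1\<close> this is \<open>{0}\<close>, which is why the class of 1 appears
  as \<open>1 mod m\<close> in the Fourier sums.\<close>

definition units_mod :: "nat \<Rightarrow> nat set" where
  "units_mod m = {j. j < m \<and> coprime j m}"

lemma finite_units_mod: "finite (units_mod m)"
  by (simp add: units_mod_def)

lemma bij_betw_units_mod:
  assumes "m > 0" "coprime c m"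
  shows "bij_betw (\<lambda>j. c * j mod m) (units_mod m) (units_mod m)"
proof -
  have "inj_on (\<lambda>j. c * j mod m) (units_mod m)"
  proof (rule inj_onI)
    fix i j assume ij: "i \<in> units_mod m" "j \<in> units_mod m" "c * i mod m = c * j mod m"
    hence "[i = j] (mod m)" using assms(2) cong_mult_lcancel_nat[of c m i j] by (simp add: cong_def)
    thus "i = j" using ij by (simp add: units_mod_def cong_def)
  qed
  moreover have "(\<lambda>j. c * j mod m) ` units_mod m \<subseteq> units_mod m"
    using assms by (auto simp: units_mod_def)
  ultimately show ?thesis
    using endo_inj_surj[OF finite_units_mod] by (auto simp: bij_betw_def)
qed

section \<open>Cyclotomic extensions\<close>

locale cyclotomic_extension =
  fixes L :: "'a :: field_char_0 set" and n :: nat and \<zeta> :: 'a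
  assumes L: "number_field L" and prim: "primitive_root_of_unity n \<zeta>"
    and irr: "irreducible_over L (cyclotomic_poly n)"
begin

abbreviation "\<O> \<equiv> ring_of_integers L"
abbreviation "\<Phi> \<equiv> cyclotomic_poly n :: 'a poly"
abbreviation "B \<equiv> adjoin_ring \<O> \<zeta>"

lemma n_pos: "n > 0" and zeta_power_n: "\<zeta> ^ n = 1"
  using prim by (auto simp: primitive_root_of_unity_def)

lemma L_subring: "is_subring L" and O_subring: "is_subring \<O>"
  using number_field_subring[OF L] ring_of_integers_subring[OF L] by auto

lemma O_subset_L: "\<O> \<subseteq> L" by (auto simp: ring_of_integers_def)

lemma algebraic_int_O: "x \<in> \<O> \<Longrightarrow> algebraic_int x" by (simp add: ring_of_integers_def)

lemma B_subring: "is_subring B" by (rule is_subring_adjoin_ring[OF O_subring])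

lemma Phi_over: "is_subring R \<Longrightarrow> \<Phi> \<in> polys_over R"
  using cyclotomic_poly_Ints[OF prim] polys_over_mono[OF Ints_subset_subring] by blast

lemma poly_Phi: "primitive_root_of_unity n z \<Longrightarrow> poly \<Phi> z = 0"
  by (simp add: poly_cyclotomic_poly_eq_0_iff)

lemma degree_Phi_pos: "degree \<Phi> > 0"
  using irr by (simp add: irreducible_over_def)

lemma scale_monic:
  assumes g: "g \<in> polys_over L" "g \<noteq> 0"
  obtains h where "h \<in> polys_over L" "lead_coeff h = 1" "degree h = degree g"
    "\<And>x. poly h x = inverse (lead_coeff g) * poly g x"
proof
  let ?h = "smult (inverse (lead_coeff g)) g"
  have "lead_coeff g \<in> L" using g by (simp add: polys_over_def)
  hence "inverse (lead_coeff g) \<in> L" by (rule number_field_inverse[OF L])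
  thus "?h \<in> polys_over L" using g subring_mult[OF L_subring] by (auto simp: polys_over_def)
qed (use g in auto)

text \<open>A monic polynomial of least degree over \<open>L\<close> that kills \<zeta> divides
  \<Phi>, so by irreducibility it has the same degree. Hence the powers of \<zeta> below that degree
  are independent over \<open>L\<close>, the fact behind every comparison of coefficients.\<close>

lemma small_poly_eq_0:
  assumes F: "F \<in> polys_over L" "poly F \<zeta> = 0" "degree F < degree \<Phi>"
  shows "F = 0"
proof (rule ccontr)
  assume "F \<noteq> 0"
  define P where "P g \<longleftrightarrow> g \<in> polys_over L \<and> g \<noteq> 0 \<and> poly g \<zeta> = 0" for g
  have "P F" using F \<open>F \<noteq> 0\<close> by (simp add: P_def)
  then obtain g where g: "P g" and min: "\<And>h. P h \<Longrightarrow> degree g \<le> degree h"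
    using ex_has_least_nat[of P F degree] by blast
  have gL: "g \<in> polys_over L" "g \<noteq> 0" "poly g \<zeta> = 0" using g by (auto simp: P_def)
  obtain h where h: "h \<in> polys_over L" "lead_coeff h = 1" "degree h = degree g"
      and hx: "\<And>x. poly h x = inverse (lead_coeff g) * poly g x"
    by (rule scale_monic[OF gL(1,2)]) blast
  have h0: "poly h \<zeta> = 0" using hx gL by simp
  have "degree h > 0"
  proof (rule ccontr)
    assume "\<not> degree h > 0"
    hence "h = 1" using h(2) by (metis degree_0_id gr0I one_pCons)
    thus False using h0 by simp
  qed
  then obtain q r where qr: "q \<in> polys_over L" "r \<in> polys_over L" "\<Phi> = h * q + r" "degree r < degree h"
    using monic_division[OF L_subring h(1,2) _ Phi_over[OF L_subring]] by blast
  have "poly r \<zeta> = 0" using arg_cong[OF qr(3), of "\<lambda>f. poly f \<zeta>"] h0 poly_Phi[OF prim] by simp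
  hence "r = 0" using min[of r] qr h(3) by (auto simp: P_def)
  hence eq: "\<Phi> = h * q" using qr(3) by simp
  hence "degree h = 0 \<or> degree q = 0" using irr h(1) qr(1) by (auto simp: irreducible_over_def)
  hence "degree q = 0" using \<open>degree h > 0\<close> by simp
  moreover have "\<Phi> \<noteq> 0" using degree_Phi_pos by auto
  ultimately have "degree \<Phi> = degree h" using eq by (auto simp: degree_mult_eq)
  with min[OF \<open>P F\<close>] F(3) h(3) show False by simp
qed

text \<open>\<Phi> is monic with integer coefficients, so reduction works over every subring; it is
  used over \<open>L\<close>, \<open>\<O>\<close> and \<open>\<int>\<close>.\<close>

lemma reduce_mod_Phi:
  assumes R: "is_subring R" and F: "F \<in> polys_over R"
  obtains G H where "G \<in> polys_over R" "H \<in> polys_over R" "degree G < degree \<Phi>" "F = \<Phi> * H + G"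
    "\<And>z. primitive_root_of_unity n z \<Longrightarrow> poly G z = poly F z"
proof -
  obtain H G where *: "H \<in> polys_over R" "G \<in> polys_over R" "F = \<Phi> * H + G" "degree G < degree \<Phi>"
    using monic_division[OF R Phi_over[OF R] monic_cyclotomic_poly degree_Phi_pos F] by blast
  moreover have "poly G z = poly F z" if "primitive_root_of_unity n z" for z
    using * that by (simp add: poly_Phi)
  ultimately show ?thesis using that by blast
qed

text \<open>Takes the place of Galois conjugation: sending \<open>poly F \<zeta>\<close> to
  \<open>poly F z\<close> is well defined, although no automorphism is constructed.\<close>

lemma conjugate_root:
  assumes F: "F \<in> polys_over L" "poly F \<zeta> = 0" and z: "primitive_root_of_unity n z"
  shows "poly F z = 0"
proof -
  obtain G H where G: "G \<in> polys_over L" "degree G < degree \<Phi>"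
    "\<And>z. primitive_root_of_unity n z \<Longrightarrow> poly G z = poly F z"
    by (rule reduce_mod_Phi[OF L_subring F(1)]) blast
  have "G = 0" using G(3)[OF prim] F(2) by (intro small_poly_eq_0 G) simp
  thus ?thesis using G(3)[OF z] by simp
qed

text \<open>If \<open>h\<close> is an integral equation of \<open>poly F \<zeta>\<close>, then the
  composition of \<open>h\<close> with \<open>F\<close> vanishes at \<zeta>, hence at
  \<open>z\<close>, so the same equation serves.\<close>

lemma conjugate_algebraic_int:
  assumes F: "F \<in> polys_over L" "algebraic_int (poly F \<zeta>)" and z: "primitive_root_of_unity n z"
  shows "algebraic_int (poly F z)"
proof -
  obtain h where h: "lead_coeff h = 1" "\<forall>i. coeff h i \<in> \<int>" "poly h (poly F \<zeta>) = 0"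
    using F(2) by (auto elim: algebraic_int.cases)
  have "h \<in> polys_over L" using h(2) Ints_subset_subring[OF L_subring] by (auto simp: polys_over_def)
  hence "pcompose h F \<in> polys_over L" using F(1) by (rule polys_over_pcompose[OF L_subring])
  moreover have "poly (pcompose h F) \<zeta> = 0" using h(3) by (simp add: poly_pcompose)
  ultimately have "poly (pcompose h F) z = 0" using z by (rule conjugate_root)
  hence "poly h (poly F z) = 0" by (simp add: poly_pcompose)
  with h(1,2) show ?thesis by (rule algebraic_int.intros)
qed

text \<open>After reduction modulo \<Phi>, subtracting the common value leaves a polynomial with
  more roots than its degree. The reduced polynomial is thus constant, with coefficient in
  \<open>L\<close>.\<close>

lemma invariant_in_base_field:
  assumes V: "V \<in> polys_over L" and inv: "\<And>z. primitive_root_of_unity n z \<Longrightarrow> poly V z = poly V \<zeta>"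
  shows "poly V \<zeta> \<in> L"
proof -
  obtain G H where G: "G \<in> polys_over L" "degree G < degree \<Phi>"
    "\<And>z. primitive_root_of_unity n z \<Longrightarrow> poly G z = poly V z"
    by (rule reduce_mod_Phi[OF L_subring V]) blast
  define c where "c = poly V \<zeta>"
  have "degree (G - [:c:]) \<le> degree G" by (intro degree_diff_le) auto
  hence "G - [:c:] = 0"
    using G inv degree_cyclotomic_poly[of n, where ?'a = 'a]
    by (intro poly_eq_0_if_many_roots[of "{z. primitive_root_of_unity n z}"]) (auto simp: c_def)
  hence "coeff G 0 = c" by simp
  moreover have "coeff G 0 \<in> L" using G(1) by (simp add: polys_over_def)
  ultimately show ?thesis by (simp add: c_def)
qed

lemma O_subset_B: "\<O> \<subseteq> B" and zeta_in_B: "\<zeta> \<in> B"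
  using adjoin_ring_base[OF O_subring] adjoin_ring_gen[OF O_subring] by auto

lemma algebraic_int_root_of_unity: "k > 0 \<Longrightarrow> (z :: 'a) ^ k = 1 \<Longrightarrow> algebraic_int z"
  by (rule algebraic_int_root[of 1 "monom 1 k"])
    (auto simp: poly_monom degree_monom_eq coeff_monom)

lemma algebraic_int_zeta: "algebraic_int \<zeta>"
  using algebraic_int_root_of_unity[OF n_pos zeta_power_n] .

lemma algebraic_int_poly:
  "\<lbrakk>\<And>i. algebraic_int (coeff F i); algebraic_int (x :: 'a)\<rbrakk> \<Longrightarrow> algebraic_int (poly F x)"
  using poly_in_subring[OF is_subring_algebraic_ints, of F x] by (simp add: polys_over_def)

lemma algebraic_int_B:
  assumes "x \<in> B"
  shows "algebraic_int x"
proof -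
  obtain F where F: "F \<in> polys_over \<O>" "x = poly F \<zeta>" using assms by (auto simp: adjoin_ring_def)
  have "algebraic_int (coeff F i)" for i using F(1) algebraic_int_O by (simp add: polys_over_def)
  thus ?thesis unfolding F(2) using algebraic_int_zeta by (rule algebraic_int_poly)
qed

text \<open>
  For a power \<open>\<omega> = \<zeta> ^ q\<close> of order \<open>m\<close> and \<open>f \<in> L[X]\<close>, the trace \<open>b i\<close> of \<open>f(\<omega>) \<omega> ^ (- i)\<close> over \<open>L\<close>;
  Fourier inversion recovers \<open>m f(\<omega>)\<close> from these traces.
\<close>

definition fourier_coeff :: "nat \<Rightarrow> 'a \<Rightarrow> 'a poly \<Rightarrow> nat \<Rightarrow> 'a" where
  "fourier_coeff m \<omega> f i = (\<Sum>j\<in>units_mod m. poly f (\<omega> ^ j) * \<omega> ^ (j * ((m - 1) * i)))"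

lemma fourier_inversion:
  assumes \<omega>: "primitive_root_of_unity m (\<omega> :: 'a)"
  shows "(\<Sum>i<m. fourier_coeff m \<omega> f i * \<omega> ^ i) = of_nat m * poly f \<omega>"
proof -
  have m: "m > 0" and \<omega>m: "\<omega> ^ m = 1" using \<omega> by (auto simp: primitive_root_of_unity_def)
  \<comment> \<open>\<open>w j\<close> stands for \<open>\<omega> ^ (1 - j)\<close>, with
    \<open>\<omega> ^ (m - 1)\<close> as the inverse of \<omega>. Its geometric sum is
    \<open>m\<close> for the class of 1 and 0 otherwise, which isolates
    \<open>poly f \<omega>\<close>.\<close>
  define w where "w j = \<omega> ^ (j * (m - 1) + 1)" for j
  have w: "(\<Sum>i<m. w j ^ i) = (if j = 1 mod m then of_nat m else 0)" if j: "j \<in> units_mod m" for j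
  proof -
    have "w j * \<omega> ^ j = \<omega> ^ (j * m + 1)" using m by (cases m) (simp_all add: w_def algebra_simps flip: power_add)
    also have "\<dots> = \<omega>" using \<omega>m by (simp add: power_mult mult.commute[of j])
    finally have *: "w j * \<omega> ^ j = \<omega>" .
    have "w j = 1 \<longleftrightarrow> \<omega> ^ j = \<omega> ^ 1"
      using * primitive_root_nonzero[OF \<omega>] by (metis mult_cancel_right1 mult_1 power_one_right power_not_zero)
    also have "\<dots> \<longleftrightarrow> j = 1 mod m"
      using j unfolding primitive_root_power_eq_iff[OF \<omega>] by (simp add: cong_def units_mod_def)
    finally have w1: "w j = 1 \<longleftrightarrow> j = 1 mod m" .
    have wm: "w j ^ m = 1"
      by (simp only: w_def power_mult[symmetric] primitive_root_power_eq_1_iff[OF \<omega>] dvd_triv_right)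
    show ?thesis
    proof (cases "w j = 1")
      case True
      thus ?thesis using w1 by simp
    next
      case False
      thus ?thesis using w1 geometric_sum_root_of_unity[OF wm False] by simp
    qed
  qed
  have j1: "1 mod m \<in> units_mod m" using m by (auto simp: units_mod_def)
  have "\<omega> ^ (1 mod m) = \<omega> ^ 1" unfolding primitive_root_power_eq_iff[OF \<omega>] by (simp add: cong_def)
  hence \<omega>1: "\<omega> ^ (1 mod m) = \<omega>" by simp
  have "(\<Sum>i<m. fourier_coeff m \<omega> f i * \<omega> ^ i) =
      (\<Sum>i<m. \<Sum>j\<in>units_mod m. poly f (\<omega> ^ j) * w j ^ i)"
    unfolding fourier_coeff_def sum_distrib_right w_def
    by (intro sum.cong refl) (simp add: power_add power_mult mult.assoc power_mult_distrib)
  also have "\<dots> = (\<Sum>j\<in>units_mod m. poly f (\<omega> ^ j) * (\<Sum>i<m. w j ^ i))"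
    by (subst sum.swap) (simp add: sum_distrib_left)
  also have "\<dots> = (\<Sum>j\<in>units_mod m. if j = 1 mod m then poly f \<omega> * of_nat m else 0)"
    using \<omega>1 by (intro sum.cong refl) (auto simp: w)
  also have "\<dots> = of_nat m * poly f \<omega>" using j1 by (simp add: finite_units_mod)
  finally show ?thesis .
qed

context
  fixes m q :: nat and \<omega> :: 'a
  assumes \<omega>: "primitive_root_of_unity m \<omega>" and \<omega>_eq: "\<omega> = \<zeta> ^ q"
    and lift: "\<And>j. coprime j m \<Longrightarrow> \<exists>c. coprime c n \<and> [c = j] (mod m)"
begin

text \<open>A unit \<open>j\<close> modulo \<open>m\<close> lifts to an exponent \<open>c\<close>
  prime to \<open>n\<close>; conjugating \<zeta> to \<open>\<zeta> ^ c\<close> moves \<omega> to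
  \<open>\<omega> ^ j\<close>.\<close>

lemma conjugate_power_algebraic_int:
  assumes g: "g \<in> polys_over L" "algebraic_int (poly g \<omega>)" and j: "coprime j m"
  shows "algebraic_int (poly g (\<omega> ^ j))"
proof -
  obtain c where c: "coprime c n" "[c = j] (mod m)" using lift[OF j] by blast
  have z: "primitive_root_of_unity n (\<zeta> ^ c)" using primitive_roots_eq[OF prim] c(1) by blast
  have zq: "(\<zeta> ^ c) ^ q = \<omega> ^ j"
  proof -
    have "(\<zeta> ^ c) ^ q = \<omega> ^ c" by (simp add: \<omega>_eq mult.commute flip: power_mult)
    also have "\<dots> = \<omega> ^ j" using c(2) primitive_root_power_eq_iff[OF \<omega>] by blast
    finally show ?thesis .
  qed
  define F where "F = pcompose g (monom 1 q)"
  have FL: "F \<in> polys_over L"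
    unfolding F_def by (intro polys_over_pcompose[OF L_subring] polys_over_monom[OF L_subring] g subring_1[OF L_subring])
  have F: "poly F x = poly g (x ^ q)" for x by (simp add: F_def poly_pcompose poly_monom)
  have "algebraic_int (poly F \<zeta>)" using g(2) by (simp add: F \<omega>_eq)
  hence "algebraic_int (poly F (\<zeta> ^ c))" by (rule conjugate_algebraic_int[OF FL _ z])
  thus ?thesis by (simp add: F zq)
qed

text \<open>The coefficient is the value at \<zeta> of a polynomial over \<open>L\<close>. Replacing
  \<zeta> by \<open>\<zeta> ^ c\<close> only permutes the summands by
  \<open>j \<mapsto> c * j mod m\<close>, so that value is invariant.\<close>

lemma fourier_coeff_in_L:
  assumes f: "f \<in> polys_over L"
  shows "fourier_coeff m \<omega> f i \<in> L"
proof -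
  have m: "m > 0" using \<omega> by (auto simp: primitive_root_of_unity_def)
  define g where "g = f * monom 1 ((m - 1) * i)"
  have g: "g \<in> polys_over L"
    unfolding g_def by (intro polys_over_mult[OF L_subring] polys_over_monom[OF L_subring] f subring_1[OF L_subring])
  define V where "V = (\<Sum>j\<in>units_mod m. pcompose g (monom 1 (q * j)))"
  have "V \<in> polys_over L"
    unfolding V_def by (intro subring_sum[OF is_subring_polys_over[OF L_subring]]
        polys_over_pcompose[OF L_subring] polys_over_monom[OF L_subring] g subring_1[OF L_subring])
  moreover have V: "poly V x = (\<Sum>j\<in>units_mod m. poly g ((x ^ q) ^ j))" for x
    by (simp add: V_def poly_sum poly_pcompose poly_monom power_mult)
  moreover have "poly V z = poly V \<zeta>" if z: "primitive_root_of_unity n z" for z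
  proof -
    obtain c where c: "coprime c n" "z = \<zeta> ^ c" using primitive_roots_eq[OF prim] z by blast
    have "\<omega> ^ n = 1"
      by (simp only: \<omega>_eq power_mult[symmetric] primitive_root_power_eq_1_iff[OF prim] dvd_triv_right)
    hence "m dvd n" using primitive_root_power_eq_1_iff[OF \<omega>] by blast
    hence cm: "coprime c m" by (rule coprime_divisors[OF dvd_refl _ c(1)])
    have zq: "z ^ q = \<omega> ^ c" by (simp add: \<omega>_eq c(2) mult.commute flip: power_mult)
    have "poly V z = (\<Sum>j\<in>units_mod m. poly g (\<omega> ^ (c * j mod m)))"
      unfolding V zq power_mult[symmetric]
      by (intro sum.cong refl arg_cong[where f = "poly g"])
        (simp add: primitive_root_power_eq_iff[OF \<omega>] cong_def)
    also have "\<dots> = (\<Sum>j\<in>units_mod m. poly g (\<omega> ^ j))"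
      by (rule sum.reindex_bij_betw[OF bij_betw_units_mod[OF m cm]])
    also have "\<dots> = poly V \<zeta>" by (simp add: V \<omega>_eq)
    finally show ?thesis .
  qed
  ultimately have "poly V \<zeta> \<in> L" by (intro invariant_in_base_field)
  moreover have "poly V \<zeta> = fourier_coeff m \<omega> f i"
    unfolding V \<omega>_eq[symmetric] fourier_coeff_def
    by (intro sum.cong refl) (simp add: g_def poly_monom power_mult)
  ultimately show ?thesis by simp
qed

lemma algebraic_int_omega: "algebraic_int \<omega>"
  using \<omega> by (intro algebraic_int_root_of_unity[of m]) (auto simp: primitive_root_of_unity_def)

lemma fourier_coeff_in_O:
  assumes f: "f \<in> polys_over L" "algebraic_int (poly f \<omega>)"
  shows "fourier_coeff m \<omega> f i \<in> \<O>"
proof -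
  have "algebraic_int (fourier_coeff m \<omega> f i)"
    unfolding fourier_coeff_def
    by (intro algebraic_int_sum algebraic_int_mult algebraic_int_power algebraic_int_omega
        conjugate_power_algebraic_int[OF f]) (simp add: units_mod_def)
  thus ?thesis using fourier_coeff_in_L[OF f(1)] by (simp add: ring_of_integers_def)
qed

end

lemma n_times_integer_in_B:
  assumes F: "F \<in> polys_over L" "algebraic_int (poly F \<zeta>)"
  shows "of_nat n * poly F \<zeta> \<in> B"
proof -
  have b: "fourier_coeff n \<zeta> F i \<in> \<O>" for i
    by (rule fourier_coeff_in_O[OF prim, of 1]) (use F in \<open>auto intro: exI[of _ "_ :: nat"]\<close>)
  have "(\<Sum>i<n. fourier_coeff n \<zeta> F i * \<zeta> ^ i) \<in> B"
    using b O_subset_B by (intro subring_sum[OF B_subring] subring_mult[OF B_subring] subring_power[OF B_subring] zeta_in_B) auto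
  thus ?thesis by (simp add: fourier_inversion[OF prim])
qed

end

section \<open>Saturation of the ring generated by zeta at a prime dividing n\<close>

text \<open>The source of congruences modulo \<pi>: it compares values of a polynomial at \<zeta>
  and \<omega>, and powers of two congruent elements.\<close>

lemma poly_diff_factor:
  assumes R: "is_subring R" and f: "f \<in> polys_over R" and xy: "x \<in> R" "y \<in> R"
  shows "\<exists>s\<in>R. poly f x - poly f y = (x - y) * s"
  using f
proof (induction f)
  case 0
  show ?case by (intro bexI[of _ 0]) (auto simp: subring_0[OF R])
next
  case (pCons a f)
  have f: "f \<in> polys_over R" using pCons.prems unfolding polys_over_def mem_Collect_eq by (metis coeff_pCons_Suc)
  then obtain s where s: "s \<in> R" "poly f x - poly f y = (x - y) * s" using pCons.IH by blast
  have "poly (pCons a f) x - poly (pCons a f) y = (x - y) * poly f x + y * (poly f x - poly f y)"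
    by (simp add: algebra_simps)
  also have "\<dots> = (x - y) * (poly f x + y * s)" unfolding s(2) by (simp add: algebra_simps)
  finally show ?case
    using s f xy by (intro bexI[of _ "poly f x + y * s"]) (auto intro!: subring_add[OF R] subring_mult[OF R] poly_in_subring[OF R])
qed

text \<open>\<open>m\<close> is invertible modulo \<open>p\<close>, so it can be cancelled from a
  divisibility by \<open>p\<close> inside \<open>R\<close>.\<close>

lemma bezout_combination:
  fixes p m :: nat and v y :: "'a :: field_char_0"
  assumes R: "is_subring R" and cop: "coprime p m" and eq: "of_nat m * v = of_nat p * y" and mem: "v \<in> R" "y \<in> R"
  shows "\<exists>y'\<in>R. v = of_nat p * y'"
proof -
  obtain s t where "s * int p + t * int m = 1" using bezout_int[of "int p" "int m"] cop by auto
  hence "(of_int (s * int p + t * int m) :: 'a) = 1" by simp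
  hence "v = (of_int s * of_nat p + of_int t * of_nat m) * v" by simp
  also have "\<dots> = of_nat p * (of_int s * v + of_int t * y)"
    using eq by (simp add: algebra_simps)
  finally show ?thesis
    using mem by (intro bexI[of _ "of_int s * v + of_int t * y"])
      (auto intro!: subring_add[OF R] subring_mult[OF R] subring_of_int[OF R])
qed

text \<open>Nilpotents are tested through squares only; higher exponents are recovered by repeated
  squaring.\<close>

definition reduced_mod :: "'a :: field_char_0 set \<Rightarrow> nat \<Rightarrow> bool" where
  "reduced_mod R p \<longleftrightarrow> (\<forall>b\<in>R. b\<^sup>2 \<in> (*) (of_nat p) ` R \<longrightarrow> b \<in> (*) (of_nat p) ` R)"

context cyclotomic_extension
begin

lemma divide_in_O:
  assumes "p > 0" "of_nat p * c \<in> \<O>" "algebraic_int c"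
  shows "c \<in> \<O>"
proof -
  have "inverse (of_nat p) \<in> L" by (intro number_field_inverse[OF L] subring_of_nat[OF L_subring])
  hence "inverse (of_nat p) * (of_nat p * c) \<in> L"
    by (rule subring_mult[OF L_subring _ subsetD[OF O_subset_L assms(2)]])
  hence "c \<in> L" using assms(1) by (simp flip: mult.assoc)
  thus ?thesis using assms(3) by (simp add: ring_of_integers_def)
qed

text \<open>The cofactor \<open>c\<close> lies in \<open>L\<close> as a quotient, and in
  \<open>\<O>\<close> because it is integral. Raising the exponent to \<open>2 ^ N\<close>, which is
  at least \<open>N\<close>, lets squares be removed one at a time.\<close>

lemma reduced_mod_power:
  assumes red: "reduced_mod \<O> p" and p: "p > 0" and b: "b \<in> \<O>" "b ^ N = of_nat p * c" "algebraic_int c"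
  shows "\<exists>y\<in>\<O>. b = of_nat p * y"
proof -
  have *: "b \<in> (*) (of_nat p) ` \<O>" if "b \<in> \<O>" "b ^ 2 ^ k \<in> (*) (of_nat p) ` \<O>" for b k
    using that
  proof (induction k arbitrary: b)
    case (Suc k)
    have 1: "(b\<^sup>2) ^ 2 ^ k \<in> (*) (of_nat p) ` \<O>" using Suc.prems(2) by (simp add: power_mult)
    have "b\<^sup>2 \<in> \<O>" using Suc.prems(1) by (rule subring_power[OF O_subring])
    from Suc.IH[OF this 1] have "b\<^sup>2 \<in> (*) (of_nat p) ` \<O>" .
    thus ?case using red Suc.prems(1) by (simp add: reduced_mod_def)
  qed simp
  have "of_nat p * c \<in> \<O>" using subring_power[OF O_subring b(1), of N] by (simp add: b(2))
  hence c: "c \<in> \<O>" by (rule divide_in_O[OF p _ b(3)])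
  have "N \<le> 2 ^ N" using less_exp[of N] by simp
  hence "b ^ 2 ^ N = b ^ N * b ^ (2 ^ N - N)" by (simp flip: power_add)
  also have "\<dots> = of_nat p * (c * b ^ (2 ^ N - N))" by (simp add: b(2) mult.assoc)
  finally have "b ^ 2 ^ N \<in> (*) (of_nat p) ` \<O>"
    using b(1) c by (auto intro!: imageI subring_mult[OF O_subring] subring_power[OF O_subring])
  from *[OF b(1) this] show ?thesis by blast
qed

context
  fixes p a m k :: nat
  assumes p: "prime p" and n_eq: "n = p ^ a * m" and a: "a > 0" and cop: "coprime p m"
    and k: "k \<ge> a" and qm: "[p ^ k = 1] (mod m)" and red: "reduced_mod \<O> p"
begin

text \<open>This exponent is 1 modulo \<open>m\<close> and 0 modulo \<open>p ^ a\<close>, so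
  \<open>\<zeta> ^ q\<close> is the part of \<zeta> of order \<open>m\<close>. The exponent
  \<open>s\<close> is \<open>1 - q\<close> modulo \<open>n\<close>, kept nonnegative; it gives the
  part of order \<open>p ^ a\<close>.\<close>

definition "q = p ^ k"
definition "\<omega> = \<zeta> ^ q"
definition "s = 1 + (n - 1) * q"
definition "\<eta> = \<zeta> ^ s"
definition "\<pi> = 1 - \<eta>"

lemma p_pos: "p > 0" using p by (rule prime_gt_0_nat)

lemma m_pos: "m > 0" using n_pos n_eq by (cases "m = 0") auto

lemma omega_primitive: "primitive_root_of_unity m \<omega>"
  unfolding \<omega>_def
proof (rule primitive_root_power[OF prim m_pos])
  fix i
  have "coprime m q" using cop by (simp add: q_def coprime_commute)
  show "n dvd q * i \<longleftrightarrow> m dvd i"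
  proof
    assume "n dvd q * i"
    hence "m dvd q * i" using n_eq dvd_mult_right by blast
    thus "m dvd i" using \<open>coprime m q\<close> by (simp add: coprime_dvd_mult_right_iff)
  next
    assume "m dvd i"
    moreover have "p ^ a dvd q" unfolding q_def using k by (rule le_imp_power_dvd)
    ultimately show "n dvd q * i" unfolding n_eq by (intro mult_dvd_mono)
  qed
qed

text \<open>The lift is chosen congruent to 1 modulo \<open>p\<close>, which makes it prime to
  \<open>p ^ a\<close>.\<close>

lemma lift_unit:
  assumes "coprime j m"
  shows "\<exists>c. coprime c n \<and> [c = j] (mod m)"
proof -
  obtain c where c: "[c = 1] (mod p)" "[c = j] (mod m)"
    using binary_chinese_remainder_nat[OF cop] by blast
  have "coprime c p" using c(1) cong_imp_coprime[of 1 c p] by (simp add: cong_sym)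
  moreover have "coprime c m" using c(2) assms cong_imp_coprime[of j c m] by (simp add: cong_sym)
  ultimately have "coprime c n" by (simp add: n_eq)
  with c(2) show ?thesis by blast
qed

lemma omega_times_eta: "\<omega> * \<eta> = \<zeta>"
proof -
  have "q + s = n * q + 1" using n_pos by (simp add: s_def mult_eq_if[of n])
  hence "\<omega> * \<eta> = \<zeta> ^ (n * q + 1)" by (simp add: \<omega>_def \<eta>_def flip: power_add)
  also have "\<dots> = \<zeta>" by (simp add: power_mult zeta_power_n)
  finally show ?thesis .
qed

lemma eta_power: "\<eta> ^ p ^ a = 1"
proof -
  have "[1 + (n - 1) * q = 1 + (n - 1) * 1] (mod m)"
    using qm unfolding q_def by (intro cong_add cong_mult cong_refl)
  hence "[s = n] (mod m)" using n_pos by (simp add: s_def)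
  moreover have "m dvd n" by (simp add: n_eq)
  ultimately have "m dvd s" using cong_dvd_iff by blast
  hence "p ^ a * m dvd p ^ a * s" by (rule mult_dvd_mono[OF dvd_refl])
  hence "n dvd s * p ^ a" by (simp add: n_eq mult.commute)
  thus ?thesis by (simp add: \<eta>_def primitive_root_power_eq_1_iff[OF prim] flip: power_mult)
qed

text \<open>Since \<open>p\<close> divides \<open>q\<close>, the exponent \<open>s\<close> is 1
  modulo \<open>p\<close>; thus \<eta> has order exactly \<open>p ^ a\<close>.\<close>

lemma theta_neq_1: "\<eta> ^ p ^ (a - 1) \<noteq> 1"
proof
  assume "\<eta> ^ p ^ (a - 1) = 1"
  hence "n dvd s * p ^ (a - 1)"
    by (simp add: \<eta>_def primitive_root_power_eq_1_iff[OF prim] flip: power_mult)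
  moreover have "n = p * m * p ^ (a - 1)" using a by (cases a) (simp_all add: n_eq mult_ac)
  ultimately have "p * m dvd s" using p_pos by simp
  hence "p dvd 1 + (n - 1) * q" unfolding s_def by (rule dvd_mult_left)
  moreover have "p dvd (n - 1) * q" using k a by (simp add: q_def dvd_power)
  ultimately have "p dvd 1" using dvd_add_left_iff by blast
  thus False using p by simp
qed

lemma pi_neq_0: "\<pi> \<noteq> 0"
  using theta_neq_1 by (auto simp: \<pi>_def)

lemma eta_in_B: "\<eta> \<in> B" and omega_in_B': "\<omega> \<in> B"
  unfolding \<eta>_def \<omega>_def by (intro subring_power[OF B_subring] zeta_in_B)+

lemma pi_in_B: "\<pi> \<in> B"
  unfolding \<pi>_def by (intro subring_diff[OF B_subring] subring_1[OF B_subring] eta_in_B)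

text \<open>For \<theta> of order \<open>p\<close>, the sum of all \<open>1 - \<theta> ^ i\<close>
  is \<open>p\<close>, and each summand is divisible by \<pi> because \<theta> is a power of
  \<eta>.\<close>

lemma pi_dvd_p: "\<exists>u\<in>B. of_nat p = \<pi> * u"
proof -
  define \<theta> where "\<theta> = \<eta> ^ p ^ (a - 1)"
  have "\<theta> ^ p = \<eta> ^ (p ^ (a - 1) * p)" by (simp add: \<theta>_def power_mult)
  also have "p ^ (a - 1) * p = p ^ a" using a by (cases a) (simp_all add: mult.commute)
  finally have "\<theta> ^ p = 1" by (simp add: eta_power)
  moreover have "\<theta> \<noteq> 1" using theta_neq_1 by (simp add: \<theta>_def)
  ultimately have "(\<Sum>i<p. \<theta> ^ i) = 0" by (rule geometric_sum_root_of_unity)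
  hence "of_nat p = (\<Sum>i<p. 1 - \<theta> ^ i)" by (simp add: sum_subtractf)
  also have "\<dots> = (\<Sum>i<p. \<pi> * (\<Sum>l<p ^ (a - 1) * i. \<eta> ^ l))"
    by (intro sum.cong refl) (simp add: \<theta>_def \<pi>_def one_diff_power_eq flip: power_mult)
  also have "\<dots> = \<pi> * (\<Sum>i<p. \<Sum>l<p ^ (a - 1) * i. \<eta> ^ l)" by (simp only: sum_distrib_left)
  finally show ?thesis
    by (rule bexI) (intro subring_sum[OF B_subring] subring_power[OF B_subring] eta_in_B)
qed

text \<open>Modulo \<open>p\<close>, the power \<open>(\<eta> + \<pi>) ^ p ^ a = 1\<close> equals
  \<open>\<eta> ^ p ^ a + \<pi> ^ p ^ a = 1 + \<pi> ^ p ^ a\<close>.\<close>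

lemma p_dvd_pi_power: "\<exists>y\<in>B. \<pi> ^ p ^ a = of_nat p * y"
proof -
  obtain c where c: "c \<in> B" "(\<eta> + \<pi>) ^ p ^ a = \<eta> ^ p ^ a + \<pi> ^ p ^ a + of_nat p * c"
    using add_power_prime_power[OF B_subring p eta_in_B pi_in_B] by blast
  have "\<eta> + \<pi> = 1" by (simp add: \<pi>_def)
  hence "\<pi> ^ p ^ a = of_nat p * (- c)" using c(2) by (simp add: eta_power add_eq_0_iff)
  thus ?thesis using c(1) subring_uminus[OF B_subring] by blast
qed

text \<open>Nilpotency modulo \<open>p\<close> passes from \<open>poly f \<omega>\<close> to its
  conjugates and then to the Fourier coefficients, which lie in \<open>\<O>\<close> and are
  therefore divisible by \<open>p\<close>. Inversion recovers \<open>m\<close> times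
  \<open>poly f \<omega>\<close>, and \<open>m\<close> is prime to \<open>p\<close>.\<close>

lemma omega_part_reduced:
  assumes f: "f \<in> polys_over \<O>" and pow: "poly f \<omega> ^ N = of_nat p * c" "algebraic_int c"
  shows "\<exists>y\<in>B. poly f \<omega> = of_nat p * y"
proof -
  note om = omega_primitive \<omega>_def lift_unit
  have fL: "f \<in> polys_over L" using f polys_over_mono[OF O_subset_L] by blast
  have f_int: "algebraic_int (coeff f i)" for i using f algebraic_int_O by (simp add: polys_over_def)
  have om_int: "algebraic_int \<omega>" by (rule algebraic_int_omega[OF om])
  have conj: "\<exists>d. algebraic_int d \<and> poly f (\<omega> ^ j) ^ N = of_nat p * d" if j: "coprime j m" for j
  proof -
    \<comment> \<open>Division by \<open>p\<close> is carried out on the polynomial: the value at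
      \<omega> is the algebraic integer \<open>c\<close>, so the values at the conjugates are
      algebraic integers too.\<close>
    define g where "g = [:inverse (of_nat p):] * f ^ N"
    have "inverse (of_nat p) \<in> L" by (intro number_field_inverse[OF L] subring_of_nat[OF L_subring])
    from polys_over_monom[OF L_subring this, of 0]
    have "[:inverse (of_nat p):] \<in> polys_over L" by (simp add: monom_0)
    hence g: "g \<in> polys_over L"
      unfolding g_def using fL
      by (intro polys_over_mult[OF L_subring] subring_power[OF is_subring_polys_over[OF L_subring]])
    have gx: "poly f x ^ N = of_nat p * poly g x" for x using p_pos by (simp add: g_def poly_power)
    have "of_nat p * poly g \<omega> = of_nat p * c" by (rule trans[OF gx[symmetric] pow(1)])
    hence "algebraic_int (poly g \<omega>)" using pow(2) p_pos by simp
    from conjugate_power_algebraic_int[OF om g this j] have "algebraic_int (poly g (\<omega> ^ j))" .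
    thus ?thesis using gx by blast
  qed
  let ?b = "fourier_coeff m \<omega> f"
  have f_om: "algebraic_int (poly f \<omega>)" using f_int om_int by (rule algebraic_int_poly)
  have b: "?b i \<in> \<O>" for i by (rule fourier_coeff_in_O[OF om fL f_om])
  have "\<exists>y\<in>\<O>. ?b i = of_nat p * y" for i
  proof -
    define h where "h j = poly f (\<omega> ^ j) * \<omega> ^ (j * ((m - 1) * i))" for j
    have h_int: "algebraic_int (h j)" for j
      unfolding h_def
      by (intro algebraic_int_mult algebraic_int_power algebraic_int_poly f_int om_int)
    obtain d where d: "\<And>j. coprime j m \<Longrightarrow> algebraic_int (d j) \<and> poly f (\<omega> ^ j) ^ N = of_nat p * d j"
      using conj by metis
    \<comment> \<open>The exponent \<open>p ^ N\<close> is at least \<open>N\<close>, so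
      divisibility of the \<open>N\<close>-th power persists, and it is a power of \<open>p\<close>,
      so it can be applied termwise to a sum modulo \<open>p\<close>.\<close>
    define e where "e j = d j * poly f (\<omega> ^ j) ^ (p ^ N - N) * (\<omega> ^ (j * ((m - 1) * i))) ^ p ^ N" for j
    have Np: "N \<le> p ^ N" using less_exp[of N] power_mono[of 2 p N] prime_ge_2_nat[OF p] by linarith
    have hp: "h j ^ p ^ N = of_nat p * e j" and e_int: "algebraic_int (e j)" if j: "j \<in> units_mod m" for j
    proof -
      have cj: "coprime j m" using j by (simp add: units_mod_def)
      have "poly f (\<omega> ^ j) ^ p ^ N = poly f (\<omega> ^ j) ^ N * poly f (\<omega> ^ j) ^ (p ^ N - N)"
        using Np by (simp flip: power_add)
      thus "h j ^ p ^ N = of_nat p * e j"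
        using d[OF cj] by (simp only: h_def e_def power_mult_distrib mult.assoc)
      show "algebraic_int (e j)"
        unfolding e_def using d[OF cj]
        by (intro algebraic_int_mult algebraic_int_power algebraic_int_poly f_int om_int) blast
    qed
    obtain r where r: "algebraic_int r" "?b i ^ p ^ N = (\<Sum>j\<in>units_mod m. h j ^ p ^ N) + of_nat p * r"
      using sum_power_prime_power[OF is_subring_algebraic_ints p, of "units_mod m" h N] h_int
      by (auto simp: fourier_coeff_def h_def)
    have "?b i ^ p ^ N = of_nat p * ((\<Sum>j\<in>units_mod m. e j) + r)"
      unfolding r(2) by (simp add: hp distrib_left sum_distrib_left)
    moreover have "algebraic_int ((\<Sum>j\<in>units_mod m. e j) + r)"
      using e_int r(1) by (intro algebraic_int_add algebraic_int_sum)
    ultimately show ?thesis by (rule reduced_mod_power[OF red p_pos b])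
  qed
  then obtain y where y: "\<And>i. y i \<in> \<O> \<and> ?b i = of_nat p * y i" by metis
  have yB: "(\<Sum>i<m. y i * \<omega> ^ i) \<in> B"
    using y O_subset_B
    by (intro subring_sum[OF B_subring] subring_mult[OF B_subring] subring_power[OF B_subring] omega_in_B') auto
  have "of_nat m * poly f \<omega> = (\<Sum>i<m. ?b i * \<omega> ^ i)"
    by (rule fourier_inversion[OF omega_primitive, symmetric])
  also have "\<dots> = of_nat p * (\<Sum>i<m. y i * \<omega> ^ i)"
    unfolding sum_distrib_left using y by (intro sum.cong refl) (simp only: mult.assoc)
  finally have eq: "of_nat m * poly f \<omega> = of_nat p * (\<Sum>i<m. y i * \<omega> ^ i)" .
  have "poly f \<omega> \<in> B"
    using polys_over_mono[OF O_subset_B] f omega_in_B' by (intro poly_in_subring[OF B_subring]) auto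
  thus ?thesis using bezout_combination[OF B_subring cop eq _ yB] by blast
qed

lemma pi_saturated:
  assumes x: "algebraic_int x" and xB: "\<pi> * x \<in> B"
  shows "x \<in> B"
proof -
  define y where "y = \<pi> * x"
  obtain f where f: "f \<in> polys_over \<O>" "y = poly f \<zeta>"
    using xB by (auto simp: adjoin_ring_def y_def)
  \<comment> \<open>Replacing \<zeta> by \<omega> changes the value by a multiple of
    \<open>\<zeta> - \<omega> = - (\<omega> * \<pi>)\<close>. So \<open>v\<close> is congruent to
    \<open>y\<close> modulo \<pi>, and its nilpotency modulo \<open>p\<close> can be
    exploited.\<close>
  define v where "v = poly f \<omega>"
  have fB: "f \<in> polys_over B" using f(1) polys_over_mono[OF O_subset_B] by blast
  have vB: "v \<in> B" unfolding v_def using fB omega_in_B' by (intro poly_in_subring[OF B_subring])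
  have yB: "y \<in> B" using xB by (simp add: y_def)
  obtain t0 where t0: "t0 \<in> B" "y - v = (\<zeta> - \<omega>) * t0"
    using poly_diff_factor[OF B_subring fB zeta_in_B omega_in_B'] by (auto simp: f(2) v_def)
  have "\<zeta> - \<omega> = - (\<omega> * \<pi>)" using omega_times_eta by (simp add: \<pi>_def algebra_simps)
  hence yv: "y - v = \<pi> * (- (\<omega> * t0))" using t0(2) by simp
  define t where "t = - (\<omega> * t0)"
  have tB: "t \<in> B"
    unfolding t_def by (intro subring_uminus[OF B_subring] subring_mult[OF B_subring] omega_in_B' t0)
  obtain h where h: "lead_coeff h = 1" "\<forall>i. coeff h i \<in> \<int>" "poly h x = 0"
    using x by (auto elim: algebraic_int.cases)
  define r where "r = degree h"
  have "0 = (\<Sum>i\<le>r. coeff h i * x ^ i)" using h(3) by (simp add: poly_altdef r_def)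
  also have "\<dots> = (\<Sum>i<r. coeff h i * x ^ i) + x ^ r"
    using h(1) by (simp add: r_def lessThan_Suc_atMost[symmetric])
  finally have "x ^ r = - (\<Sum>i<r. coeff h i * x ^ i)" by (simp add: eq_neg_iff_add_eq_0 add.commute)
  \<comment> \<open>Multiplying the integral equation of \<open>x\<close> by
    \<open>\<pi> ^ r\<close> leaves at least one factor \<pi> in each term with
    \<open>i < r\<close>, after \<open>\<pi> ^ i\<close> has been absorbed into
    \<open>y ^ i\<close>.\<close>
  hence "y ^ r = \<pi> ^ r * - (\<Sum>i<r. coeff h i * x ^ i)" by (simp add: y_def power_mult_distrib)
  also have "\<dots> = - (\<Sum>i<r. \<pi> ^ r * (coeff h i * x ^ i))" by (simp add: sum_distrib_left)
  also have "(\<Sum>i<r. \<pi> ^ r * (coeff h i * x ^ i)) = (\<Sum>i<r. \<pi> * (\<pi> ^ (r - Suc i) * coeff h i * y ^ i))"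
  proof (intro sum.cong refl)
    fix i assume "i \<in> {..<r}"
    hence "r = Suc (r - Suc i) + i" by simp
    hence "\<pi> ^ r = \<pi> * \<pi> ^ (r - Suc i) * \<pi> ^ i" by (metis power_Suc power_add)
    thus "\<pi> ^ r * (coeff h i * x ^ i) = \<pi> * (\<pi> ^ (r - Suc i) * coeff h i * y ^ i)"
      by (simp add: y_def power_mult_distrib mult_ac)
  qed
  finally have yr: "y ^ r = \<pi> * - (\<Sum>i<r. \<pi> ^ (r - Suc i) * coeff h i * y ^ i)"
    by (simp add: sum_distrib_left)
  define w where "w = - (\<Sum>i<r. \<pi> ^ (r - Suc i) * coeff h i * y ^ i)"
  have wB: "w \<in> B"
    unfolding w_def using h(2) Ints_subset_subring[OF B_subring]
    by (intro subring_uminus[OF B_subring] subring_sum[OF B_subring] subring_mult[OF B_subring]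
        subring_power[OF B_subring] pi_in_B yB) auto
  obtain t1 where t1: "t1 \<in> B" "y ^ r - v ^ r = (y - v) * t1"
    using poly_diff_factor[OF B_subring polys_over_monom[OF B_subring subring_1[OF B_subring], of r] yB vB]
    by (auto simp: poly_monom)
  define w' where "w' = w - t * t1"
  have w'B: "w' \<in> B"
    unfolding w'_def by (intro subring_diff[OF B_subring] subring_mult[OF B_subring] wB tB t1)
  have "v ^ r = \<pi> * w'"
    using t1(2) yr yv by (simp add: w'_def w_def t_def algebra_simps)
  moreover obtain z where z: "z \<in> B" "\<pi> ^ p ^ a = of_nat p * z" using p_dvd_pi_power by blast
  \<comment> \<open>\<open>v ^ r\<close> is divisible by \<pi>; the further exponent
    \<open>p ^ a\<close> turns \<pi> into a multiple of \<open>p\<close>.\<close>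
  ultimately have "v ^ (r * p ^ a) = of_nat p * (z * w' ^ p ^ a)"
    by (simp add: power_mult power_mult_distrib mult.assoc)
  moreover have "algebraic_int (z * w' ^ p ^ a)"
    by (intro algebraic_int_B subring_mult[OF B_subring] subring_power[OF B_subring] z w'B)
  ultimately obtain v' where v': "v' \<in> B" "v = of_nat p * v'"
    using omega_part_reduced[OF f(1)] unfolding v_def by blast
  obtain u where u: "u \<in> B" "of_nat p = \<pi> * u" using pi_dvd_p by blast
  have "y = v + \<pi> * t" using yv by (simp add: t_def diff_eq_eq)
  also have "\<dots> = \<pi> * (u * v' + t)" unfolding v'(2) u(2) by (simp add: algebra_simps)
  finally have "\<pi> * x = \<pi> * (u * v' + t)" by (simp add: y_def)
  hence "x = u * v' + t" using pi_neq_0 by simp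
  thus ?thesis using u v' tB by (auto intro!: subring_add[OF B_subring] subring_mult[OF B_subring])
qed

lemma p_saturated_aux:
  assumes x: "algebraic_int x" and xB: "of_nat p * x \<in> B"
  shows "x \<in> B"
proof -
  have *: "x \<in> B" if "\<pi> ^ j * x \<in> B" for j
    using that
  proof (induction j)
    case (Suc j)
    have 1: "\<pi> * (\<pi> ^ j * x) \<in> B" using Suc.prems by (simp add: mult.assoc)
    have "algebraic_int (\<pi> ^ j * x)"
      by (intro algebraic_int_mult algebraic_int_power algebraic_int_B pi_in_B x)
    from pi_saturated[OF this 1] have "\<pi> ^ j * x \<in> B" .
    thus ?case by (rule Suc.IH)
  qed simp
  obtain z where z: "z \<in> B" "\<pi> ^ p ^ a = of_nat p * z" using p_dvd_pi_power by blast
  have "\<pi> ^ p ^ a * x = z * (of_nat p * x)" using z(2) by simp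
  also have "\<dots> \<in> B" by (intro subring_mult[OF B_subring] z xB)
  finally show ?thesis by (rule *)
qed

end

lemma p_saturated:
  assumes p: "prime p" "p dvd n" and red: "reduced_mod \<O> p"
    and x: "algebraic_int x" "of_nat p * x \<in> B"
  shows "x \<in> B"
proof -
  define a where "a = multiplicity p n"
  have "n \<noteq> 0" using n_pos by simp
  obtain m where m: "n = p ^ a * m" "\<not> p dvd m"
    unfolding a_def by (rule multiplicity_decompose'[OF \<open>n \<noteq> 0\<close>, of p]) (use p(1) in auto)
  have a: "a > 0" using p \<open>n \<noteq> 0\<close> by (simp add: a_def prime_multiplicity_gt_zero_iff)
  have cop: "coprime p m" using p(1) m(2) by (rule prime_imp_coprime)
  have "m > 0" using m n_pos by (cases "m = 0") auto
  hence "totient m \<ge> 1" by (simp add: Suc_leI)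
  \<comment> \<open>The factor \<open>totient m\<close> makes this power of \<open>p\<close>
    congruent to 1 modulo \<open>m\<close> by Euler's theorem; the factor \<open>a\<close> makes it
    divisible by \<open>p ^ a\<close>.\<close>
  hence k: "totient m * a \<ge> a" by simp
  have "[(p ^ totient m) ^ a = 1 ^ a] (mod m)" using euler_theorem[OF cop] by (rule cong_pow)
  hence "[p ^ (totient m * a) = 1] (mod m)" by (simp add: power_mult)
  thus ?thesis using p_saturated_aux[OF p(1) m(1) a cop k _ red x] by blast
qed

text \<open>Stated for all divisors \<open>N\<close> of \<open>n\<close> so that the induction can
  remove one prime factor at a time.\<close>

lemma divisor_saturated:
  assumes red: "\<And>p. prime p \<Longrightarrow> p dvd n \<Longrightarrow> reduced_mod \<O> p"
    and N: "N dvd n" and x: "algebraic_int x" "of_nat N * x \<in> B"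
  shows "x \<in> B"
  using N x
proof (induction N arbitrary: x rule: less_induct)
  case (less N)
  show ?case
  proof (cases "N = 1")
    case False
    then obtain p where p: "prime p" "p dvd N" using prime_factor_nat by blast
    then obtain M where M: "N = p * M" by (elim dvdE)
    have "N > 0" using less.prems(1) n_pos by (cases "N = 0") auto
    hence "M < N" using M prime_gt_1_nat[OF p(1)] by (cases "M = 0") auto
    have 1: "of_nat p * (of_nat M * x) \<in> B" using less.prems(3) M by (simp add: mult.assoc)
    have 2: "algebraic_int (of_nat M * x)" by (intro algebraic_int_mult algebraic_int_of_nat less.prems)
    have pn: "p dvd n" using p(2) less.prems(1) by (rule dvd_trans)
    from p_saturated[OF p(1) pn red[OF p(1) pn] 2 1] have "of_nat M * x \<in> B" .
    moreover have "M dvd n" using M less.prems(1) dvd_mult_right by blast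
    ultimately show ?thesis using less.IH[OF \<open>M < N\<close>] less.prems(2) by blast
  qed (use less.prems in simp)
qed

end

section \<open>The ring generated by zeta over L is already a field\<close>

text \<open>Vanishing constant terms are divided out; then \<open>a + w * poly h w = 0\<close> with
  nonzero \<open>a\<close> exhibits the inverse of \<open>w\<close> as a polynomial in
  \<open>w\<close>.\<close>

lemma inverse_in_subring:
  fixes w :: "'a :: field"
  assumes R: "is_subring R" and K: "is_subfield K" "K \<subseteq> R" and w: "w \<in> R" "w \<noteq> 0"
    and h: "h \<in> polys_over K" "h \<noteq> 0" "poly h w = 0"
  shows "inverse w \<in> R"
  using h
proof (induction h)
  case 0
  thus ?case by simp
next
  case (pCons a h)
  have h: "h \<in> polys_over K" using pCons.prems(1) unfolding polys_over_def mem_Collect_eq by (metis coeff_pCons_Suc)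
  have a: "a \<in> K" using pCons.prems(1) unfolding polys_over_def mem_Collect_eq by (metis coeff_pCons_0)
  show ?case
  proof (cases "a = 0")
    case True
    thus ?thesis using pCons.IH[OF h] pCons.prems w(2) by auto
  next
    case False
    have "w * (- poly h w * inverse a) = 1" using pCons.prems(3) False by (simp add: field_simps add_eq_0_iff)
    hence "inverse w = - poly h w * inverse a" by (rule inverse_unique)
    moreover have "inverse a \<in> R" using a K by (auto simp: is_subfield_def)
    moreover have "poly h w \<in> R"
      using h polys_over_mono[OF K(2)] w(1) by (intro poly_in_subring[OF R]) auto
    ultimately show ?thesis by (simp add: subring_mult[OF R] subring_uminus[OF R])
  qed
qed

context cyclotomic_extension
begin

lemma adjoin_ring_integer_multiple:
  assumes "y \<in> adjoin_ring L \<zeta>"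
  shows "\<exists>N::nat. N > 0 \<and> algebraic_int (of_nat N * y)"
proof -
  obtain F where F: "F \<in> polys_over L" "y = poly F \<zeta>" using assms by (auto simp: adjoin_ring_def)
  have "\<exists>N::nat. N > 0 \<and> algebraic_int (of_nat N * poly F \<zeta>)"
    using F(1)
  proof (induction F)
    case 0
    show ?case by (intro exI[of _ 1]) simp
  next
    case (pCons a F)
    have "F \<in> polys_over L" using pCons.prems unfolding polys_over_def mem_Collect_eq by (metis coeff_pCons_Suc)
    then obtain N :: nat where N: "N > 0" "algebraic_int (of_nat N * poly F \<zeta>)" using pCons.IH by blast
    have "a \<in> L" using pCons.prems unfolding polys_over_def mem_Collect_eq by (metis coeff_pCons_0)
    then obtain M :: nat where M: "M > 0" "algebraic_int (of_nat M * a)"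
      by (rule algebraic_int_multiple[OF L]) blast
    have "of_nat (N * M) * poly (pCons a F) \<zeta> = of_nat N * (of_nat M * a) + of_nat M * \<zeta> * (of_nat N * poly F \<zeta>)"
      by (simp add: algebra_simps)
    moreover have "algebraic_int (of_nat N * (of_nat M * a) + of_nat M * \<zeta> * (of_nat N * poly F \<zeta>))"
      by (intro algebraic_int_add algebraic_int_mult[OF algebraic_int_of_nat] algebraic_int_mult[OF _ N(2)]
          M algebraic_int_zeta)
    ultimately show ?case using N M by (intro exI[of _ "N * M"]) simp
  qed
  thus ?thesis by (simp add: F(2))
qed

text \<open>A positive integer multiple of each element satisfies a monic integer equation; its
  inverse is then a polynomial in it.\<close>

lemma is_subfield_adjoin_ring: "is_subfield (adjoin_ring L \<zeta>)"
proof -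
  note R = is_subring_adjoin_ring[OF L_subring, of \<zeta>]
  have LR: "L \<subseteq> adjoin_ring L \<zeta>" using adjoin_ring_base[OF L_subring] by blast
  have "inverse y \<in> adjoin_ring L \<zeta>" if y: "y \<in> adjoin_ring L \<zeta>" "y \<noteq> 0" for y
  proof -
    obtain N :: nat where N: "N > 0" "algebraic_int (of_nat N * y)"
      using adjoin_ring_integer_multiple[OF y(1)] by blast
    obtain h where h: "lead_coeff h = 1" "\<forall>i. coeff h i \<in> \<int>" "poly h (of_nat N * y) = 0"
      using N(2) by (auto elim: algebraic_int.cases)
    have 1: "h \<in> polys_over L" using h(2) Ints_subset_subring[OF L_subring] by (auto simp: polys_over_def)
    have 2: "h \<noteq> 0" using h(1) by auto
    have 3: "of_nat N * y \<in> adjoin_ring L \<zeta>" using y(1) by (intro subring_mult[OF R] subring_of_nat[OF R])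
    have "is_subfield L" using L by (simp add: number_field_def)
    hence "inverse (of_nat N * y) \<in> adjoin_ring L \<zeta>"
      using N(1) y(2) by (intro inverse_in_subring[OF R _ LR 3 _ 1 2 h(3)]) auto
    hence "of_nat N * inverse (of_nat N * y) \<in> adjoin_ring L \<zeta>"
      by (rule subring_mult[OF R subring_of_nat[OF R]])
    thus ?thesis using N(1) by (simp add: field_simps)
  qed
  hence "inverse y \<in> adjoin_ring L \<zeta>" if "y \<in> adjoin_ring L \<zeta>" for y
    using that subring_0[OF R] by (cases "y = 0") auto
  thus ?thesis
    using R unfolding is_subfield_def is_subring_def by blast
qed

lemma adjoin_field_eq: "adjoin_field L \<zeta> = adjoin_ring L \<zeta>"
proof (rule equalityI)
  have "insert \<zeta> L \<subseteq> adjoin_ring L \<zeta>"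
    using adjoin_ring_base[OF L_subring] adjoin_ring_gen[OF L_subring] by blast
  thus "adjoin_field L \<zeta> \<subseteq> adjoin_ring L \<zeta>"
    unfolding adjoin_field_def by (intro hull_minimal is_subfield_adjoin_ring)
  have "poly F \<zeta> \<in> K" if F: "F \<in> polys_over L" and K: "is_subfield K" "insert \<zeta> L \<subseteq> K" for F K
    using F polys_over_mono[of L K] K by (intro poly_in_subring[OF is_subring_subfield]) auto
  thus "adjoin_ring L \<zeta> \<subseteq> adjoin_field L \<zeta>"
    unfolding adjoin_field_def hull_def adjoin_ring_def by blast
qed

lemma adjoin_ring_integers_subset: "B \<subseteq> ring_of_integers (adjoin_field L \<zeta>)"
  unfolding adjoin_field_eq ring_of_integers_def[of "adjoin_ring L \<zeta>"]
  using algebraic_int_B adjoin_ring_mono[OF O_subset_L] by blast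

lemma ring_of_integers_adjoin_eq_if_reduced:
  assumes red: "\<And>p. prime p \<Longrightarrow> p dvd n \<Longrightarrow> reduced_mod \<O> p"
  shows "B = ring_of_integers (adjoin_field L \<zeta>)"
proof (rule equalityI[OF adjoin_ring_integers_subset subsetI])
  fix x assume "x \<in> ring_of_integers (adjoin_field L \<zeta>)"
  hence x: "x \<in> adjoin_ring L \<zeta>" "algebraic_int x"
    by (auto simp: ring_of_integers_def adjoin_field_eq)
  then obtain F where F: "F \<in> polys_over L" "x = poly F \<zeta>" by (auto simp: adjoin_ring_def)
  have nB: "of_nat n * x \<in> B" using n_times_integer_in_B[OF F(1)] x(2) F(2) by simp
  show "x \<in> B" by (rule divisor_saturated[OF _ dvd_refl x(2) nB]) (rule red)
qed

section \<open>A ramified element and the necessity of reducedness\<close>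

abbreviation "Z\<zeta> \<equiv> adjoin_ring \<int> \<zeta>"

lemma Zzeta_subring: "is_subring Z\<zeta>" by (rule is_subring_adjoin_ring[OF is_subring_Ints])

lemma zeta_power_in_Zzeta: "\<zeta> ^ i \<in> Z\<zeta>"
  by (intro subring_power[OF Zzeta_subring] adjoin_ring_gen[OF is_subring_Ints])

lemma Zzeta_subset_B: "Z\<zeta> \<subseteq> B"
  by (rule adjoin_ring_mono[OF Ints_subset_subring[OF O_subring]])

text \<open>
  The element \<open>\<rho>\<close> is \<open>1 - \<kappa>\<close> for a root of unity \<open>\<kappa>\<close> of order \<open>p\<close>, or of order 4 when \<open>p = 2\<close>.
\<close>

lemma ex_ramified_element:
  assumes p: "prime p" "p dvd n" and n4: "\<not> [n = 2] (mod 4)"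
  obtains \<rho> \<gamma> \<delta> N where "\<rho> \<in> Z\<zeta>" "\<gamma> \<in> Z\<zeta>" "\<delta> \<in> Z\<zeta>" "of_nat p = \<rho>\<^sup>2 * \<gamma>" "\<rho> ^ N = of_nat p * \<delta>"
proof (cases "p = 2")
  case True
  have "even n" using p True by simp
  hence "4 dvd n" using n4 unfolding cong_def by presburger
  then obtain e where e: "n = 4 * e" by (elim dvdE)
  have e0: "e > 0" using n_pos e by simp
  define \<kappa> where "\<kappa> = \<zeta> ^ e"
  have "\<kappa> ^ 4 = 1" using zeta_power_n e by (simp add: \<kappa>_def mult.commute flip: power_mult)
  hence "(\<kappa>\<^sup>2 - 1) * (\<kappa>\<^sup>2 + 1) = 0" by (simp add: algebra_simps power2_eq_square power4_eq_xxxx)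
  moreover have "\<kappa>\<^sup>2 \<noteq> 1"
  proof
    assume "\<kappa>\<^sup>2 = 1"
    hence "n dvd e * 2" by (simp add: \<kappa>_def primitive_root_power_eq_1_iff[OF prim] flip: power_mult)
    hence "n \<le> e * 2" using e0 by (intro dvd_imp_le) auto
    thus False using e e0 by simp
  qed
  ultimately have k2: "\<kappa>\<^sup>2 = - 1" by (simp add: eq_neg_iff_add_eq_0)
  have kZ: "\<kappa> \<in> Z\<zeta>" unfolding \<kappa>_def by (rule zeta_power_in_Zzeta)
  \<comment> \<open>The square of \<open>1 - \<kappa>\<close> is 2 up to the unit
    \<open>- \<kappa>\<close>, so 2 and this square divide each other; the witnesses \<kappa> and
    \<open>- \<kappa>\<close> follow from \<open>\<kappa>\<^sup>2 = - 1\<close>.\<close>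
  have sq: "(1 - \<kappa>)\<^sup>2 = - 2 * \<kappa>" using k2 by (simp add: power2_eq_square algebra_simps)
  show ?thesis
  proof (rule that[of "1 - \<kappa>" \<kappa> "- \<kappa>" 2])
    show "1 - \<kappa> \<in> Z\<zeta>" by (intro subring_diff[OF Zzeta_subring] subring_1[OF Zzeta_subring] kZ)
    show "\<kappa> \<in> Z\<zeta>" "- \<kappa> \<in> Z\<zeta>" using kZ subring_uminus[OF Zzeta_subring] by auto
    have "(1 - \<kappa>)\<^sup>2 * \<kappa> = - 2 * \<kappa>\<^sup>2" unfolding sq by (simp add: power2_eq_square)
    thus "of_nat p = (1 - \<kappa>)\<^sup>2 * \<kappa>" by (simp add: True k2)
    show "(1 - \<kappa>) ^ 2 = of_nat p * - \<kappa>" unfolding sq by (simp add: True)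
  qed
next
  case False
  hence "odd p" using p(1) primes_dvd_imp_eq two_is_prime_nat by blast
  then obtain h where h: "p = 2 * h + 1" by (elim oddE)
  obtain e where e: "n = p * e" using p(2) by (elim dvdE)
  have e0: "e > 0" using n_pos e by (cases "e = 0") auto
  define \<kappa> where "\<kappa> = \<zeta> ^ e"
  have kp: "\<kappa> ^ p = 1" using zeta_power_n e by (simp add: \<kappa>_def mult.commute flip: power_mult)
  have k1: "\<kappa> \<noteq> 1"
  proof
    assume "\<kappa> = 1"
    hence "n dvd e" by (simp add: \<kappa>_def primitive_root_power_eq_1_iff[OF prim])
    hence "n \<le> e" using e0 by (intro dvd_imp_le) auto
    thus False using e e0 prime_gt_1_nat[OF p(1)] by simp
  qed
  define \<rho> where "\<rho> = 1 - \<kappa>"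
  define S where "S i = (\<Sum>l<i. \<kappa> ^ l)" for i :: nat
  define A where "A = (\<Sum>i<p. S i)"
  define C where "C = (\<Sum>i<p. \<Sum>l<i. S l)"
  have kZ: "\<kappa> \<in> Z\<zeta>" unfolding \<kappa>_def by (rule zeta_power_in_Zzeta)
  have SZ: "S i \<in> Z\<zeta>" for i
    unfolding S_def by (intro subring_sum[OF Zzeta_subring] subring_power[OF Zzeta_subring] kZ)
  have AZ: "A \<in> Z\<zeta>" and CZ: "C \<in> Z\<zeta>"
    unfolding A_def C_def by (intro subring_sum[OF Zzeta_subring] SZ)+
  have \<rho>Z: "\<rho> \<in> Z\<zeta>" unfolding \<rho>_def by (intro subring_diff[OF Zzeta_subring] subring_1[OF Zzeta_subring] kZ)
  have pw: "1 - \<kappa> ^ i = \<rho> * S i" for i by (simp add: \<rho>_def S_def one_diff_power_eq)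
  have "(\<Sum>i<p. \<kappa> ^ i) = 0" using kp k1 by (rule geometric_sum_root_of_unity)
  hence "of_nat p = (\<Sum>i<p. 1 - \<kappa> ^ i)" by (simp add: sum_subtractf)
  also have "\<dots> = \<rho> * A" by (simp add: pw A_def sum_distrib_left)
  finally have pA: "of_nat p = \<rho> * A" .
  \<comment> \<open>\<open>S i\<close> is a sum of \<open>i\<close> powers of \<kappa>, each
    congruent to 1 modulo \<rho>. So \<open>A\<close> is congruent to the sum of all
    \<open>i < p\<close>, which is \<open>p * h\<close> as \<open>p\<close> is odd. Since \<rho>
    divides \<open>p\<close>, it divides \<open>A\<close>, and this gives the second factor \<rho>
    of \<open>p\<close>.\<close>
  have "S i = of_nat i - \<rho> * (\<Sum>l<i. S l)" for i
  proof -
    have "of_nat i - S i = (\<Sum>l<i. 1 - \<kappa> ^ l)" by (simp add: S_def sum_subtractf)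
    also have "\<dots> = \<rho> * (\<Sum>l<i. S l)" by (simp add: pw sum_distrib_left)
    finally show ?thesis by (simp add: algebra_simps)
  qed
  hence "A = (\<Sum>i<p. of_nat i - \<rho> * (\<Sum>l<i. S l))" unfolding A_def by (intro sum.cong refl)
  also have "\<dots> = of_nat (\<Sum>i<p. i) - \<rho> * C" by (simp add: sum_subtractf C_def sum_distrib_left)
  also have "(\<Sum>i<p. i) = p * h"
  proof -
    have "2 * (\<Sum>i<p. i) = 2 * (p * h)"
      using gauss_sum_nat[of "2 * h"] by (simp add: h lessThan_Suc_atMost atLeast0AtMost)
    thus ?thesis by simp
  qed
  finally have "A = \<rho> * (A * of_nat h - C)" using pA by (simp add: algebra_simps)
  hence eq: "of_nat p = \<rho>\<^sup>2 * (A * of_nat h - C)" using pA by (metis mult.assoc power2_eq_square)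
  obtain c where c: "c \<in> Z\<zeta>" "(\<kappa> + \<rho>) ^ p ^ 1 = \<kappa> ^ p ^ 1 + \<rho> ^ p ^ 1 + of_nat p * c"
    using add_power_prime_power[OF Zzeta_subring p(1) kZ \<rho>Z, of 1] by blast
  have "\<kappa> + \<rho> = 1" by (simp add: \<rho>_def)
  hence "\<rho> ^ p = of_nat p * (- c)" using c(2) kp by (simp add: add_eq_0_iff)
  moreover have "A * of_nat h - C \<in> Z\<zeta>"
    by (intro subring_diff[OF Zzeta_subring] subring_mult[OF Zzeta_subring] subring_of_nat[OF Zzeta_subring] AZ CZ)
  ultimately show ?thesis using that[of \<rho> _ "- c" p] \<rho>Z eq c(1) subring_uminus[OF Zzeta_subring] by blast
qed

lemma reduced_if_ring_of_integers_adjoin_eq: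
  assumes eq: "B = ring_of_integers (adjoin_field L \<zeta>)" and n4: "\<not> [n = 2] (mod 4)"
    and p: "prime p" "p dvd n"
  shows "reduced_mod \<O> p"
  unfolding reduced_mod_def
proof (intro ballI impI)
  fix v assume v: "v \<in> \<O>" "v\<^sup>2 \<in> (*) (of_nat p) ` \<O>"
  have p0: "p > 0" using p(1) by (rule prime_gt_0_nat)
  obtain w where w: "w \<in> \<O>" "v\<^sup>2 = of_nat p * w" using v(2) by blast
  obtain \<rho> \<gamma> \<delta> N where \<rho>: "\<rho> \<in> Z\<zeta>" and \<gamma>: "\<gamma> \<in> Z\<zeta>" and \<delta>: "\<delta> \<in> Z\<zeta>"
    and p\<rho>: "of_nat p = \<rho>\<^sup>2 * \<gamma>" and \<rho>N: "\<rho> ^ N = of_nat p * \<delta>"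
    by (rule ex_ramified_element[OF p n4]) blast
  have \<rho>0: "\<rho> \<noteq> 0" using p\<rho> p0 by auto
  have ZB: "algebraic_int x" if "x \<in> Z\<zeta>" for x using that Zzeta_subset_B algebraic_int_B by blast
  define x where "x = v / \<rho>"
  have vx: "v = \<rho> * x" using \<rho>0 by (simp add: x_def)
  have "\<rho>\<^sup>2 * x\<^sup>2 = \<rho>\<^sup>2 * (\<gamma> * w)" using w(2) p\<rho> by (simp add: vx power_mult_distrib mult.assoc)
  hence x2: "x\<^sup>2 = \<gamma> * w" using \<rho>0 by simp
  have "algebraic_int (\<gamma> * w)" by (intro algebraic_int_mult ZB[OF \<gamma>] algebraic_int_O[OF w(1)])
  hence "algebraic_int x"
    by (rule algebraic_int_root[of _ "monom 1 2"]) (auto simp: x2 poly_monom degree_monom_eq coeff_monom)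
  moreover have "x \<in> adjoin_field L \<zeta>"
  proof -
    note F = is_subfield_adjoin_ring
    have "v \<in> adjoin_ring L \<zeta>" using v(1) O_subset_L adjoin_ring_base[OF L_subring] by blast
    moreover have "\<rho> \<in> adjoin_ring L \<zeta>" using \<rho> adjoin_ring_mono[OF Ints_subset_subring[OF L_subring]] by blast
    hence "inverse \<rho> \<in> adjoin_ring L \<zeta>" using F by (simp add: is_subfield_def)
    ultimately have "v * inverse \<rho> \<in> adjoin_ring L \<zeta>"
      by (rule subring_mult[OF is_subring_subfield[OF F]])
    thus ?thesis by (simp add: x_def adjoin_field_eq divide_inverse)
  qed
  ultimately have "x \<in> ring_of_integers (adjoin_field L \<zeta>)" unfolding ring_of_integers_def by blast
  hence "x \<in> B" unfolding eq .
  then obtain X0 where X0: "X0 \<in> polys_over \<O>" "x = poly X0 \<zeta>" by (auto simp: adjoin_ring_def)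
  obtain X H where X: "X \<in> polys_over \<O>" "degree X < degree \<Phi>"
    "\<And>z. primitive_root_of_unity n z \<Longrightarrow> poly X z = poly X0 z"
    by (rule reduce_mod_Phi[OF O_subring X0(1)]) blast
  define \<tau> where "\<tau> = \<rho> * \<gamma>"
  have "\<tau> \<in> Z\<zeta>" unfolding \<tau>_def by (intro subring_mult[OF Zzeta_subring] \<rho> \<gamma>)
  then obtain T0 where T0: "T0 \<in> polys_over \<int>" "\<tau> = poly T0 \<zeta>" by (auto simp: adjoin_ring_def)
  obtain T H' where T: "T \<in> polys_over \<int>" "degree T < degree \<Phi>"
    "\<And>z. primitive_root_of_unity n z \<Longrightarrow> poly T z = poly T0 z"
    by (rule reduce_mod_Phi[OF is_subring_Ints T0(1)]) blast
  have xX: "poly X \<zeta> = x" and tT: "poly T \<zeta> = \<tau>" using X(3)[OF prim] T(3)[OF prim] X0 T0 by auto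
  \<comment> \<open>As \<tau> is \<open>p / \<rho>\<close>, the equation
    \<open>v * \<tau> = p * x\<close> holds. Both sides are expanded in powers of \<zeta> below the
    degree of \<Phi>, so it holds coefficient by coefficient.\<close>
  have "smult v T - smult (of_nat p) X = 0"
  proof (rule small_poly_eq_0)
    have "v * coeff T i - of_nat p * coeff X i \<in> L" for i
    proof -
      have "v \<in> L" "coeff X i \<in> L" using v(1) X(1) O_subset_L by (auto simp: polys_over_def)
      moreover have "coeff T i \<in> L"
        using T(1) Ints_subset_subring[OF L_subring] by (auto simp: polys_over_def)
      ultimately show ?thesis
        by (intro subring_diff[OF L_subring] subring_mult[OF L_subring] subring_of_nat[OF L_subring])
    qed
    thus "smult v T - smult (of_nat p) X \<in> polys_over L" by (simp add: polys_over_def)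
    have "v * \<tau> = of_nat p * x" unfolding vx \<tau>_def p\<rho> by (simp add: power2_eq_square)
    thus "poly (smult v T - smult (of_nat p) X) \<zeta> = 0" by (simp add: xX tT)
    have "degree (smult v T - smult (of_nat p) X) \<le> max (degree (smult v T)) (degree (smult (of_nat p) X))"
      by (rule degree_diff_le_max)
    also have "\<dots> < degree \<Phi>"
      using T(2) X(2) degree_smult_le[of v T] degree_smult_le[of "of_nat p" X] by simp
    finally show "degree (smult v T - smult (of_nat p) X) < degree \<Phi>" .
  qed
  hence coeffs: "v * coeff T i = of_nat p * coeff X i" for i
    by (metis coeff_smult eq_iff_diff_eq_0)
  have "\<forall>i. \<exists>k. coeff T i = of_int k" using T(1) by (auto simp: polys_over_def elim: Ints_cases)
  then obtain t where t: "\<And>i. coeff T i = of_int (t i)" using choice[of "\<lambda>i k. coeff T i = of_int k"] by blast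
  \<comment> \<open>Otherwise \<tau> would be \<open>p\<close> times an algebraic integer \<sigma>,
    whence \<open>\<rho> * \<sigma> = 1\<close>; taking \<open>N\<close>-th powers would make
    \<open>p\<close> a unit.\<close>
  have "\<exists>i. \<not> int p dvd t i"
  proof (rule ccontr)
    assume "\<nexists>i. \<not> int p dvd t i"
    hence dv: "t i = int p * (t i div int p)" for i by simp
    define \<sigma> where "\<sigma> = (\<Sum>i\<le>degree T. of_int (t i div int p) * \<zeta> ^ i)"
    have "\<tau> = (\<Sum>i\<le>degree T. of_int (int p * (t i div int p)) * \<zeta> ^ i)"
      unfolding tT[symmetric] poly_altdef using t dv by (intro sum.cong refl) metis
    also have "\<dots> = of_nat p * \<sigma>" by (simp add: \<sigma>_def sum_distrib_left mult.assoc)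
    finally have "\<tau> = of_nat p * \<sigma>" .
    hence "of_nat p * (\<rho> * \<sigma>) = \<rho> * \<tau>" by simp
    also have "\<dots> = of_nat p" using p\<rho> by (simp add: \<tau>_def power2_eq_square mult.assoc)
    finally have "\<rho> * \<sigma> = 1" using p0 by simp
    hence "\<rho> ^ N * \<sigma> ^ N = 1" by (simp flip: power_mult_distrib)
    hence "of_nat p * (\<delta> * \<sigma> ^ N) = 1" by (simp add: \<rho>N mult.assoc)
    moreover have "algebraic_int (\<delta> * \<sigma> ^ N)"
      unfolding \<sigma>_def by (intro algebraic_int_mult algebraic_int_power algebraic_int_sum ZB[OF \<delta>]
          algebraic_int_of_int algebraic_int_zeta)
    ultimately show False using not_algebraic_int_inverse_prime[OF p(1)] by blast
  qed
  \<comment> \<open>The product of \<open>v\<close> with \<open>t i\<close> is a multiple of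
    \<open>p\<close>, and \<open>t i\<close> is prime to \<open>p\<close>, so \<open>v\<close> is a
    multiple as well. The sign only turns \<open>t i\<close> into a natural number.\<close>
  then obtain i where i: "\<not> int p dvd t i" by blast
  have "coprime p (nat \<bar>t i\<bar>)"
    using i p(1) by (intro prime_imp_coprime) (auto simp: int_dvd_int_iff[symmetric])
  moreover have "of_nat (nat \<bar>t i\<bar>) * v = of_nat p * (of_int (sgn (t i)) * coeff X i)"
  proof -
    have "(of_nat (nat \<bar>t i\<bar>) :: 'a) = of_int \<bar>t i\<bar>" by simp
    also have "\<dots> = of_int (sgn (t i)) * of_int (t i)" by (simp only: abs_sgn of_int_mult mult.commute)
    finally have "(of_nat (nat \<bar>t i\<bar>) :: 'a) = of_int (sgn (t i)) * of_int (t i)" .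
    thus ?thesis using coeffs[of i] by (simp add: t mult_ac)
  qed
  moreover have "of_int (sgn (t i)) * coeff X i \<in> \<O>"
    using X(1) by (intro subring_mult[OF O_subring] subring_of_int[OF O_subring]) (simp add: polys_over_def)
  ultimately obtain y where "y \<in> \<O>" "v = of_nat p * y"
    using bezout_combination[OF O_subring _ _ v(1)] by blast
  thus "v \<in> (*) (of_nat p) ` \<O>" by blast
qed

end

section \<open>Both directions combined over the primes dividing n\<close>

lemma reduced_mod_iff_not_dvd_discriminant:
  assumes "number_field L" "prime p"
  shows "reduced_mod (ring_of_integers L) p \<longleftrightarrow> \<not> int p dvd discriminant L"
  using prime_dvd_discriminant_iff[OF assms] unfolding reduced_mod_def by blast

theorem corollary3p2:
  fixes n :: nat and \<zeta> :: "'a :: field_char_0" and L :: "'a set"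
  assumes "n > 2" and "\<not> [n = 2] (mod 4)"
    and "primitive_root_of_unity n \<zeta>"
    and "number_field L"
    and "irreducible_over L (cyclotomic_poly n)"
  shows "adjoin_ring (ring_of_integers L) \<zeta> = ring_of_integers (adjoin_field L \<zeta>)
     \<longleftrightarrow> gcd (int n) (discriminant L) = 1"
proof -
  interpret cyclotomic_extension L n \<zeta>
    using assms by unfold_locales
  have "gcd (int n) (discriminant L) = 1 \<longleftrightarrow> (\<forall>p. prime p \<longrightarrow> p dvd n \<longrightarrow> \<not> int p dvd discriminant L)"
  proof
    assume g: "gcd (int n) (discriminant L) = 1"
    show "\<forall>p. prime p \<longrightarrow> p dvd n \<longrightarrow> \<not> int p dvd discriminant L"
    proof (intro allI impI notI)
      fix p assume p: "prime p" "p dvd n" "int p dvd discriminant L"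
      hence "int p dvd gcd (int n) (discriminant L)" by simp
      thus False using g p(1) by simp
    qed
  next
    assume *: "\<forall>p. prime p \<longrightarrow> p dvd n \<longrightarrow> \<not> int p dvd discriminant L"
    show "gcd (int n) (discriminant L) = 1"
    proof (rule ccontr)
      assume "gcd (int n) (discriminant L) \<noteq> 1"
      hence "nat (gcd (int n) (discriminant L)) \<noteq> 1" by (simp add: nat_eq_iff)
      then obtain p where p: "prime p" "p dvd nat (gcd (int n) (discriminant L))"
        using prime_factor_nat by blast
      have "int p dvd int (nat (gcd (int n) (discriminant L)))" using p(2) by (simp only: int_dvd_int_iff)
      hence g: "int p dvd gcd (int n) (discriminant L)" by simp
      have "p dvd n" using dvd_trans[OF g gcd_dvd1] by (simp only: int_dvd_int_iff)
      moreover have "int p dvd discriminant L" by (rule dvd_trans[OF g gcd_dvd2])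
      ultimately show False using * p(1) by blast
    qed
  qed
  also have "\<dots> \<longleftrightarrow> (\<forall>p. prime p \<longrightarrow> p dvd n \<longrightarrow> reduced_mod \<O> p)"
    using reduced_mod_iff_not_dvd_discriminant[OF L] by blast
  also have "\<dots> \<longleftrightarrow> B = ring_of_integers (adjoin_field L \<zeta>)"
    using ring_of_integers_adjoin_eq_if_reduced reduced_if_ring_of_integers_adjoin_eq[OF _ assms(2)] by blast
  finally show ?thesis by (rule sym)
qed

end
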